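(* Let $n\ge 7$ and let $(u_\lambda)$ be a family of least energy radial sign-changing solutions of $$-\Delta u=\lambda u+|u|^{2^*-2}u \ \text{ in } B_1,\qquad u=0\ \text{ on }\partial B_1,$$ with $u_\lambda(0)>0$. As $\lambda\to0$ we have: (i) $M_{\lambda,+}^{2-2\beta}\,r_\lambda^{n-2}\,\lambda\to c(n)$; (ii) $M_{\lambda,-}^{2-2\beta}\,\lambda\to c(n)$; (iii) $\displaystyle\frac{M_{\lambda,-}^{2-2\beta}}{M_{\lambda,+}^{2-2\beta}\,r_\lambda^{n-2}}\to1$, where $c(n):=\frac{c_1^2(n)}{c_2(n)}$, $c_1(n):=\int_0^\infty\delta_{0,\mu}^{2^*-1}(s)s^{n-1}ds$, $c_2(n):=2\int_0^\infty\delta_{0,\mu}^2(s)s^{n-1}ds$, and $\mu=\sqrt{n(n-2)}$.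
   Context: $B_1$ is the open unit ball of $\mathbb{R}^n$, $2^*=\frac{2n}{n-2}$, $\beta:=\frac{2}{n-2}$, and $\lambda_1$ is the first Dirichlet eigenvalue of $-\Delta$ in $B_1$. A least energy radial sign-changing solution is a radial sign-changing solution minimizing $I_\lambda(u)=\frac12\int_{B_1}(|\nabla u|^2-\lambda u^2)\,dx-\frac1{2^*}\int_{B_1}|u|^{2^*}dx$ among all radial sign-changing solutions of the problem with parameter $\lambda$. The family consists of one such solution $u_\lambda$ for each $\lambda\in(0,\lambda_1)$; $\lambda\to 0$ means $\lambda\to0^+$. Solutions are classical; write $u_\lambda=u_\lambda(r)$, $r=|x|$. Each $u_\lambda$ has exactly two nodal regions: there is a node $r_\lambda\in(0,1)$ with $u_\lambda>0$ in $B_{r_\lambda}=\{|x|<r_\lambda\}$ and $u_\lambda<0$ in $A_{r_\lambda}:=\{r_\lambda<|x|<1\}$. Moreover $u_\lambda^+=\max(u_\lambda,0)$, $u_\lambda^-=\max(-u_\lambda,0)$, $M_{\lambda,\pm}:=\|u_\lambda^\pm\|_\infty$. $\delta_{0,\mu}(x):=\dfrac{[n(n-2)\mu^2]^{(n-2)/4}}{[\mu^2+|x|^2]^{(n-2)/2}}$, and $\delta_{0,\mu}(s)$ denotes its radial profile, $s=|x|$. *)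

theory Defs
  imports "HOL-Analysis.Analysis"
begin

definition partial_deriv :: "'n::finite \<Rightarrow> (real^'n \<Rightarrow> real) \<Rightarrow> real^'n \<Rightarrow> real" where
  "partial_deriv i u x = frechet_derivative u (at x) (axis i 1)"

definition grad :: "(real^'n::finite \<Rightarrow> real) \<Rightarrow> real^'n \<Rightarrow> real^'n" where
  "grad u x = (\<chi> i. partial_deriv i u x)"

definition laplacian :: "(real^'n::finite \<Rightarrow> real) \<Rightarrow> real^'n \<Rightarrow> real" where
  "laplacian u x = (\<Sum>i\<in>UNIV. partial_deriv i (partial_deriv i u) x)"

text \<open>Intended for open sets only.\<close>
definition C2_on :: "(real^'n::finite) set \<Rightarrow> (real^'n \<Rightarrow> real) \<Rightarrow> bool" where
  "C2_on S u \<longleftrightarrow>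
     (\<forall>x\<in>S. u differentiable (at x)) \<and>
     (\<forall>i. \<forall>x\<in>S. partial_deriv i u differentiable (at x)) \<and>
     (\<forall>i j. continuous_on S (partial_deriv i (partial_deriv j u)))"

text \<open>Classical solutions of the Dirichlet problem for \<open>-\<Delta>u = f(u)\<close>.
  The values of \<open>u\<close> outside the closure of \<open>S\<close> are irrelevant.\<close>
definition dirichlet_solution ::
    "(real^'n::finite) set \<Rightarrow> (real \<Rightarrow> real) \<Rightarrow> (real^'n \<Rightarrow> real) \<Rightarrow> bool" where
  "dirichlet_solution S f u \<longleftrightarrow>
     C2_on S u \<and> continuous_on (closure S) u \<and>
     (\<forall>x\<in>S. - laplacian u x = f (u x)) \<and> (\<forall>x\<in>frontier S. u x = 0)"

definition dirichlet_eigenvalue :: "(real^'n::finite) set \<Rightarrow> real \<Rightarrow> bool" where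
  "dirichlet_eigenvalue S l \<longleftrightarrow>
     (\<exists>\<phi>. dirichlet_solution S (\<lambda>t. l * t) \<phi> \<and> (\<exists>x\<in>S. \<phi> x \<noteq> 0))"

definition first_dirichlet_eigenvalue :: "(real^'n::finite) set \<Rightarrow> real" where
  "first_dirichlet_eigenvalue S = Inf {l. dirichlet_eigenvalue S l}"

definition crit_exp :: "nat \<Rightarrow> real" where
  "crit_exp n = 2 * real n / (real n - 2)"

definition beta_exp :: "nat \<Rightarrow> real" where
  "beta_exp n = 2 / (real n - 2)"

definition BN_solution :: "real \<Rightarrow> (real^'n::finite \<Rightarrow> real) \<Rightarrow> bool" where
  "BN_solution l u \<longleftrightarrow>
     dirichlet_solution (ball 0 1)
       (\<lambda>t. l * t + \<bar>t\<bar> powr (crit_exp CARD('n) - 2) * t) u"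

definition radial :: "(real^'n::finite \<Rightarrow> real) \<Rightarrow> bool" where
  "radial u \<longleftrightarrow> (\<forall>x\<in>cball 0 1. \<forall>y\<in>cball 0 1. norm x = norm y \<longrightarrow> u x = u y)"

definition sign_changing :: "(real^'n::finite \<Rightarrow> real) \<Rightarrow> bool" where
  "sign_changing u \<longleftrightarrow> (\<exists>x\<in>ball 0 1. u x > 0) \<and> (\<exists>x\<in>ball 0 1. u x < 0)"

definition energy :: "real \<Rightarrow> (real^'n::finite \<Rightarrow> real) \<Rightarrow> real" where
  "energy l u =
     1/2 * (LINT x:ball 0 1|lborel. (norm (grad u x))\<^sup>2 - l * (u x)\<^sup>2)
     - 1 / crit_exp CARD('n) * (LINT x:ball 0 1|lborel. \<bar>u x\<bar> powr crit_exp CARD('n))"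

definition radial_sign_changing_solution :: "real \<Rightarrow> (real^'n::finite \<Rightarrow> real) \<Rightarrow> bool" where
  "radial_sign_changing_solution l u \<longleftrightarrow> BN_solution l u \<and> radial u \<and> sign_changing u"

definition least_energy_radial_sign_changing :: "real \<Rightarrow> (real^'n::finite \<Rightarrow> real) \<Rightarrow> bool" where
  "least_energy_radial_sign_changing l u \<longleftrightarrow>
     radial_sign_changing_solution l u \<and>
     (\<forall>v::real^'n \<Rightarrow> real. radial_sign_changing_solution l v \<longrightarrow> energy l u \<le> energy l v)"

definition is_node :: "(real^'n::finite \<Rightarrow> real) \<Rightarrow> real \<Rightarrow> bool" where
  "is_node u r \<longleftrightarrow> 0 < r \<and> r < 1 \<and>
     (\<forall>x. norm x < r \<longrightarrow> u x > 0) \<and> (\<forall>x. r < norm x \<and> norm x < 1 \<longrightarrow> u x < 0)"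

text \<open>For continuous functions on the closed ball this is the \<open>L\<^sup>\<infinity>\<close> norm on the unit ball.\<close>
definition sup_norm :: "(real^'n::finite \<Rightarrow> real) \<Rightarrow> real" where
  "sup_norm f = (SUP x\<in>ball 0 1. \<bar>f x\<bar>)"

definition M_pos :: "(real^'n::finite \<Rightarrow> real) \<Rightarrow> real" where
  "M_pos u = sup_norm (\<lambda>x. max (u x) 0)"

definition M_neg :: "(real^'n::finite \<Rightarrow> real) \<Rightarrow> real" where
  "M_neg u = sup_norm (\<lambda>x. max (- u x) 0)"

definition bubble :: "nat \<Rightarrow> real \<Rightarrow> real \<Rightarrow> real" where
  "bubble n \<mu> s =
     (real n * (real n - 2) * \<mu>\<^sup>2) powr ((real n - 2) / 4)
       / (\<mu>\<^sup>2 + s\<^sup>2) powr ((real n - 2) / 2)"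

definition mu :: "nat \<Rightarrow> real" where
  "mu n = sqrt (real n * (real n - 2))"

definition c1 :: "nat \<Rightarrow> real" where
  "c1 n = (LINT s:{0..}|lborel. bubble n (mu n) s powr (crit_exp n - 1) * s ^ (n - 1))"

definition c2 :: "nat \<Rightarrow> real" where
  "c2 n = 2 * (LINT s:{0..}|lborel. (bubble n (mu n) s)\<^sup>2 * s ^ (n - 1))"

definition c_limit :: "nat \<Rightarrow> real" where
  "c_limit n = (c1 n)\<^sup>2 / c2 n"

end

theory Submission
  imports Defs
begin

text \<open>
  Write \<open>u\<^sub>\<lambda>(x) = w(|x|)\<close> and \<open>K(s) = - s^(n-1) w'(s)\<close>; on each nodal interval the equation becomes the system
  \<open>w' = - K / s^(n-1)\<close>, \<open>K' = s^(n-1) (\<lambda> w + w^p)\<close> with \<open>p = 2* - 1\<close>, and the Pohozaev functional \<open>P\<close> satisfies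
  \<open>P' = \<lambda> s^(n-1) w\<^sup>2\<close>. Consider an arc that starts at a critical point \<open>a\<close> with value \<open>1\<close> (after rescaling)
  and decreases to a zero \<open>b\<close>. Positivity of \<open>P - \<lambda> s^n w\<^sup>2 / n\<close> says exactly that \<open>\<zeta>' / s\<close> is nondecreasing for
  \<open>\<zeta> = w^(-2/(n-2))\<close>, which bounds \<open>w\<close> from above by a multiple of the standard bubble, the factor tending
  to \<open>1\<close> as \<open>a\<close> tends to \<open>0\<close>. Integrating the equation once more with this bound gives a matching lower
  bound. Hence, as \<open>a\<close> and \<open>\<lambda> b\<^sup>2\<close> tend to \<open>0\<close>, \<open>K(b)\<close> tends to \<open>c\<^sub>1\<close> and \<open>\<integral> s^(n-1) w\<^sup>2\<close> tends to \<open>c\<^sub>2 / 2\<close>.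

  Applied to \<open>[0, r\<^sub>\<lambda>]\<close>, the Pohozaev identity turns these two limits into (i). The value of \<open>P\<close> at \<open>r\<^sub>\<lambda>\<close> forces
  the minimum point \<open>s\<^sub>\<lambda>\<close> of \<open>u\<^sub>\<lambda>\<close> to be small on the scale of the negative part, so the same analysis applies to
  \<open>-u\<^sub>\<lambda>\<close> on \<open>[s\<^sub>\<lambda>, 1]\<close>; comparing with (i) shows that the contribution of the positive part to the Pohozaev
  identity on \<open>[0, 1]\<close> is negligible, which is (ii).
\<close>


text \<open>The exponents come from the critical scaling w(t/\<sigma>) / \<sigma>^((n-2)/2),
  \<lambda> -> \<lambda>/\<sigma>^2, with \<sigma> = M^\<beta> for the maximum M of the arc; note
  that 2 - 2\<beta> = \<beta> (n-4). At a zero of w only the term in K^2 survives in P. On the core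
  this gives K(r)^2 / (2 r^(n-2)) = \<lambda> times the integral of s^(n-1) w^2, and multiplication
  by \<sigma>^(n-2) isolates \<sigma>^(n-4) r^(n-2) \<lambda> as a quotient with limit c_1^2 / c_2.
  The obstacle is the negative part: neither the blow-up of its maximum nor the position of its
  minimum point is known beforehand. Smallness of s_\<lambda> on its scale needs only that
  \<sigma>^2 times the integral over the core stays bounded. The blow-up and r_\<lambda> -> 0 then
  follow, and r_\<lambda> -> 0 is what makes the positive contribution negligible. Square
  integrability of the bubble and the exponent n-4 both ask for n > 4. The hypotheses speak only of
  0 < \<lambda> < \<lambda>_1, with \<lambda>_1 defined as an infimum, so a proof that \<lambda>_1 >
  0 is part of the work.\<close>

lemma crit_exp_ge: "n \<ge> 5 \<Longrightarrow> crit_exp n > 2"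
  by (simp add: crit_exp_def field_simps)

text \<open>Derivatives are asked only inside the interval: the radial system divides by s^(n-1),
  and at the end points of an arc only continuity is available.\<close>

lemma LINT_FTC_interior:
  fixes F f :: "real \<Rightarrow> real"
  assumes "a \<le> b" "continuous_on {a..b} F" "continuous_on {a..b} f"
    and "\<And>x. a < x \<Longrightarrow> x < b \<Longrightarrow> (F has_real_derivative f x) (at x)"
  shows "(LINT x:{a..b}|lborel. f x) = F b - F a"
proof -
  have "(f has_integral F b - F a) {a..b}"
    using assms by (intro fundamental_theorem_of_calculus_interior)
      (auto simp: has_real_derivative_iff_has_vector_derivative)
  moreover have "set_integrable lborel {a..b} f"
    by (rule borel_integrable_atLeastAtMost') fact
  ultimately show ?thesis
    by (simp add: set_borel_integral_eq_integral integral_unique)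
qed

lemma derivative_le_imp_increment_le:
  fixes f g :: "real \<Rightarrow> real"
  assumes "a \<le> b" "continuous_on {a..b} f" "continuous_on {a..b} g"
    and "\<And>x. a < x \<Longrightarrow> x < b \<Longrightarrow> (f has_real_derivative f' x) (at x)"
    and "\<And>x. a < x \<Longrightarrow> x < b \<Longrightarrow> (g has_real_derivative g' x) (at x)"
    and "\<And>x. a < x \<Longrightarrow> x < b \<Longrightarrow> f' x \<le> g' x"
  shows "f b - f a \<le> g b - g a"
proof -
  have "g a - f a \<le> g b - f b"
  proof (rule DERIV_nonneg_imp_increasing_open[where f = "\<lambda>x. g x - f x"])
    fix x assume "a < x" "x < b"
    with assms(4-6) have "((\<lambda>x. g x - f x) has_real_derivative g' x - f' x) (at x)" "g' x - f' x \<ge> 0"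
      by (auto intro: DERIV_diff)
    then show "\<exists>y. ((\<lambda>x. g x - f x) has_real_derivative y) (at x) \<and> y \<ge> 0" by blast
  qed (use assms in \<open>auto intro: continuous_on_diff\<close>)
  then show ?thesis by simp
qed

section \<open>Arcs of radial solutions and the Pohozaev functional\<close>

text \<open>\<open>K\<close> carries no sign and \<open>w\<close> may vanish at both ends, so one
  locale serves the positive core as well as the rising and the falling part of the negative region.
  \<open>start\<close> controls K^2 / s^(n-2) when the arc begins at the origin.\<close>

locale radial_arc =
  fixes n :: nat and l a b :: real and w K :: "real \<Rightarrow> real"
  assumes n5: "n \<ge> 5" and l_pos: "l > 0" and a_nonneg: "0 \<le> a" and ab: "a < b"
    and w_cont: "continuous_on {a..b} w" and K_cont: "continuous_on {a..b} K"
    and w_pos: "\<And>s. a < s \<Longrightarrow> s < b \<Longrightarrow> w s > 0"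
    and w_deriv: "\<And>s. a < s \<Longrightarrow> s < b \<Longrightarrow> (w has_real_derivative - K s / s ^ (n - 1)) (at s)"
    and K_deriv: "\<And>s. a < s \<Longrightarrow> s < b \<Longrightarrow>
      (K has_real_derivative s ^ (n - 1) * (l * w s + w s powr (crit_exp n - 1))) (at s)"
    and start: "a > 0 \<or> K a = 0"
begin

text \<open>The classical s^n (w'^2 / 2 + F(w)) + (n-2)/2 s^(n-1) w w', where F(t) = l t^2 / 2 + t^q
  / q and q = \<open>crit_exp n\<close>, after w' is replaced by - K / s^(n-1).\<close>

definition pohozaev :: "real \<Rightarrow> real" where
  "pohozaev s = (K s)\<^sup>2 / (2 * s ^ (n - 2))
     + s ^ n * (l * (w s)\<^sup>2 / 2 + w s powr crit_exp n / crit_exp n)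
     - (real n - 2) / 2 * w s * K s"

lemma w_nonneg: "s \<in> {a..b} \<Longrightarrow> w s \<ge> 0"
proof -
  assume s: "s \<in> {a..b}"
  have "w s \<in> closure {0<..}"
  proof (rule subsetD)
    show "w ` closure {a<..<b} \<subseteq> closure {0<..}"
      using w_cont w_pos ab by (intro image_closure_subset) (auto intro: less_imp_le)
    show "w s \<in> w ` closure {a<..<b}" using s ab by auto
  qed
  then show ?thesis by simp
qed

lemma force_cont: "continuous_on {a..b} (\<lambda>s. s ^ (n - 1) * (l * w s + w s powr (crit_exp n - 1)))"
  using crit_exp_ge[OF n5] w_nonneg
  by (intro continuous_intros w_cont continuous_on_powr') auto

text \<open>Criticality is the point: n / q = (n-2) / 2 for q = \<open>crit_exp n\<close>, so the
  terms in w^q cancel, while the linear term is left with the factor n/2 - (n-2)/2 = 1.\<close>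

lemma has_derivative_pohozaev:
  assumes "a < s" "s < b"
  shows "(pohozaev has_real_derivative l * s ^ (n - 1) * (w s)\<^sup>2) (at s)"
proof -
  have s: "s > 0" using assms a_nonneg by simp
  have w: "w s > 0" using w_pos assms by simp
  obtain k where k: "n = Suc (Suc k)" using n5 le_Suc_ex[of 2 n] by auto
  have k1: "real k > 0" using n5 k by auto
  define A where "A = s ^ k"
  have A: "A > 0" using s by (simp add: A_def)
  define q where "q = crit_exp n"
  have q: "q = 2 * (real k + 2) / real k" by (simp add: q_def crit_exp_def k)
  have q0: "q > 0" using k1 by (simp add: q)
  define W where "W = w s powr (q - 1)"
  have Wq: "w s powr q = w s * W"
    unfolding W_def using w by (simp add: powr_mult_base)
  have dw: "(w has_real_derivative - K s / (s * A)) (at s)"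
    using w_deriv[OF assms] by (simp add: k A_def)
  have dK: "(K has_real_derivative s * A * (l * w s + W)) (at s)"
    using K_deriv[OF assms] by (simp add: k A_def W_def q_def)
  have dq: "((\<lambda>s. w s powr q) has_real_derivative q * W * (- K s / (s * A))) (at s)"
    unfolding W_def using DERIV_chain2[OF has_real_derivative_powr[OF w] dw] .
  have dk: "((\<lambda>s. s ^ k) has_real_derivative real k * A / s) (at s)"
    using s k1 DERIV_pow[of k s UNIV] unfolding A_def by (simp add: power_eq_if[of s k])
  have dn: "((\<lambda>s. s ^ n) has_real_derivative real n * (s * A)) (at s)"
    by (rule derivative_eq_intros refl)+ (simp add: k A_def)
  define Q B N where "Q = (\<lambda>s. w s powr q)" and "B = (\<lambda>s::real. s ^ k)" and "N = (\<lambda>s::real. s ^ n)"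
  have QBN: "Q s = w s powr q" "B s = A" "N s = s ^ n" by (simp_all add: Q_def B_def A_def N_def)
  have dQ: "(Q has_real_derivative q * W * (- K s / (s * A))) (at s)"
    and dB: "(B has_real_derivative real k * A / s) (at s)"
    and dN: "(N has_real_derivative real n * (s * A)) (at s)"
    using dq dk dn by (simp_all add: Q_def B_def N_def)
  define X where "X = K s / (s * A)"
  have KX: "K s = X * s * A" using s A by (simp add: X_def)
  define F where "F = l * w s + W"
  have dw': "(w has_real_derivative - X) (at s)" using dw by (simp add: X_def)
  have dQ': "(Q has_real_derivative - (q * W * X)) (at s)" using dQ by (simp add: X_def)
  have dK': "(K has_real_derivative s * A * F) (at s)" using dK by (simp add: F_def)
  have "((\<lambda>s. (K s)\<^sup>2 / (2 * B s)) has_real_derivative X * s * (s * A * F) - real k / 2 * X\<^sup>2 * s * A) (at s)"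
    by (rule DERIV_cong[OF DERIV_divide[OF DERIV_power[OF dK', of 2] DERIV_cmult[OF dB, of 2]]])
      (use s A in \<open>simp_all add: QBN KX field_simps power2_eq_square\<close>)
  moreover have "((\<lambda>s. N s * (l * (w s)\<^sup>2 / 2 + Q s / q)) has_real_derivative
      real n * (s * A) * (l * (w s)\<^sup>2 / 2 + w s * W / q) - s * s * A * (F * X)) (at s)"
    by (rule DERIV_cong[OF DERIV_mult[OF dN DERIV_add[OF DERIV_cdivide[OF DERIV_cmult[OF DERIV_power[OF dw', of 2]]] DERIV_cdivide[OF dQ']]]])
      (use q0 in \<open>simp add: QBN F_def Wq k A_def algebra_simps\<close>)
  moreover have "((\<lambda>s. real k / 2 * w s * K s) has_real_derivative
      real k / 2 * (w s * (s * A * F)) - real k / 2 * X\<^sup>2 * s * A) (at s)"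
    by (rule DERIV_cong[OF DERIV_mult[OF DERIV_cmult[OF dw'] dK']])
      (simp add: KX algebra_simps power2_eq_square)
  ultimately have "((\<lambda>s. (K s)\<^sup>2 / (2 * B s) + N s * (l * (w s)\<^sup>2 / 2 + Q s / q) - real k / 2 * w s * K s)
     has_real_derivative
      (X * s * (s * A * F) - real k / 2 * X\<^sup>2 * s * A
      + (real n * (s * A) * (l * (w s)\<^sup>2 / 2 + w s * W / q) - s * s * A * (F * X)))
      - (real k / 2 * (w s * (s * A * F)) - real k / 2 * X\<^sup>2 * s * A)) (at s)"
    by (intro DERIV_diff DERIV_add)
  moreover have "(X * s * (s * A * F) - real k / 2 * X\<^sup>2 * s * A
      + (real n * (s * A) * (l * (w s)\<^sup>2 / 2 + w s * W / q) - s * s * A * (F * X)))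
      - (real k / 2 * (w s * (s * A * F)) - real k / 2 * X\<^sup>2 * s * A) = l * (s * A) * (w s)\<^sup>2"
  proof -
    have 2: "real n * (w s * W / q) = real k / 2 * (w s * W)"
      using k1 by (simp add: q k field_simps)
    have 3: "real n * (s * A) * (l * (w s)\<^sup>2 / 2 + w s * W / q)
      = s * A * (real n * l * (w s)\<^sup>2 / 2 + real k / 2 * (w s * W))"
      unfolding 2[symmetric] by (simp add: algebra_simps)
    show ?thesis unfolding 3 F_def by (simp add: k algebra_simps power2_eq_square)
  qed
  moreover have "pohozaev = (\<lambda>s. (K s)\<^sup>2 / (2 * B s) + N s * (l * (w s)\<^sup>2 / 2 + Q s / q) - real k / 2 * w s * K s)"
  proof -
    have "n - 2 = k" "real n - 2 = real k" by (simp_all add: k)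
    then show ?thesis by (simp add: fun_eq_iff pohozaev_def Q_def B_def N_def q_def)
  qed
  moreover have "s ^ (n - 1) = s * A" by (simp add: k A_def)
  ultimately show ?thesis by (metis (no_types, lifting))
qed

text \<open>Only an arc that starts at the origin needs care. The bracket multiplying s^(n-1) in K'
  is bounded, hence |K| <= C s^n and the quotient K^2 / s^(n-2) is of order s^(n+2).\<close>

lemma pohozaev_cont: "continuous_on {a..b} pohozaev"
proof -
  have main: "continuous_on {a..b} (\<lambda>s. (K s)\<^sup>2 / (2 * s ^ (n - 2)))"
  proof (cases "a > 0")
    case True
    then show ?thesis by (intro continuous_intros K_cont) auto
  next
    case False
    then have a0: "a = 0" and K0: "K 0 = 0" using a_nonneg start by auto
    have "bounded ((\<lambda>s. l * w s + w s powr (crit_exp n - 1)) ` {a..b})"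
      using crit_exp_ge[OF n5] w_nonneg
      by (intro compact_imp_bounded compact_continuous_image continuous_intros w_cont continuous_on_powr') auto
    then obtain C where C: "\<forall>s\<in>{a..b}. \<bar>l * w s + w s powr (crit_exp n - 1)\<bar> \<le> C"
      by (auto simp: bounded_iff)
    have K_le: "\<bar>K s\<bar> \<le> C * s ^ n" if s: "s \<in> {0..b}" for s
    proof -
      have d: "((\<lambda>s. C * s ^ n) has_real_derivative C * (real n * x ^ (n - 1))) (at x)" for x
        by (rule derivative_eq_intros refl)+ simp
      have C0: "C \<ge> 0" using bspec[OF C, of a] ab by auto
      have C': "\<bar>x ^ (n - 1) * (l * w x + w x powr (crit_exp n - 1))\<bar> \<le> C * (real n * x ^ (n - 1))"
        if x: "0 < x" "x < s" for x
      proof -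
        have "\<bar>l * w x + w x powr (crit_exp n - 1)\<bar> \<le> C"
          using x s a0 by (intro bspec[OF C]) auto
        also have "C \<le> C * real n" using C0 n5 by (simp add: mult_le_cancel_left1)
        finally have "\<bar>l * w x + w x powr (crit_exp n - 1)\<bar> * x ^ (n - 1) \<le> C * real n * x ^ (n - 1)"
          using x by (intro mult_right_mono) auto
        then show ?thesis using x by (simp add: abs_mult mult_ac)
      qed
      have K_cont': "continuous_on {0..s} K" using s a0 by (intro continuous_on_subset[OF K_cont]) auto
      have cont: "continuous_on {0..s} (\<lambda>s. C * s ^ n)" by (intro continuous_intros)
      have "K s - K 0 \<le> C * s ^ n - C * 0 ^ n"
      proof (rule derivative_le_imp_increment_le[where f = K and g = "\<lambda>s. C * s ^ n", OF _ K_cont' cont K_deriv d])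
        fix x assume x: "0 < x" "x < s"
        show "x ^ (n - 1) * (l * w x + w x powr (crit_exp n - 1)) \<le> C * (real n * x ^ (n - 1))"
          using C'[OF x] by (simp only: abs_le_iff)
      qed (use s a0 in auto)
      moreover have "(- (C * s ^ n)) - (- (C * 0 ^ n)) \<le> K s - K 0"
      proof (rule derivative_le_imp_increment_le[where g = K and f = "\<lambda>s. - (C * s ^ n)", OF _ continuous_on_minus[OF cont] K_cont' DERIV_minus[OF d] K_deriv])
        fix x assume x: "0 < x" "x < s"
        show "- (C * (real n * x ^ (n - 1))) \<le> x ^ (n - 1) * (l * w x + w x powr (crit_exp n - 1))"
          using C'[OF x] by (simp only: abs_le_iff minus_le_iff)
      qed (use s a0 in auto)
      ultimately show ?thesis using K0 n5 by (auto simp: power_0_left)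
    qed
    have "((\<lambda>s. (K s)\<^sup>2 / (2 * s ^ (n - 2))) \<longlongrightarrow> 0) (at 0 within {0..b})"
    proof (rule Lim_null_comparison)
      show "\<forall>\<^sub>F s in at 0 within {0..b}. norm ((K s)\<^sup>2 / (2 * s ^ (n - 2))) \<le> C\<^sup>2 * s ^ (n + 2)"
        unfolding eventually_at_filter
      proof (rule always_eventually, intro allI impI)
        fix s assume "s \<noteq> 0" "s \<in> {0..b}"
        then have s: "s > 0" and Ks: "\<bar>K s\<bar> \<le> C * s ^ n" using K_le by auto
        have "(K s)\<^sup>2 \<le> (C * s ^ n)\<^sup>2" using Ks by (metis abs_ge_zero power2_abs power_mono)
        also have "\<dots> = C\<^sup>2 * s ^ (n + 2) * s ^ (n - 2)"
        proof -
          obtain k where "n = 2 + k" using n5 le_Suc_ex[of 2 n] by auto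
          then show ?thesis by (simp add: power_mult_distrib power_add power2_eq_square)
        qed
        finally have "(K s)\<^sup>2 / s ^ (n - 2) \<le> C\<^sup>2 * s ^ (n + 2)"
          using s by (simp add: field_simps)
        then show "norm ((K s)\<^sup>2 / (2 * s ^ (n - 2))) \<le> C\<^sup>2 * s ^ (n + 2)"
          using s divide_left_mono[of "s ^ (n - 2)" "2 * s ^ (n - 2)" "(K s)\<^sup>2"]
          by (auto intro: order_trans)
      qed
      show "((\<lambda>s. C\<^sup>2 * s ^ (n + 2)) \<longlongrightarrow> 0) (at 0 within {0..b})"
        by (auto intro!: tendsto_eq_intros)
    qed
    \<comment> \<open>Since \<open>K 0 = 0\<close>, the quotient evaluates to 0 at the origin
      whatever its denominator is, and so agrees with its limit.\<close>
    then have at0: "((\<lambda>s. (K s)\<^sup>2 / (2 * s ^ (n - 2))) \<longlongrightarrow> (K 0)\<^sup>2 / (2 * 0 ^ (n - 2))) (at 0 within {0..b})"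
      by (simp add: K0)
    show ?thesis unfolding continuous_on_def
    proof
      fix s assume s: "s \<in> {a..b}"
      show "((\<lambda>s. (K s)\<^sup>2 / (2 * s ^ (n - 2))) \<longlongrightarrow> (K s)\<^sup>2 / (2 * s ^ (n - 2))) (at s within {a..b})"
      proof (cases "s = 0")
        case True then show ?thesis using at0 a0 by simp
      next
        case False
        have "(K \<longlongrightarrow> K s) (at s within {a..b})" using K_cont s by (auto simp: continuous_on_def)
        then show ?thesis using False by (auto intro!: tendsto_intros)
      qed
    qed
  qed
  show ?thesis unfolding pohozaev_def[abs_def]
    using crit_exp_ge[OF n5] w_nonneg
    by (intro continuous_intros main w_cont K_cont continuous_on_powr') auto
qed

lemma pohozaev_identity:
  "(LINT s:{a..b}|lborel. l * s ^ (n - 1) * (w s)\<^sup>2) = pohozaev b - pohozaev a"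
  using ab by (intro LINT_FTC_interior pohozaev_cont has_derivative_pohozaev continuous_intros w_cont) auto

end

locale decreasing_arc = radial_arc +
  assumes K_start: "K a = 0"
begin

lemma K_nonneg: "s \<in> {a..b} \<Longrightarrow> K s \<ge> 0"
proof -
  assume s: "s \<in> {a..b}"
  have "K a \<le> K s"
  proof (rule DERIV_nonneg_imp_increasing_open[where f = K])
    fix x assume x: "a < x" "x < s"
    have "w x > 0" using w_pos x s by auto
    then show "\<exists>y. (K has_real_derivative y) (at x) \<and> y \<ge> 0"
      using K_deriv[of x] x s a_nonneg l_pos
      by (intro exI[of _ "x ^ (n - 1) * (l * w x + w x powr (crit_exp n - 1))"]) auto
  qed (use s in \<open>auto intro!: continuous_on_subset[OF K_cont]\<close>)
  then show ?thesis using K_start by simp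
qed

lemma w_antimono:
  assumes "a \<le> s" "s \<le> t" "t \<le> b"
  shows "w t \<le> w s"
proof (rule DERIV_nonpos_imp_decreasing_open[where f = w])
  fix x assume x: "s < x" "x < t"
  then show "\<exists>y. (w has_real_derivative y) (at x) \<and> y \<le> 0"
    using w_deriv[of x] K_nonneg[of x] assms a_nonneg
    by (intro exI[of _ "- K x / x ^ (n - 1)"]) auto
qed (use assms in \<open>auto intro!: continuous_on_subset[OF w_cont]\<close>)

end

locale half_bubble = decreasing_arc +
  assumes w_start: "w a = 1" and w_end: "w b = 0"
begin

lemma w_le_1: "s \<in> {a..b} \<Longrightarrow> w s \<le> 1"
  using w_antimono[of a s] w_start by auto

lemma pohozaev_start: "pohozaev a = a ^ n * (l / 2 + 1 / crit_exp n)"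
  by (simp add: pohozaev_def w_start K_start)

text \<open>Differentiating l s^n w^2 / n through the factor s^n reproduces the derivative of
  \<open>pohozaev\<close>. What remains of the difference is 2 l s w K / n, nonnegative because w
  decreases. At \<open>a\<close> the difference is nonnegative because 1/n <= 1/2.\<close>

lemma pohozaev_ge:
  assumes s: "s \<in> {a..b}"
  shows "pohozaev s \<ge> l * s ^ n * (w s)\<^sup>2 / n"
proof -
  define D where "D s = pohozaev s - l / n * (s ^ n * (w s)\<^sup>2)" for s
  have "D a \<le> D s"
  proof (rule DERIV_nonneg_imp_increasing_open[where f = D])
    fix x assume x: "a < x" "x < s"
    then have ab: "a < x" "x < b" and x0: "x > 0" using s a_nonneg by auto
    have dn: "((\<lambda>s. s ^ n) has_real_derivative real n * x ^ (n - 1)) (at x)"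
      using DERIV_pow[of n x] by simp
    have xn: "x ^ n = x * x ^ (n - 1)" using n5 by (simp add: power_eq_if)
    define c where "c = l / n"
    have D: "D = (\<lambda>s. pohozaev s - c * (s ^ n * (w s)\<^sup>2))" by (simp add: fun_eq_iff D_def c_def)
    have "(D has_real_derivative l * x ^ (n - 1) * (w x)\<^sup>2
        - c * (real n * x ^ (n - 1) * (w x)\<^sup>2 + x ^ n * (2 * w x * (- K x / x ^ (n - 1))))) (at x)"
      unfolding D
      by (auto intro!: derivative_eq_intros has_derivative_pohozaev[OF ab] w_deriv[OF ab] dn)
    moreover have "l * x ^ (n - 1) * (w x)\<^sup>2
        - c * (real n * x ^ (n - 1) * (w x)\<^sup>2 + x ^ n * (2 * w x * (- K x / x ^ (n - 1))))
        = 2 * l / n * x * w x * K x"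
      unfolding xn c_def using x0 n5 by (simp add: field_simps)
    moreover have "\<dots> \<ge> 0"
      using K_nonneg[of x] w_nonneg[of x] ab x0 l_pos by auto
    ultimately show "\<exists>y. (D has_real_derivative y) (at x) \<and> y \<ge> 0" by auto
  qed (use s n5 in \<open>auto simp: D_def[abs_def] intro!: continuous_intros continuous_on_subset[OF w_cont] continuous_on_subset[OF pohozaev_cont]\<close>)
  moreover have "D a \<ge> 0"
  proof -
    have "D a = a ^ n * (l * (1 / 2 - 1 / n) + 1 / crit_exp n)"
      using n5 unfolding D_def pohozaev_start w_start by (simp add: field_simps)
    moreover have "1 / real n \<le> 1 / 2" using n5 by (simp add: field_simps)
    ultimately show ?thesis
      using a_nonneg l_pos crit_exp_ge[OF n5] by auto
  qed
  ultimately show ?thesis by (simp add: D_def)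
qed

text \<open>The function \<open>w powr (- beta_exp n)\<close> equals \<open>1 + s\<^sup>2 / (n * (n - 2))\<close> for the bubble;
  \<open>slope\<close> is its derivative divided by \<open>beta_exp n * s\<close>.\<close>

definition slope :: "real \<Rightarrow> real" where
  "slope s = w s powr (- beta_exp n - 1) * K s / s ^ n"

text \<open>The derivative is 2n/(n-2) * w^(-\<beta>-2) / s^(n+1) times the quantity estimated in
  \<open>pohozaev_ge\<close>. The end points stay out because w^(-\<beta>-1) is singular at the zero
  \<open>b\<close>, and s^(-n) is singular at \<open>a\<close> when the arc starts at the
  origin.\<close>

lemma slope_mono:
  assumes "a < s" "s \<le> t" "t < b"
  shows "slope s \<le> slope t"
proof (rule DERIV_nonneg_imp_increasing_open[where f = slope])
  fix x assume x: "s < x" "x < t"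
  then have ab: "a < x" "x < b" and x0: "x > 0" using assms a_nonneg by auto
  have w0: "w x > 0" using w_pos ab by auto
  obtain k where k: "n = Suc (Suc k)" using n5 le_Suc_ex[of 2 n] by auto
  have k1: "real k > 0" using n5 k by auto
  define A where "A = x ^ k"
  have A: "A > 0" using x0 by (simp add: A_def)
  define q where "q = crit_exp n"
  have q: "q = 2 * (real k + 2) / real k" by (simp add: q_def crit_exp_def k)
  define W where "W = w x powr (q - 1)"
  have Wq: "w x powr q = w x * W"
    unfolding W_def using w0 by (simp add: powr_mult_base)
  have dw: "(w has_real_derivative - K x / (x * A)) (at x)"
    using w_deriv[OF ab] by (simp add: k A_def)
  have dK: "(K has_real_derivative x * A * (l * w x + W)) (at x)"
    using K_deriv[OF ab] by (simp add: k A_def W_def q_def)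
  define Z where "Z = w x powr (- beta_exp n - 2)"
  have Z0: "Z > 0" using w0 by (simp add: Z_def)
  have Z1: "w x powr (- beta_exp n - 1) = w x * Z"
    using powr_mult_base[of "w x" "- beta_exp n - 2"] w0 arg_cong[of "- beta_exp n - 1" "1 + (- beta_exp n - 2)" "\<lambda>e. w x powr e"]
    unfolding Z_def by linarith
  have dz: "((\<lambda>s. w s powr (- beta_exp n - 1)) has_real_derivative
      (- beta_exp n - 1) * Z * (- K x / (x * A))) (at x)"
    using DERIV_chain2[OF has_real_derivative_powr[OF w0, of "- beta_exp n - 1"] dw]
    unfolding Z_def by (simp add: diff_diff_eq)
  have dn: "((\<lambda>s. s ^ n) has_real_derivative real n * (x * A)) (at x)"
    by (rule derivative_eq_intros refl)+ (simp add: k A_def)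
  have xn: "x ^ n = x * x * A" by (simp add: k A_def)
  define Y N where "Y = (\<lambda>s. w s powr (- beta_exp n - 1))" and "N = (\<lambda>s::real. s ^ n)"
  have YN: "Y x = w x * Z" "N x = x * x * A" by (simp_all add: Y_def N_def Z1 xn)
  have dY: "(Y has_real_derivative (- beta_exp n - 1) * Z * (- K x / (x * A))) (at x)"
    and dN: "(N has_real_derivative real n * (x * A)) (at x)"
    using dz dn by (simp_all add: Y_def N_def)
  have slope: "slope = (\<lambda>s. Y s * K s / N s)" by (simp add: fun_eq_iff slope_def Y_def N_def)
  have d: "(slope has_real_derivative
     (((- beta_exp n - 1) * Z * (- K x / (x * A)) * K x + w x * Z * (x * A * (l * w x + W))) * (x * x * A)
       - w x * Z * K x * (real n * (x * A))) / (x * x * A)\<^sup>2) (at x)"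
    unfolding slope
    by (rule DERIV_cong[OF DERIV_divide[OF DERIV_mult[OF dY dK] dN]]) (use x0 A in \<open>simp_all add: YN power2_eq_square\<close>)
  have b: "beta_exp n = 2 / real k" by (simp add: beta_exp_def k)
  have P: "pohozaev x = (K x)\<^sup>2 / (2 * A) + x * x * A * (l * (w x)\<^sup>2 / 2 + w x * W / q) - real k / 2 * w x * K x"
  proof -
    have "n - 2 = k" "real n - 2 = real k" by (simp_all add: k)
    then show ?thesis by (simp add: pohozaev_def Wq q_def[symmetric] A_def[symmetric] xn)
  qed
  have Wq2: "w x * W / q = real k * w x * W / (2 * (real k + 2))"
    using k1 by (simp add: q field_simps)
  have "(((- beta_exp n - 1) * Z * (- K x / (x * A)) * K x + w x * Z * (x * A * (l * w x + W))) * (x * x * A)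
       - w x * Z * K x * (real n * (x * A))) / (x * x * A)\<^sup>2
    = Z / (x * x * x * A) * (2 * (real k + 2) / real k) * (pohozaev x - l * x ^ n * (w x)\<^sup>2 / n)"
  proof -
    define X where "X = K x / (x * A)"
    have KX: "K x = X * x * A" using x0 A by (simp add: X_def)
    \<comment> \<open>In terms of X = - w', both sides of the identity reduce to
      \<open>Z / x * S\<close>; \<open>S\<close> is the bracket they share.\<close>
    define S where "S = (2 / real k + 1) * X\<^sup>2 + w x * (l * w x + W) - (real k + 2) * w x * X / x"
    have "pohozaev x - l * x ^ n * (w x)\<^sup>2 / n =
        x * x * A * (X\<^sup>2 / 2 + l * (w x)\<^sup>2 / 2 + real k * w x * W / (2 * (real k + 2)) - real k / 2 * w x * X / x
          - l * (w x)\<^sup>2 / (real k + 2))"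
    proof -
      have e: "(K x)\<^sup>2 / (2 * A) = x * x * A * (X\<^sup>2 / 2)"
        "real k / 2 * w x * K x = x * x * A * (real k / 2 * w x * X / x)" "real n = real k + 2"
        unfolding KX using x0 A k by (simp_all add: field_simps power2_eq_square)
      show ?thesis unfolding P Wq2 xn e by (simp only: ring_distribs mult_ac times_divide_eq_right)
    qed
    also have "\<dots> = x * x * A * (real k / (2 * (real k + 2)) * S)"
    proof -
      have "X\<^sup>2 / 2 + l * (w x)\<^sup>2 / 2 + real k * w x * W / (2 * (real k + 2)) - real k / 2 * w x * X / x
          - l * (w x)\<^sup>2 / (real k + 2) = real k / (2 * (real k + 2)) * S"
      proof -
        define c h where "c = real k + 2" and "h = real k / (2 * c)"
        have c: "c > 0" using k1 by (simp add: c_def)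
        have "2 / real k + 1 = c / real k" using k1 by (simp add: c_def field_simps)
        then have h1: "h * (2 / real k + 1) = 1 / 2" using k1 c by (simp add: h_def)
        have h2: "h = 1 / 2 - 1 / c" using c by (simp add: h_def c_def field_simps)
        have h3: "h * c = real k / 2" using c by (simp add: h_def)
        have "h * S = (h * (2 / real k + 1)) * X\<^sup>2 + h * (l * (w x)\<^sup>2) + h * (w x * W) - (h * c) * (w x * X / x)"
          by (simp add: S_def c_def[symmetric] ring_distribs power2_eq_square mult_ac)
        also have "\<dots> = X\<^sup>2 / 2 + (1 / 2 - 1 / c) * (l * (w x)\<^sup>2) + real k / (2 * c) * (w x * W) - real k / 2 * (w x * X / x)"
          unfolding h1 h3 unfolding h2[symmetric] h_def[symmetric] by simp
        finally show ?thesis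
          unfolding h_def[symmetric] c_def[symmetric] by (simp add: ring_distribs) (simp add: h_def mult.assoc)
      qed
      then show ?thesis by simp
    qed
    finally have PS: "pohozaev x - l * x ^ n * (w x)\<^sup>2 / n = x * x * A * (real k / (2 * (real k + 2)) * S)" .
    have "Z / (x * x * x * A) * (2 * (real k + 2) / real k) * (pohozaev x - l * x ^ n * (w x)\<^sup>2 / n) = Z / x * S"
    proof -
      define h where "h = 2 * (real k + 2) / real k"
      have h: "h > 0" unfolding h_def using k1 by (intro divide_pos_pos) auto
      have h2: "real k / (2 * (real k + 2)) = 1 / h" by (simp only: h_def divide_divide_eq_right mult_1)
      show ?thesis unfolding PS h_def[symmetric] h2 using h x0 A by simp
    qed
    moreover have "(((- beta_exp n - 1) * Z * (- K x / (x * A)) * K x + w x * Z * (x * A * (l * w x + W))) * (x * x * A)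
       - w x * Z * K x * (real n * (x * A))) / (x * x * A)\<^sup>2 = Z / x * S"
    proof -
      have n: "real n = real k + 2" by (simp add: k)
      have X: "- (X * x * A) / (x * A) = - X" using x0 A by simp
      have ne: "(x * x * A)\<^sup>2 \<noteq> 0" using x0 A by simp
      define h where "h = 2 / real k"
      have "((- h - 1) * Z * (- X) * (X * x * A) + w x * Z * (x * A * (l * w x + W))) * (x * x * A)
       - w x * Z * (X * x * A) * ((real k + 2) * (x * A))
        = (x * x * A) * (x * A) * Z * ((h + 1) * X\<^sup>2 + w x * (l * w x + W)) - (real k + 2) * w x * Z * x * A * x * A * X"
        by (simp add: algebra_simps power2_eq_square)
      also have "\<dots> = (x * x * A) * (x * A) * Z * S"
      proof -
        define Y where "Y = X / x"
        have XY: "X = Y * x" using x0 by (simp add: Y_def)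
        have S: "S = (h + 1) * X\<^sup>2 + w x * (l * w x + W) - (real k + 2) * w x * Y"
          by (simp add: S_def h_def Y_def)
        show ?thesis unfolding S by (simp add: XY algebra_simps power2_eq_square)
      qed
      also have "\<dots> = (Z / x * S) * (x * x * A)\<^sup>2"
        using x0 by (simp add: power2_eq_square)
      finally have "(((- h - 1) * Z * (- X) * (X * x * A) + w x * Z * (x * A * (l * w x + W))) * (x * x * A)
       - w x * Z * (X * x * A) * ((real k + 2) * (x * A))) / (x * x * A)\<^sup>2 = Z / x * S"
        by (simp only: nonzero_divide_eq_eq[OF ne])
      then show ?thesis unfolding b KX n X h_def .
    qed
    ultimately show ?thesis by linarith
  qed
  moreover have "\<dots> \<ge> 0"
    using pohozaev_ge[of x] ab x0 A Z0 k1 by (intro mult_nonneg_nonneg) auto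
  ultimately show "\<exists>y. (slope has_real_derivative y) (at x) \<and> y \<ge> 0" using d by auto
next
  show "continuous_on {s..t} slope"
  proof -
    have "continuous_on {s..t} w" "continuous_on {s..t} K"
      using assms by (auto intro: continuous_on_subset[OF w_cont] continuous_on_subset[OF K_cont])
    moreover have "\<forall>x\<in>{s..t}. w x > 0 \<and> x > 0" using assms a_nonneg w_pos by auto
    ultimately show ?thesis unfolding slope_def[abs_def]
      by (intro continuous_intros continuous_on_powr') auto
  qed
qed fact

end

section \<open>Comparison with the bubble\<close>

text \<open>The choice of \<open>mu\<close> gives the bubble the value 1 at the origin, the
  normalization imposed on w: \<mu>^2 = n (n-2) factors out of the denominator and cancels the
  numerator.\<close>

lemma bubble_mu:
  assumes "n > 2"
  shows "bubble n (mu n) s = (1 + s\<^sup>2 / (real n * (real n - 2))) powr (- ((real n - 2) / 2))"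
proof -
  define c where "c = real n * (real n - 2)"
  have c: "c > 0" using assms by (simp add: c_def)
  have m: "(mu n)\<^sup>2 = c" using c by (simp add: mu_def c_def)
  have "(c * c) powr ((real n - 2) / 4) = c powr ((real n - 2) / 2)"
    using c by (simp add: powr_mult powr_add[symmetric])
  moreover have "c + s\<^sup>2 = c * (1 + s\<^sup>2 / c)" using c by (simp add: field_simps)
  moreover have "(c * (1 + s\<^sup>2 / c)) powr ((real n - 2) / 2)
      = c powr ((real n - 2) / 2) * (1 + s\<^sup>2 / c) powr ((real n - 2) / 2)"
    using c by (intro powr_mult)
  ultimately have "bubble n (mu n) s = 1 / (1 + s\<^sup>2 / c) powr ((real n - 2) / 2)"
    using c unfolding bubble_def m c_def[symmetric] by simp
  then show ?thesis unfolding c_def by (simp add: powr_minus_divide)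
qed

lemma one_plus_pos: "n > 2 \<Longrightarrow> 1 + s\<^sup>2 / (real n * (real n - 2)) > 0"
  by (intro add_pos_nonneg divide_nonneg_nonneg) auto

lemma bubble_pos: "n > 2 \<Longrightarrow> bubble n (mu n) s > 0"
  using one_plus_pos[of n s] by (simp add: bubble_mu)

lemma bubble_le_1:
  assumes "n > 2"
  shows "bubble n (mu n) s \<le> 1"
proof -
  have "(1 + s\<^sup>2 / (real n * (real n - 2))) powr (- ((real n - 2) / 2)) \<le> 1 powr (- ((real n - 2) / 2))"
    using assms by (intro powr_mono2') auto
  then show ?thesis using assms by (simp add: bubble_mu)
qed

lemma bubble_antimono:
  assumes "n > 2" "0 \<le> s" "s \<le> t"
  shows "bubble n (mu n) t \<le> bubble n (mu n) s"
  using assms one_plus_pos[of n s] unfolding bubble_mu[OF assms(1)]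
  by (intro powr_mono2' add_left_mono divide_right_mono power_mono) auto

text \<open>The counterpart of K: - s^(n-1) U'(s) for U = \<open>bubble n (mu n)\<close>. The two
  derivative lemmas below say that the pair solves the radial system with l = 0.\<close>

definition bubble_flux :: "nat \<Rightarrow> real \<Rightarrow> real" where
  "bubble_flux n s = s ^ n / n * (1 + s\<^sup>2 / (real n * (real n - 2))) powr (- (real n / 2))"

lemma has_derivative_bubble:
  assumes n: "n > 2" and s: "s > 0"
  shows "(bubble n (mu n) has_real_derivative - bubble_flux n s / s ^ (n - 1)) (at s)"
proof -
  define c where "c = real n * (real n - 2)"
  have c: "c > 0" using n by (simp add: c_def)
  have p: "1 + s\<^sup>2 / c > 0" using one_plus_pos[OF n] by (simp add: c_def)
  have b: "bubble n (mu n) = (\<lambda>s. (1 + s\<^sup>2 / c) powr (- ((real n - 2) / 2)))"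
    using n by (simp add: bubble_mu c_def fun_eq_iff)
  have "((\<lambda>s. 1 + s\<^sup>2 / c) has_real_derivative 2 * s / c) (at s)"
    using c by (auto intro!: derivative_eq_intros)
  from DERIV_chain2[OF has_real_derivative_powr[OF p] this]
  have "(bubble n (mu n) has_real_derivative
      - ((real n - 2) / 2) * (1 + s\<^sup>2 / c) powr (- ((real n - 2) / 2) - 1) * (2 * s / c)) (at s)"
    unfolding b .
  moreover have "- ((real n - 2) / 2) - 1 = - (real n / 2)" by (simp add: field_simps)
  moreover have "(real n - 2) / 2 * (2 * s / c) = s / n" using n by (simp add: c_def field_simps)
  moreover have "s ^ n / s ^ (n - 1) = s" using s n by (simp add: power_eq_if[of s n])
  moreover define E where "E = (1 + s\<^sup>2 / c) powr (- (real n / 2))"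
  ultimately have "(bubble n (mu n) has_real_derivative - (s / n * E)) (at s)"
    by (metis (no_types, opaque_lifting) mult.assoc mult.commute mult_minus_left)
  moreover have "- bubble_flux n s / s ^ (n - 1) = - (s / n * E)"
    using s n by (simp add: bubble_flux_def c_def[symmetric] E_def[symmetric] power_eq_if[of s n])
  ultimately show ?thesis by simp
qed

lemma has_derivative_bubble_flux:
  assumes n: "n > 2" and s: "s > 0"
  shows "(bubble_flux n has_real_derivative s ^ (n - 1) * bubble n (mu n) s powr (crit_exp n - 1)) (at s)"
proof -
  define c where "c = real n * (real n - 2)"
  have c: "c > 0" using n by (simp add: c_def)
  define y where "y = 1 + s\<^sup>2 / c"
  have p: "y > 0" using one_plus_pos[OF n] by (simp add: c_def y_def)
  have d1: "((\<lambda>s. 1 + s\<^sup>2 / c) has_real_derivative 2 * s / c) (at s)"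
    using c by (auto intro!: derivative_eq_intros)
  have d2: "((\<lambda>s. (1 + s\<^sup>2 / c) powr (- (real n / 2))) has_real_derivative
      - (real n / 2) * y powr (- (real n / 2) - 1) * (2 * s / c)) (at s)"
    using DERIV_chain2[OF has_real_derivative_powr d1] p unfolding y_def by blast
  have d3: "((\<lambda>s. s ^ n / n) has_real_derivative s ^ (n - 1)) (at s)"
    using DERIV_cdivide[OF DERIV_pow[of n s], of "real n"] n by simp
  define E where "E = y powr (- (real n / 2) - 1)"
  have "y powr (1 + (- (real n / 2) - 1)) = y * E"
    unfolding E_def using p by (simp only: powr_mult_base less_imp_le)
  then have yE: "y powr (- (real n / 2)) = y * E" by simp
  have sn: "s ^ n = s * s ^ (n - 1)" using s n by (simp add: power_eq_if[of s n])
  have "- ((real n - 2) / 2) * (crit_exp n - 1) = - (real n / 2) - 1"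
    using n by (simp add: crit_exp_def field_simps)
  then have "bubble n (mu n) s powr (crit_exp n - 1) = E"
    by (simp only: bubble_mu[OF n] powr_powr c_def[symmetric] y_def[symmetric] E_def)
  moreover have "s ^ (n - 1) * (y * E) + s ^ n / n * (- (real n / 2) * E * (2 * s / c)) = s ^ (n - 1) * E"
  proof -
    define A where "A = s ^ (n - 1)"
    have T: "s ^ n / n * (- (real n / 2) * E * (2 * s / c)) = - (s ^ (n - 1) * E * (s\<^sup>2 / c))"
      unfolding sn A_def[symmetric] using n by (simp add: power2_eq_square)
    show ?thesis unfolding T y_def by (simp add: algebra_simps)
  qed
  moreover have "bubble_flux n = (\<lambda>s. s ^ n / n * (1 + s\<^sup>2 / c) powr (- (real n / 2)))"
    by (simp add: bubble_flux_def c_def fun_eq_iff)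
  moreover have "((\<lambda>s. s ^ n / n * (1 + s\<^sup>2 / c) powr (- (real n / 2))) has_real_derivative
      s ^ (n - 1) * (y * E) + s ^ n / n * (- (real n / 2) * E * (2 * s / c))) (at s)"
    by (rule DERIV_cong[OF DERIV_mult[OF d3 d2]]) (simp add: y_def[symmetric] yE E_def[symmetric])
  ultimately show ?thesis by simp
qed

lemma bubble_cont: "n > 2 \<Longrightarrow> continuous_on A (bubble n (mu n))"
  using one_plus_pos by (subst continuous_on_cong[OF refl bubble_mu])
    (auto intro!: continuous_intros dest: less_imp_neq[symmetric] simp: less_imp_neq[symmetric])

lemma bubble_flux_cont: "n > 2 \<Longrightarrow> continuous_on A (bubble_flux n)"
  unfolding bubble_flux_def[abs_def] using one_plus_pos less_imp_neq
  by (intro continuous_intros) (auto dest: less_imp_neq[symmetric])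

section \<open>Pointwise bounds for a normalized arc\<close>

context half_bubble begin

lemma power_deriv: "((\<lambda>s. c * s ^ n / n) has_real_derivative c * x ^ (n - 1)) (at x)"
  using DERIV_cdivide[OF DERIV_cmult[OF DERIV_pow[of n x]], of c "real n"] n5 by simp

lemma square_deriv: "((\<lambda>s. c * s\<^sup>2) has_real_derivative 2 * c * x) (at (x::real))"
  by (auto intro!: derivative_eq_intros)

lemma w_powr_le_1: "s \<in> {a..b} \<Longrightarrow> w s powr (crit_exp n - 1) \<le> 1"
  using w_le_1 w_nonneg crit_exp_ge[OF n5] powr_mono2[of "crit_exp n - 1" "w s" 1] by auto

lemma w_ge:
  assumes "s \<in> {a..b}" and C: "\<And>t. t \<in> {a..b} \<Longrightarrow> K t \<le> C * t ^ n"
  shows "w s \<ge> 1 - C / 2 * s\<^sup>2"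
proof -
  \<comment> \<open>Dropping the term in a^2 below requires C >= 0, which the hypothesis at
    \<open>b\<close> forces because K is nonnegative there.\<close>
  have "b > 0" using ab a_nonneg by simp
  moreover have "0 \<le> C * b ^ n" using C[of b] K_nonneg[of b] ab by auto
  moreover have "b ^ n > 0" using \<open>b > 0\<close> by simp
  ultimately have C0: "C \<ge> 0" by (simp add: zero_le_mult_iff)
  have "- C / 2 * s\<^sup>2 - - C / 2 * a\<^sup>2 \<le> w s - w a"
  proof (rule derivative_le_imp_increment_le[OF _ _ _ square_deriv w_deriv])
    fix x assume x: "a < x" "x < s"
    have "K x \<le> C * x ^ n" using x assms by (intro C) auto
    also have "x ^ n = x * x ^ (n - 1)" using n5 by (simp add: power_eq_if)
    finally show "2 * (- C / 2) * x \<le> - K x / x ^ (n - 1)"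
      using x a_nonneg by (simp add: field_simps)
  qed (use assms in \<open>auto intro!: continuous_intros continuous_on_subset[OF w_cont]\<close>)
  moreover have "C / 2 * a\<^sup>2 \<ge> 0" using C0 by simp
  ultimately show ?thesis using w_start by simp
qed

lemma K_le:
  assumes "s \<in> {a..b}"
  shows "K s \<le> (1 + l) / n * s ^ n"
proof -
  have "K s - K a \<le> (1 + l) * s ^ n / n - (1 + l) * a ^ n / n"
  proof (rule derivative_le_imp_increment_le[OF _ _ _ K_deriv power_deriv])
    fix x assume x: "a < x" "x < s"
    have "l * w x + w x powr (crit_exp n - 1) \<le> l * 1 + 1"
      using w_le_1[of x] w_powr_le_1[of x] x assms l_pos by (intro add_mono mult_left_mono) auto
    then show "x ^ (n - 1) * (l * w x + w x powr (crit_exp n - 1)) \<le> (1 + l) * x ^ (n - 1)"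
      using x a_nonneg by (simp add: mult.commute[of "x ^ (n - 1)"] add.commute mult_right_mono)
  qed (use assms n5 in \<open>auto intro!: continuous_intros continuous_on_subset[OF K_cont]\<close>)
  moreover have "(1 + l) * a ^ n / n \<ge> 0" using a_nonneg l_pos by simp
  ultimately show ?thesis using K_start by simp
qed

lemma w_ge_parabola: "s \<in> {a..b} \<Longrightarrow> w s \<ge> 1 - (1 + l) / (2 * n) * s\<^sup>2"
  using w_ge[OF _ K_le] by (simp add: mult.commute)

text \<open>Since w decreases, its power on [a, s] is at least the power at the right end s; the
  linear term is discarded.\<close>

lemma K_ge:
  assumes "s \<in> {a..b}"
  shows "K s \<ge> w s powr (crit_exp n - 1) * (s ^ n - a ^ n) / n"
proof -
  let ?c = "w s powr (crit_exp n - 1)"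
  have "?c * s ^ n / n - ?c * a ^ n / n \<le> K s - K a"
  proof (rule derivative_le_imp_increment_le[OF _ _ _ power_deriv K_deriv])
    fix x assume x: "a < x" "x < s"
    have "?c \<le> w x powr (crit_exp n - 1)"
      using w_antimono[of x s] x assms crit_exp_ge[OF n5] w_nonneg[of s] by (intro powr_mono2) auto
    also have "\<dots> \<le> l * w x + w x powr (crit_exp n - 1)"
      using w_nonneg[of x] x assms l_pos by auto
    finally show "?c * x ^ (n - 1) \<le> x ^ (n - 1) * (l * w x + w x powr (crit_exp n - 1))"
      using x a_nonneg by (simp add: mult.commute[of _ "x ^ (n - 1)"] mult_left_mono)
  qed (use assms n5 in \<open>auto intro!: continuous_intros continuous_on_subset[OF K_cont]\<close>)
  then show ?thesis using K_start by (simp add: algebra_simps diff_divide_distrib)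
qed

text \<open>The exponents add up as (-\<beta>-1) + (2^* - 1) = \<beta>. The bubble has the constant
  slope 1/n, and this bound reaches that value in the limit w s -> 1, a/s -> 0.\<close>

lemma slope_ge:
  assumes "a < s" "s < b"
  shows "slope s \<ge> w s powr (beta_exp n) * (1 - (a / s) ^ n) / n"
proof -
  have s: "s > 0" using assms a_nonneg by simp
  have w: "w s > 0" using assms w_pos by simp
  have "- beta_exp n - 1 + (crit_exp n - 1) = beta_exp n"
  proof -
    define R where "R = real n - 2"
    have "R > 0" "real n = R + 2" using n5 by (auto simp: R_def)
    then show ?thesis by (simp add: beta_exp_def crit_exp_def field_simps)
  qed
  then have 1: "w s powr (- beta_exp n - 1) * w s powr (crit_exp n - 1) = w s powr (beta_exp n)"
    by (simp only: powr_add[symmetric])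
  have 2: "1 - (a / s) ^ n = (s ^ n - a ^ n) / s ^ n"
    using s by (simp add: power_divide diff_divide_distrib)
  have "w s powr (beta_exp n) * (1 - (a / s) ^ n) / n
      = w s powr (- beta_exp n - 1) * (w s powr (crit_exp n - 1) * (s ^ n - a ^ n) / n) / s ^ n"
    unfolding 1[symmetric] 2 by (simp add: mult_ac)
  also have "\<dots> \<le> slope s"
    unfolding slope_def using K_ge[of s] assms s w
    by (intro divide_right_mono mult_left_mono) auto
  finally show ?thesis .
qed

text \<open>By \<open>slope_mono\<close> the derivative \<beta> x \<open>slope x\<close> of
  w^(-\<beta>) is at least \<beta> x g on [t, s]; integrate it, starting from w^(-\<beta>) >= 1 at
  t.\<close>

lemma w_powr_minus_ge:
  fixes g :: real
  assumes "a < t" "t \<le> s" "s < b" "g \<le> slope t"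
  shows "w s powr (- beta_exp n) \<ge> 1 + g / (real n - 2) * (s\<^sup>2 - t\<^sup>2)"
proof -
  have pos: "\<forall>x\<in>{t..s}. w x > 0 \<and> x > 0" using assms a_nonneg w_pos by auto
  let ?c = "g / (real n - 2)"
  have "?c * s\<^sup>2 - ?c * t\<^sup>2 \<le> w s powr (- beta_exp n) - w t powr (- beta_exp n)"
  proof (rule derivative_le_imp_increment_le[OF _ _ _ square_deriv])
    fix x assume x: "t < x" "x < s"
    then have wx: "w x > 0" and x0: "x > 0" using pos by auto
    show "((\<lambda>s. w s powr (- beta_exp n)) has_real_derivative
        - beta_exp n * w x powr (- beta_exp n - 1) * (- K x / x ^ (n - 1))) (at x)"
      using x assms by (intro DERIV_chain2[OF has_real_derivative_powr[OF wx] w_deriv]) auto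
    have "- beta_exp n * w x powr (- beta_exp n - 1) * (- K x / x ^ (n - 1)) = beta_exp n * x * slope x"
      using x0 n5 by (simp add: slope_def power_eq_if[of x n])
    moreover have "beta_exp n * x * g \<le> beta_exp n * x * slope x"
      using slope_mono[of t x] x assms x0 n5 by (intro mult_left_mono) (auto simp: beta_exp_def)
    ultimately show "2 * ?c * x \<le> - beta_exp n * w x powr (- beta_exp n - 1) * (- K x / x ^ (n - 1))"
      by (simp add: beta_exp_def mult_ac)
  next
    have "continuous_on {t..s} w" using assms by (auto intro: continuous_on_subset[OF w_cont])
    then show "continuous_on {t..s} (\<lambda>s. w s powr (- beta_exp n))"
      using pos by (intro continuous_intros continuous_on_powr') auto
  qed (use assms n5 in \<open>auto intro!: continuous_intros\<close>)
  moreover have "1 powr (- beta_exp n) \<le> w t powr (- beta_exp n)"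
    using w_le_1[of t] assms pos n5 by (intro powr_mono2') (auto simp: beta_exp_def)
  ultimately show ?thesis by (simp add: algebra_simps)
qed

text \<open>In terms of w^(-\<beta>) the claim reads w^(-\<beta>) >= k (1 + s^2 / (n (n-2))). Up to
  t it follows from w <= 1 and the last bound on k. Beyond t, \<open>w_powr_minus_ge\<close>
  supplies a quadratic in s, and the two middle bounds on k compare its constant and its leading
  coefficient with those of the bubble.\<close>

lemma w_le_bubble:
  fixes g k :: real
  assumes t: "a < t" "t < b" and g: "g \<le> slope t"
    and k: "k > 0" "k \<le> 1 - g / (real n - 2) * t\<^sup>2" "k \<le> n * g" "k * (1 + t\<^sup>2 / (real n * (real n - 2))) \<le> 1"
    and s: "s \<in> {a..b}"
  shows "w s \<le> k powr (- ((real n - 2) / 2)) * bubble n (mu n) s"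
proof -
  define c where "c = real n * (real n - 2)"
  have c: "c > 0" using n5 by (simp add: c_def)
  let ?y = "\<lambda>s. 1 + s\<^sup>2 / c"
  have y: "?y s > 0" for s using one_plus_pos[of n] n5 by (simp add: c_def)
  have ky: "k powr (- ((real n - 2) / 2)) * bubble n (mu n) s = (k * ?y s) powr (- ((real n - 2) / 2))"
    using n5 k y[of s] by (simp add: bubble_mu c_def powr_mult)
  consider "s \<le> t" | "t < s" "s < b" | "s = b" using s by fastforce
  then show ?thesis
  proof cases
    case 1
    have "k * ?y s \<le> k * ?y t"
      using 1 s a_nonneg c k by (intro mult_left_mono add_left_mono divide_right_mono power_mono) auto
    also have "\<dots> \<le> 1" using k by (simp add: c_def)
    finally have "1 powr (- ((real n - 2) / 2)) \<le> (k * ?y s) powr (- ((real n - 2) / 2))"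
      using k y[of s] n5 by (intro powr_mono2') auto
    then show ?thesis using w_le_1[OF s] unfolding ky by simp
  next
    case 2
    have w: "w s > 0" using 2 t w_pos by auto
    have "k * ?y s = k + k / c * s\<^sup>2" using c by (simp add: field_simps)
    also have "\<dots> \<le> (1 - g / (real n - 2) * t\<^sup>2) + g / (real n - 2) * s\<^sup>2"
    proof (intro add_mono mult_right_mono)
      have "k / c \<le> n * g / c" using k c by (intro divide_right_mono) auto
      also have "\<dots> = g / (real n - 2)" using n5 by (simp add: c_def)
      finally show "k / c \<le> g / (real n - 2)" .
    qed (use k in auto)
    also have "\<dots> \<le> w s powr (- beta_exp n)"
      using w_powr_minus_ge[OF t(1) _ _ g, of s] 2 by (simp add: algebra_simps)
    finally have "(w s powr (- beta_exp n)) powr (- ((real n - 2) / 2)) \<le> (k * ?y s) powr (- ((real n - 2) / 2))"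
      using k y[of s] n5 by (intro powr_mono2') auto
    moreover have "(w s powr (- beta_exp n)) powr (- ((real n - 2) / 2)) = w s"
    proof -
      have "- beta_exp n * - ((real n - 2) / 2) = 1" using n5 by (simp add: beta_exp_def)
      then show ?thesis using w by (simp only: powr_powr powr_one less_imp_le)
    qed
    ultimately show ?thesis unfolding ky by simp
  next
    \<comment> \<open>At \<open>b\<close> the power w^(-\<beta>) carries no information, because w
      vanishes and \<open>0 powr x\<close> is 0; positivity of the bubble suffices.\<close>
    case 3
    then show ?thesis using w_end k bubble_pos[of n s] n5 by simp
  qed
qed

text \<open>An upper bound for w bounds K from above by \<theta>^(2^*-1) times the bubble flux, plus
  l s^n / n from the linear term with w <= 1. Integrating w' = - K / s^(n-1) turns this into a lower
  bound for w, which approaches the bubble as \<theta> -> 1 and l s^2 -> 0.\<close>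

lemma w_ge_bubble:
  assumes \<theta>: "\<And>s. s \<in> {a..b} \<Longrightarrow> w s \<le> \<theta> * bubble n (mu n) s"
    and s: "s \<in> {a..b}"
  shows "w s \<ge> 1 - \<theta> powr (crit_exp n - 1) * (1 - bubble n (mu n) s) - l / (2 * n) * s\<^sup>2"
proof -
  let ?U = "bubble n (mu n)" and ?c = "\<theta> powr (crit_exp n - 1)"
  have n2: "n > 2" using n5 by simp
  have \<theta>0: "\<theta> \<ge> 0" using \<theta>[of a] ab w_start bubble_pos[OF n2, of a]
    by (smt (verit, best) atLeastAtMost_iff mult_nonpos_nonneg)
  have flux: "K t \<le> ?c * bubble_flux n t + l * t ^ n / n" if t: "t \<in> {a..b}" for t
  proof -
    have "K t - K a \<le> (?c * bubble_flux n t + l * t ^ n / n) - (?c * bubble_flux n a + l * a ^ n / n)"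
    proof (rule derivative_le_imp_increment_le[OF _ _ _ K_deriv])
      fix x assume x: "a < x" "x < t"
      then have x': "x \<in> {a..b}" "x > 0" using t a_nonneg by auto
      show "((\<lambda>t. ?c * bubble_flux n t + l * t ^ n / n) has_real_derivative
          ?c * (x ^ (n - 1) * ?U x powr (crit_exp n - 1)) + l * x ^ (n - 1)) (at x)"
        using x' n2 by (intro DERIV_add DERIV_cmult has_derivative_bubble_flux power_deriv) auto
      have "w x powr (crit_exp n - 1) \<le> (\<theta> * ?U x) powr (crit_exp n - 1)"
        using \<theta>[OF x'(1)] w_nonneg[OF x'(1)] crit_exp_ge[OF n5] by (intro powr_mono2) auto
      also have "\<dots> = ?c * ?U x powr (crit_exp n - 1)"
        using \<theta>0 bubble_pos[OF n2] by (simp add: powr_mult less_imp_le)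
      finally have "l * w x + w x powr (crit_exp n - 1) \<le> l * 1 + ?c * ?U x powr (crit_exp n - 1)"
        using w_le_1[OF x'(1)] l_pos by (intro add_mono mult_left_mono) auto
      from mult_left_mono[OF this, of "x ^ (n - 1)"] x'(2)
      show "x ^ (n - 1) * (l * w x + w x powr (crit_exp n - 1))
          \<le> ?c * (x ^ (n - 1) * ?U x powr (crit_exp n - 1)) + l * x ^ (n - 1)"
        by (simp add: algebra_simps)
    qed (use t n5 n2 in \<open>auto intro!: continuous_intros bubble_flux_cont continuous_on_subset[OF K_cont]\<close>)
    moreover have "?c * bubble_flux n a + l * a ^ n / n \<ge> 0"
      using a_nonneg l_pos by (simp add: bubble_flux_def)
    ultimately show ?thesis using K_start by simp
  qed
  have "(?c * ?U s - l / (2 * n) * s\<^sup>2) - (?c * ?U a - l / (2 * n) * a\<^sup>2) \<le> w s - w a"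
  proof (rule derivative_le_imp_increment_le[OF _ _ _ _ w_deriv])
    fix x assume x: "a < x" "x < s"
    then have x': "x \<in> {a..b}" "x > 0" using s a_nonneg by auto
    show "((\<lambda>s. ?c * ?U s - l / (2 * n) * s\<^sup>2) has_real_derivative
        ?c * (- bubble_flux n x / x ^ (n - 1)) - 2 * (l / (2 * n)) * x) (at x)"
      using x' n2 by (intro DERIV_diff DERIV_cmult has_derivative_bubble square_deriv) auto
    have xn: "x ^ n = x * x ^ (n - 1)" using n5 by (simp add: power_eq_if)
    have "K x / x ^ (n - 1) \<le> (?c * bubble_flux n x + l * x ^ n / n) / x ^ (n - 1)"
      using flux[OF x'(1)] x'(2) by (intro divide_right_mono) auto
    also have "\<dots> = ?c * (bubble_flux n x / x ^ (n - 1)) + 2 * (l / (2 * n)) * x"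
      using x'(2) by (simp add: xn add_divide_distrib)
    finally show "?c * (- bubble_flux n x / x ^ (n - 1)) - 2 * (l / (2 * n)) * x \<le> - K x / x ^ (n - 1)"
      by simp
  qed (use s n2 in \<open>auto intro!: continuous_intros bubble_cont continuous_on_subset[OF w_cont]\<close>)
  moreover have "?c * ?U a \<le> ?c * 1" using bubble_le_1[OF n2] by (intro mult_left_mono) auto
  moreover have "l / (2 * n) * a\<^sup>2 \<ge> 0" using l_pos by simp
  ultimately show ?thesis using w_start by (simp add: algebra_simps)
qed

end

section \<open>Integrability of the bubble and passage to the limit\<close>

lemma power_le_bubble_base:
  assumes "n > 2" "s \<ge> 0"
  shows "s ^ k \<le> sqrt (real n * (real n - 2)) ^ k * (1 + s\<^sup>2 / (real n * (real n - 2))) powr (real k / 2)"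
proof -
  define c where "c = real n * (real n - 2)"
  have c: "c > 0" using assms by (simp add: c_def)
  have y: "1 + s\<^sup>2 / c > 0" using one_plus_pos[OF assms(1)] by (simp add: c_def)
  have "s\<^sup>2 \<le> c * (1 + s\<^sup>2 / c)" using c by (simp add: algebra_simps)
  then have "s \<le> sqrt (c * (1 + s\<^sup>2 / c))" by (rule real_le_rsqrt)
  then have "s ^ k \<le> sqrt (c * (1 + s\<^sup>2 / c)) ^ k" using assms by (intro power_mono)
  also have "\<dots> = sqrt c ^ k * sqrt (1 + s\<^sup>2 / c) ^ k" by (simp add: real_sqrt_mult power_mult_distrib)
  also have "sqrt (1 + s\<^sup>2 / c) ^ k = (1 + s\<^sup>2 / c) powr (real k / 2)"
    using y by (simp add: powr_half_sqrt[symmetric] powr_realpow[symmetric] powr_powr)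
  finally show ?thesis by (simp add: c_def)
qed

lemma inverse_square_integrable:
  assumes c: "c > 0"
  shows "set_integrable lborel {0..} (\<lambda>s::real. 1 / (1 + s\<^sup>2 / c))"
proof -
  have p: "1 + s\<^sup>2 / c > 0" for s using c by (intro add_pos_nonneg) auto
  have "(\<integral>\<^sup>+s. ennreal (1 / (1 + s\<^sup>2 / c)) * indicator {0..} s \<partial>lborel)
    = ennreal (sqrt c * (pi / 2) - sqrt c * arctan (0 / sqrt c))"
  proof (rule nn_integral_FTC_atLeast)
    fix s :: real
    have "(sqrt c)\<^sup>2 = c" using c by simp
    then show "((\<lambda>s. sqrt c * arctan (s / sqrt c)) has_real_derivative 1 / (1 + s\<^sup>2 / c)) (at s)"
      using c by (auto intro!: derivative_eq_intros simp: power_divide inverse_eq_divide)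
    show "1 / (1 + s\<^sup>2 / c) \<ge> 0" using p[of s] by simp
  next
    have "filterlim (\<lambda>s. (1 / sqrt c) * s) at_top at_top"
      using c by (intro filterlim_tendsto_pos_mult_at_top[OF tendsto_const _ filterlim_ident]) auto
    from filterlim_compose[OF tendsto_arctan_at_top this]
    show "((\<lambda>s. sqrt c * arctan (s / sqrt c)) \<longlongrightarrow> sqrt c * (pi / 2)) at_top"
      by (intro tendsto_mult tendsto_const) simp
  qed simp
  moreover have "ennreal (indicator {0..} s * (1 / (1 + s\<^sup>2 / c))) = ennreal (1 / (1 + s\<^sup>2 / c)) * indicator {0..} s" for s
    by (simp split: split_indicator)
  ultimately have fin: "(\<integral>\<^sup>+s. ennreal (indicator {0..} s * (1 / (1 + s\<^sup>2 / c))) \<partial>lborel) < \<infinity>"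
    by (simp only: ennreal_less_top infinity_ennreal_def)
  show ?thesis unfolding set_integrable_def
    using fin p by (intro integrableI_nonneg) (auto simp: less_imp_le)
qed

text \<open>With y = 1 + s^2 / (n (n-2)), the condition on e says that the integrand is at most a
  constant times 1 / y. It holds for e = 2^* - 1, where e (n-2) = n + 2, and for e = 2 exactly when
  n >= 5.\<close>

lemma bubble_powr_integrable:
  assumes n: "n > 2" and e: "e * (real n - 2) \<ge> real n + 1"
  shows "set_integrable lborel {0..} (\<lambda>s. bubble n (mu n) s powr e * s ^ (n - 1))"
proof -
  define c where "c = real n * (real n - 2)"
  have c: "c > 0" using n by (simp add: c_def)
  have int: "set_integrable lborel {0..} (\<lambda>s. sqrt c ^ (n - 1) * (1 / (1 + s\<^sup>2 / c)))"
    by (intro set_integrable_mult_right inverse_square_integrable c)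
  show ?thesis
  proof (rule set_integrable_bound[OF int])
    show "set_borel_measurable lborel {0..} (\<lambda>s. bubble n (mu n) s powr e * s ^ (n - 1))"
    proof -
      have "(\<lambda>s. indicator {0..} s *\<^sub>R (bubble n (mu n) s powr e * s ^ (n - 1))) \<in> borel_measurable borel"
        by (intro borel_measurable_continuous_on_indicator continuous_intros continuous_on_powr' bubble_cont[OF n])
          (auto simp: less_imp_neq[OF bubble_pos[OF n], symmetric] less_imp_le[OF bubble_pos[OF n]])
      then show ?thesis unfolding set_borel_measurable_def by simp
    qed
    show "AE s in lborel. s \<in> {0..} \<longrightarrow> norm (bubble n (mu n) s powr e * s ^ (n - 1))
        \<le> norm (sqrt c ^ (n - 1) * (1 / (1 + s\<^sup>2 / c)))"
    proof (intro AE_I2 impI)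
      fix s :: real assume "s \<in> {0..}"
      then have s: "s \<ge> 0" by simp
      define y where "y = 1 + s\<^sup>2 / c"
      have y: "y > 0" "y \<ge> 1" using c unfolding y_def by (auto intro: add_pos_nonneg)
      have "bubble n (mu n) s powr e * s ^ (n - 1)
          \<le> bubble n (mu n) s powr e * (sqrt c ^ (n - 1) * y powr (real (n - 1) / 2))"
        using power_le_bubble_base[OF n s, of "n - 1"] by (intro mult_left_mono) (auto simp: c_def y_def)
      also have Ue: "bubble n (mu n) s powr e = y powr (- ((real n - 2) / 2 * e))"
        by (simp only: bubble_mu[OF n] powr_powr c_def[symmetric] y_def[symmetric] mult_minus_left)
      also have "y powr (- ((real n - 2) / 2 * e)) * (sqrt c ^ (n - 1) * y powr (real (n - 1) / 2))
          = sqrt c ^ (n - 1) * y powr (real (n - 1) / 2 - (real n - 2) / 2 * e)"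
        by (simp add: powr_diff powr_minus_divide)
      also have "\<dots> \<le> sqrt c ^ (n - 1) * y powr (- 1)"
        using y e n by (intro mult_left_mono powr_mono) (auto simp: field_simps of_nat_diff c less_imp_le)
      finally show "norm (bubble n (mu n) s powr e * s ^ (n - 1)) \<le> norm (sqrt c ^ (n - 1) * (1 / (1 + s\<^sup>2 / c)))"
        using y s c bubble_pos[OF n, of s] unfolding y_def[symmetric] by (simp add: powr_minus_divide abs_mult Ue)
    qed
  qed
qed


text \<open>Dominated convergence with majorant 2^e U^e s^(n-1). The 2 stands for any constant above
  1: the factor in the pointwise bound will tend to 1.\<close>

lemma set_integral_half_bubble_limit:
  fixes a b \<theta> :: "nat \<Rightarrow> real" and w :: "nat \<Rightarrow> real \<Rightarrow> real"
  assumes n: "n > 2" and e: "e * (real n - 2) \<ge> real n + 1"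
    and a: "a \<longlonglongrightarrow> 0" and b: "filterlim b at_top sequentially"
    and lim: "\<And>s. s > 0 \<Longrightarrow> (\<lambda>j. w j s) \<longlonglongrightarrow> bubble n (mu n) s"
    and bound: "\<forall>\<^sub>F j in sequentially. 0 \<le> a j \<and> continuous_on {a j..b j} (w j) \<and>
      (\<forall>s\<in>{a j..b j}. 0 \<le> w j s \<and> w j s \<le> 2 * bubble n (mu n) s)"
  shows "(\<lambda>j. LINT s:{a j..b j}|lborel. w j s powr e * s ^ (n - 1))
    \<longlonglongrightarrow> (LINT s:{0..}|lborel. bubble n (mu n) s powr e * s ^ (n - 1))"
proof -
  let ?U = "bubble n (mu n)"
  have e0: "e > 0"
  proof (rule ccontr)
    assume "\<not> e > 0"
    then have "e * (real n - 2) \<le> 0" using n by (intro mult_nonpos_nonneg) auto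
    then show False using e by simp
  qed
  obtain N where N: "\<And>j. j \<ge> N \<Longrightarrow> 0 \<le> a j \<and> continuous_on {a j..b j} (w j) \<and>
      (\<forall>s\<in>{a j..b j}. 0 \<le> w j s \<and> w j s \<le> 2 * ?U s)"
    using bound unfolding eventually_sequentially by auto
  let ?f = "\<lambda>j s. indicator {a j..b j} s *\<^sub>R (w j s powr e * s ^ (n - 1))"
  show ?thesis unfolding set_lebesgue_integral_def
  proof (rule LIMSEQ_offset[where k = N], rule integral_dominated_convergence)
    show "(\<lambda>s. indicator {0..} s *\<^sub>R (?U s powr e * s ^ (n - 1))) \<in> borel_measurable lborel"
      using bubble_powr_integrable[OF n e] unfolding set_integrable_def by (rule borel_measurable_integrable)
    show "?f (j + N) \<in> borel_measurable lborel" for j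
    proof -
      have "?f (j + N) \<in> borel_measurable borel"
        using N[of "j + N"] e0
        by (intro borel_measurable_continuous_on_indicator continuous_intros continuous_on_powr') auto
      then show ?thesis by simp
    qed
    show "integrable lborel (\<lambda>s. 2 powr e * (indicator {0..} s *\<^sub>R (?U s powr e * s ^ (n - 1))))"
      using bubble_powr_integrable[OF n e] unfolding set_integrable_def by (rule integrable_mult_right)
    show "AE s in lborel. norm (?f (j + N) s) \<le> 2 powr e * (indicator {0..} s *\<^sub>R (?U s powr e * s ^ (n - 1)))" for j
    proof (rule AE_I2)
      fix s
      show "norm (?f (j + N) s) \<le> 2 powr e * (indicator {0..} s *\<^sub>R (?U s powr e * s ^ (n - 1)))"
      proof (cases "s \<in> {a (j + N)..b (j + N)}")
        case True
        then have s: "s \<ge> 0" "0 \<le> w (j + N) s" "w (j + N) s \<le> 2 * ?U s" using N[of "j + N"] by force+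
        have "w (j + N) s powr e \<le> (2 * ?U s) powr e" using s e0 by (intro powr_mono2) auto
        also have "\<dots> = 2 powr e * ?U s powr e" using bubble_pos[OF n] by (simp add: powr_mult less_imp_le)
        finally have "w (j + N) s powr e * s ^ (n - 1) \<le> 2 powr e * ?U s powr e * s ^ (n - 1)"
          using s by (intro mult_right_mono) auto
        then show ?thesis using True s by (simp add: mult.assoc abs_mult)
      qed (auto simp: indicator_def)
    qed
    show "AE s in lborel. (\<lambda>j. ?f (j + N) s) \<longlonglongrightarrow> indicator {0..} s *\<^sub>R (?U s powr e * s ^ (n - 1))"
    proof (rule AE_mp[OF AE_lborel_singleton[of 0]], rule AE_I2, rule impI)
      fix s :: real assume "s \<noteq> 0"
      then consider "s > 0" | "s < 0" by linarith
      then show "(\<lambda>j. ?f (j + N) s) \<longlonglongrightarrow> indicator {0..} s *\<^sub>R (?U s powr e * s ^ (n - 1))"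
      proof cases
        case 1
        have "\<forall>\<^sub>F j in sequentially. a j < s" using order_tendstoD(2)[OF a 1] .
        moreover have "\<forall>\<^sub>F j in sequentially. b j > s" using b unfolding filterlim_at_top_dense by blast
        ultimately have "\<forall>\<^sub>F j in sequentially. w j s powr e * s ^ (n - 1) = ?f j s"
          by eventually_elim (auto simp: indicator_def)
        moreover have "(\<lambda>j. w j s powr e * s ^ (n - 1)) \<longlonglongrightarrow> ?U s powr e * s ^ (n - 1)"
          using bubble_pos[OF n, of s] by (intro tendsto_intros lim 1) auto
        ultimately have "(\<lambda>j. ?f j s) \<longlonglongrightarrow> ?U s powr e * s ^ (n - 1)"
          by (rule Lim_transform_eventually[rotated])
        then show ?thesis using 1 LIMSEQ_ignore_initial_segment by (simp add: LIMSEQ_ignore_initial_segment)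
      next
        case 2
        then have "?f (j + N) s = 0" for j using N[of "j + N"] by (auto simp: indicator_def)
        then show ?thesis using 2 by (simp only:) simp
      qed
    qed
  qed
qed

text \<open>Smallness of \<delta> b^2 is the natural hypothesis: s^(n-1) U grows like s, so the
  linear term contributes to K at \<open>b\<close> an amount of order \<delta> b^2 that dominated
  convergence cannot control. The divergence of \<open>b\<close> is a result, not an
  assumption.\<close>

lemma half_bubble_limits:
  fixes \<delta> a b :: "nat \<Rightarrow> real" and w K :: "nat \<Rightarrow> real \<Rightarrow> real"
  assumes n: "n \<ge> 5"
    and arc: "\<forall>\<^sub>F j in sequentially. half_bubble n (\<delta> j) (a j) (b j) (w j) (K j)"
    and a: "a \<longlonglongrightarrow> 0" and \<delta>b: "(\<lambda>j. \<delta> j * (b j)\<^sup>2) \<longlonglongrightarrow> 0"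
  shows "filterlim b at_top sequentially"
    and "(\<lambda>j. K j (b j)) \<longlonglongrightarrow> c1 n"
    and "(\<lambda>j. LINT s:{a j..b j}|lborel. s ^ (n - 1) * (w j s)\<^sup>2) \<longlonglongrightarrow> c2 n / 2"
proof -
  let ?U = "bubble n (mu n)" and ?p = "crit_exp n - 1"
  define c where "c = real n * (real n - 2)"
  have c: "c > 0" using n by (simp add: c_def)
  have n2: "n > 2" using n by simp
  have p: "?p > 0" using crit_exp_ge[OF n] by simp
  have basic: "\<forall>\<^sub>F j in sequentially. 0 < \<delta> j \<and> 0 \<le> a j \<and> a j < b j"
    using arc by eventually_elim (simp add: half_bubble_def decreasing_arc_def radial_arc_def)
  \<comment> \<open>As w vanishes at \<open>b\<close>, the parabola below it forces (1 + \<delta>)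
    b^2 >= 2n; with \<delta> b^2 < 1 this keeps \<open>b\<close> above 1, and \<delta> -> 0
    follows.\<close>
  have b1: "\<forall>\<^sub>F j in sequentially. 1 \<le> b j"
    using arc order_tendstoD(2)[OF \<delta>b, of 1, simplified]
  proof eventually_elim
    case (elim j)
    interpret half_bubble n "\<delta> j" "a j" "b j" "w j" "K j" by fact
    have "(1 + \<delta> j) / (2 * n) * (b j)\<^sup>2 \<ge> 1" using w_ge_parabola[of "b j"] w_end ab by simp
    then have "(b j)\<^sup>2 + \<delta> j * (b j)\<^sup>2 \<ge> 2 * n" using n by (simp add: field_simps)
    then have "(b j)\<^sup>2 \<ge> 1\<^sup>2" using elim(2) n by simp
    then show ?case using ab a_nonneg by (intro power2_le_imp_le[of 1 "b j"]) auto
  qed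
  have \<delta>0: "\<delta> \<longlonglongrightarrow> 0"
  proof (rule tendsto_sandwich[OF _ _ tendsto_const \<delta>b])
    show "\<forall>\<^sub>F j in sequentially. 0 \<le> \<delta> j" using basic by eventually_elim simp
    show "\<forall>\<^sub>F j in sequentially. \<delta> j \<le> \<delta> j * (b j)\<^sup>2"
      using basic b1 by eventually_elim (simp add: mult_le_cancel_left1)
  qed
  \<comment> \<open>A scale between a and 1: t -> 0, yet a/t <= t -> 0. The summand 1/(j+1) keeps t
    positive when a = 0.\<close>
  define t where "t j = sqrt (a j + 1 / real (Suc j))" for j
  have t0: "t \<longlonglongrightarrow> 0" unfolding t_def
    using tendsto_real_sqrt[OF tendsto_add[OF a LIMSEQ_Suc[OF lim_1_over_n]]] by simp
  have t_sq: "\<forall>\<^sub>F j in sequentially. 0 < t j \<and> a j < (t j)\<^sup>2"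
    using basic by eventually_elim (simp add: t_def add_nonneg_pos)
  have t_small: "\<forall>\<^sub>F j in sequentially. a j < t j \<and> t j < b j \<and> t j < 1"
    using t_sq b1 order_tendstoD(2)[OF t0, of 1, simplified]
  proof eventually_elim
    case (elim j)
    have "(t j)\<^sup>2 \<le> t j" using elim by (simp add: power2_eq_square mult_le_cancel_left1)
    then show ?case using elim by auto
  qed
  define v where "v j = 1 - (1 + \<delta> j) / (2 * n) * (t j)\<^sup>2" for j
  \<comment> \<open>The bound of \<open>slope_ge\<close> at \<open>t j\<close>, with w replaced by
    the parabola value \<open>v j\<close> below it; its limit 1/n is the slope of the
    bubble.\<close>
  define g where "g j = v j powr beta_exp n * (1 - (a j / t j) ^ n) / n" for j
  have v: "v \<longlonglongrightarrow> 1" unfolding v_def using n by (auto intro!: tendsto_eq_intros \<delta>0 t0)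
  have at: "(\<lambda>j. a j / t j) \<longlonglongrightarrow> 0"
  proof (rule tendsto_sandwich[OF _ _ tendsto_const t0])
    show "\<forall>\<^sub>F j in sequentially. 0 \<le> a j / t j" using basic t_sq by eventually_elim simp
    show "\<forall>\<^sub>F j in sequentially. a j / t j \<le> t j"
      using t_sq by eventually_elim (simp add: divide_le_eq power2_eq_square)
  qed
  have "g \<longlonglongrightarrow> 1 powr beta_exp n * (1 - 0 ^ n) / n"
    unfolding g_def using n by (intro tendsto_intros v at) auto
  then have g: "g \<longlonglongrightarrow> 1 / n" using n by (simp add: power_0_left)
  have g_slope: "\<forall>\<^sub>F j in sequentially. g j \<le> half_bubble.slope n (w j) (K j) (t j)"
    using arc t_small basic order_tendstoD(1)[OF v, of 0, simplified]
  proof eventually_elim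
    case (elim j)
    interpret half_bubble n "\<delta> j" "a j" "b j" "w j" "K j" by fact
    have "v j powr beta_exp n \<le> w j (t j) powr beta_exp n"
      using w_ge_parabola[of "t j"] elim n by (intro powr_mono2) (auto simp: v_def beta_exp_def)
    moreover have "(a j / t j) ^ n \<le> 1" using elim by (intro power_le_one) auto
    ultimately have "g j \<le> w j (t j) powr beta_exp n * (1 - (a j / t j) ^ n) / n"
      unfolding g_def by (intro divide_right_mono mult_right_mono) auto
    also have "\<dots> \<le> slope (t j)" using elim by (intro slope_ge) auto
    finally show ?case .
  qed
  \<comment> \<open>The largest factor that \<open>w_le_bubble\<close> admits; all three entries
    tend to 1.\<close>
  define k where "k j = min (min (1 - g j / (real n - 2) * (t j)\<^sup>2) (n * g j)) (1 / (1 + (t j)\<^sup>2 / c))" for j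
  have k1: "k \<longlonglongrightarrow> 1"
  proof -
    have "k \<longlonglongrightarrow> min (min (1 - (1 / n) / (real n - 2) * 0\<^sup>2) (n * (1 / n))) (1 / (1 + 0\<^sup>2 / c))"
      unfolding k_def using c n by (intro tendsto_intros g t0) auto
    then show ?thesis using n by simp
  qed
  define \<theta> where "\<theta> j = k j powr (- ((real n - 2) / 2))" for j
  have \<theta>1: "\<theta> \<longlonglongrightarrow> 1" unfolding \<theta>_def by (auto intro!: tendsto_eq_intros k1)
  have upper: "\<forall>\<^sub>F j in sequentially. \<forall>s\<in>{a j..b j}. w j s \<le> \<theta> j * ?U s"
    using arc t_small g_slope order_tendstoD(1)[OF k1, of 0, simplified]
  proof eventually_elim
    case (elim j)
    interpret half_bubble n "\<delta> j" "a j" "b j" "w j" "K j" by fact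
    have pos: "1 + (t j)\<^sup>2 / c > 0" using one_plus_pos[OF n2] by (simp add: c_def)
    have "k j \<le> 1 / (1 + (t j)\<^sup>2 / c)" by (simp add: k_def)
    then have "k j * (1 + (t j)\<^sup>2 / c) \<le> 1" using pos by (simp only: le_divide_eq if_True)
    then show ?case unfolding \<theta>_def using elim
      by (intro ballI w_le_bubble[of "t j" "g j"]) (auto simp: k_def c_def)
  qed
  have lower: "\<forall>\<^sub>F j in sequentially. \<forall>s\<in>{a j..b j}.
      1 - \<theta> j powr ?p * (1 - ?U s) - \<delta> j / (2 * n) * s\<^sup>2 \<le> w j s"
    using arc upper
  proof eventually_elim
    case (elim j)
    interpret half_bubble n "\<delta> j" "a j" "b j" "w j" "K j" by fact
    show ?case using elim(2) by (intro ballI w_ge_bubble) auto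
  qed
  \<comment> \<open>The lower bound for w must stay below w = 0 at \<open>b\<close>, which is
    possible only if U tends to 0 there. This sends \<open>b\<close> to infinity.\<close>
  have U_end: "(\<lambda>j. ?U (b j)) \<longlonglongrightarrow> 0"
  proof (rule tendsto_sandwich[OF _ _ tendsto_const])
    show "\<forall>\<^sub>F j in sequentially. 0 \<le> ?U (b j)"
      using bubble_pos[OF n2] by (simp add: less_imp_le)
    have \<theta>p: "(\<lambda>j. \<theta> j powr ?p) \<longlonglongrightarrow> 1" by (auto intro!: tendsto_eq_intros \<theta>1)
    have "(\<lambda>j. 1 - (1 - \<delta> j * (b j)\<^sup>2 / (2 * n)) / \<theta> j powr ?p) \<longlonglongrightarrow> 1 - (1 - 0 / (2 * n)) / 1"
      using n by (intro tendsto_intros \<delta>b \<theta>p) auto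
    then show "(\<lambda>j. 1 - (1 - \<delta> j * (b j)\<^sup>2 / (2 * n)) / \<theta> j powr ?p) \<longlonglongrightarrow> 0" by simp
    show "\<forall>\<^sub>F j in sequentially. ?U (b j) \<le> 1 - (1 - \<delta> j * (b j)\<^sup>2 / (2 * n)) / \<theta> j powr ?p"
      using arc lower order_tendstoD(1)[OF \<theta>p, of 0, simplified]
    proof eventually_elim
      case (elim j)
      interpret half_bubble n "\<delta> j" "a j" "b j" "w j" "K j" by fact
      have "1 - \<delta> j * (b j)\<^sup>2 / (2 * n) \<le> \<theta> j powr ?p * (1 - ?U (b j))"
        using bspec[OF elim(2), of "b j"] ab w_end by simp
      then have "(1 - \<delta> j * (b j)\<^sup>2 / (2 * n)) / \<theta> j powr ?p \<le> 1 - ?U (b j)"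
        using elim(3) by (subst pos_divide_le_eq) (simp_all add: mult.commute)
      then show ?case by simp
    qed
  qed
  show b_inf: "filterlim b at_top sequentially"
    unfolding filterlim_at_top
  proof
    fix Z :: real
    have "\<forall>\<^sub>F j in sequentially. ?U (b j) < ?U Z"
      using order_tendstoD(2)[OF U_end bubble_pos[OF n2]] .
    with b1 show "\<forall>\<^sub>F j in sequentially. Z \<le> b j"
      by eventually_elim (metis bubble_antimono[OF n2] linorder_not_le less_imp_le order_trans zero_le_one)
  qed
  have w_lim: "(\<lambda>j. w j s) \<longlonglongrightarrow> ?U s" if s: "s > 0" for s
  proof (rule tendsto_sandwich)
    have "\<forall>\<^sub>F j in sequentially. a j < s" using order_tendstoD(2)[OF a s] .
    moreover have "\<forall>\<^sub>F j in sequentially. b j > s" using b_inf unfolding filterlim_at_top_dense by blast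
    ultimately have s_in: "\<forall>\<^sub>F j in sequentially. s \<in> {a j..b j}" by eventually_elim simp
    show "\<forall>\<^sub>F j in sequentially. w j s \<le> \<theta> j * ?U s" using upper s_in by eventually_elim blast
    show "\<forall>\<^sub>F j in sequentially. 1 - \<theta> j powr ?p * (1 - ?U s) - \<delta> j / (2 * n) * s\<^sup>2 \<le> w j s"
      using lower s_in by eventually_elim blast
    show "(\<lambda>j. \<theta> j * ?U s) \<longlonglongrightarrow> ?U s" by (auto intro!: tendsto_eq_intros \<theta>1)
    show "(\<lambda>j. 1 - \<theta> j powr ?p * (1 - ?U s) - \<delta> j / (2 * n) * s\<^sup>2) \<longlonglongrightarrow> ?U s"
      using n by (auto intro!: tendsto_eq_intros \<theta>1 \<delta>0)
  qed
  have bound: "\<forall>\<^sub>F j in sequentially. 0 \<le> a j \<and> continuous_on {a j..b j} (w j) \<and>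
      (\<forall>s\<in>{a j..b j}. 0 \<le> w j s \<and> w j s \<le> 2 * ?U s)"
    using arc upper order_tendstoD(2)[OF \<theta>1, of 2, simplified]
  proof eventually_elim
    case (elim j)
    interpret half_bubble n "\<delta> j" "a j" "b j" "w j" "K j" by fact
    have "\<theta> j * ?U s \<le> 2 * ?U s" for s
      using elim(3) bubble_pos[OF n2, of s] by simp
    then show ?case using elim(2) w_nonneg w_cont a_nonneg by (meson order_trans)
  qed
  note integral_limit = set_integral_half_bubble_limit[OF n2 _ a b_inf w_lim bound]
  have sq: "(\<lambda>j. LINT s:{a j..b j}|lborel. w j s powr 2 * s ^ (n - 1))
      \<longlonglongrightarrow> (LINT s:{0..}|lborel. ?U s powr 2 * s ^ (n - 1))"
    using n by (intro integral_limit) auto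
  have U2: "(LINT s:{0..}|lborel. ?U s powr 2 * s ^ (n - 1)) = c2 n / 2"
    using bubble_pos[OF n2] by (simp add: c2_def less_imp_le)
  have "\<forall>\<^sub>F j in sequentially. (LINT s:{a j..b j}|lborel. w j s powr 2 * s ^ (n - 1))
      = (LINT s:{a j..b j}|lborel. s ^ (n - 1) * (w j s)\<^sup>2)"
    using bound by eventually_elim (rule set_lebesgue_integral_cong, auto simp: mult.commute)
  from Lim_transform_eventually[OF sq this]
  show "(\<lambda>j. LINT s:{a j..b j}|lborel. s ^ (n - 1) * (w j s)\<^sup>2) \<longlonglongrightarrow> c2 n / 2"
    unfolding U2 .
  have lim1: "(\<lambda>j. LINT s:{a j..b j}|lborel. w j s powr ?p * s ^ (n - 1)) \<longlonglongrightarrow> c1 n"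
    unfolding c1_def
  proof (rule integral_limit)
    show "?p * (real n - 2) \<ge> real n + 1" using n by (simp add: crit_exp_def field_simps)
  qed auto
  \<comment> \<open>s^(n-2) U <= D, so with w <= 2 U the linear term adds to K at \<open>b\<close>
    at most \<delta> times the integral of 2 D s, hence at most D \<delta> b^2.\<close>
  define D where "D = sqrt c ^ (n - 2)"
  have diff: "\<forall>\<^sub>F j in sequentially.
     K j (b j) - (LINT s:{a j..b j}|lborel. w j s powr ?p * s ^ (n - 1)) \<in> {0..D * (\<delta> j * (b j)\<^sup>2)}"
    using arc bound
  proof eventually_elim
    case (elim j)
    interpret half_bubble n "\<delta> j" "a j" "b j" "w j" "K j" by fact
    have i1: "set_integrable lborel {a j..b j} (\<lambda>s. w j s powr ?p * s ^ (n - 1))"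
      using w_nonneg p by (intro borel_integrable_atLeastAtMost' continuous_intros continuous_on_powr' w_cont) auto
    have i2: "set_integrable lborel {a j..b j} (\<lambda>s. \<delta> j * (s ^ (n - 1) * w j s))"
      by (intro borel_integrable_atLeastAtMost' continuous_intros w_cont)
    have i3: "set_integrable lborel {a j..b j} (\<lambda>s. \<delta> j * (2 * D * s))"
      by (intro borel_integrable_atLeastAtMost' continuous_intros)
    have "K j (b j) = (LINT s:{a j..b j}|lborel. s ^ (n - 1) * (\<delta> j * w j s + w j s powr ?p))"
      using ab K_start by (subst LINT_FTC_interior[OF _ K_cont force_cont K_deriv]) auto
    also have "\<dots> = (LINT s:{a j..b j}|lborel. w j s powr ?p * s ^ (n - 1) + \<delta> j * (s ^ (n - 1) * w j s))"
      by (simp add: algebra_simps)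
    also have "\<dots> = (LINT s:{a j..b j}|lborel. w j s powr ?p * s ^ (n - 1))
        + (LINT s:{a j..b j}|lborel. \<delta> j * (s ^ (n - 1) * w j s))"
      by (rule set_integral_add(2)[OF i1 i2])
    finally have "K j (b j) - (LINT s:{a j..b j}|lborel. w j s powr ?p * s ^ (n - 1))
        = (LINT s:{a j..b j}|lborel. \<delta> j * (s ^ (n - 1) * w j s))" by simp
    moreover have "(LINT s:{a j..b j}|lborel. \<delta> j * (s ^ (n - 1) * w j s)) \<ge> 0"
      unfolding set_lebesgue_integral_def using w_nonneg a_nonneg l_pos
      by (intro Bochner_Integration.integral_nonneg) (auto simp: indicator_def)
    moreover have "(LINT s:{a j..b j}|lborel. \<delta> j * (s ^ (n - 1) * w j s))
        \<le> (LINT s:{a j..b j}|lborel. \<delta> j * (2 * D * s))"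
    proof (rule set_integral_mono[OF i2 i3], rule mult_left_mono)
      fix s assume s: "s \<in> {a j..b j}"
      then have s0: "s \<ge> 0" using a_nonneg by auto
      define y where "y = 1 + s\<^sup>2 / c"
      have y: "y > 0" using one_plus_pos[OF n2] by (simp add: c_def y_def)
      have "s ^ (n - 2) * ?U s \<le> (D * y powr (real (n - 2) / 2)) * ?U s"
        unfolding D_def y_def c_def using power_le_bubble_base[OF n2 s0, of "n - 2"] bubble_pos[OF n2, of s]
        by (intro mult_right_mono) auto
      also have "\<dots> = D"
        using y n2 by (simp add: bubble_mu c_def[symmetric] y_def[symmetric] of_nat_diff powr_minus_divide)
      finally have "s ^ (n - 2) * ?U s \<le> D" .
      moreover have "s ^ (n - 1) = s * s ^ (n - 2)" using n by (simp add: power_Suc[symmetric] Suc_diff_Suc numeral_2_eq_2 del: power_Suc)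
      moreover have "s ^ (n - 1) * w j s \<le> s ^ (n - 1) * (2 * ?U s)"
        using elim(2) s s0 by (intro mult_left_mono) auto
      ultimately show "s ^ (n - 1) * w j s \<le> 2 * D * s"
        using s0 mult_left_mono[of "s ^ (n - 2) * ?U s" D "2 * s"] by (simp add: algebra_simps)
    qed (use l_pos in auto)
    moreover have "(LINT s:{a j..b j}|lborel. \<delta> j * (2 * D * s)) = D * \<delta> j * (b j)\<^sup>2 - D * \<delta> j * (a j)\<^sup>2"
      using ab by (intro LINT_FTC_interior) (auto intro!: continuous_intros derivative_eq_intros)
    moreover have "D * \<delta> j * (a j)\<^sup>2 \<ge> 0" using l_pos c by (simp add: D_def)
    ultimately show ?case by (simp add: mult.assoc)
  qed
  have "(\<lambda>j. K j (b j) - (LINT s:{a j..b j}|lborel. w j s powr ?p * s ^ (n - 1))) \<longlonglongrightarrow> 0"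
  proof (rule tendsto_sandwich[OF _ _ tendsto_const])
    show "(\<lambda>j. D * (\<delta> j * (b j)\<^sup>2)) \<longlonglongrightarrow> 0" using tendsto_mult_right_zero[OF \<delta>b] .
  qed (use diff in \<open>auto elim: eventually_mono\<close>)
  from tendsto_add[OF this lim1] show "(\<lambda>j. K j (b j)) \<longlonglongrightarrow> c1 n" by simp
qed

section \<open>Asymptotics of the two nodal regions\<close>

text \<open>Scale invariance of the critical equation: for S = \<sigma>^((n-2)/2) one has S^(2^*-1)
  = S \<sigma>^2, so only l changes. Since S^2 = \<sigma>^(n-2), the flux is multiplied by
  S.\<close>

lemma rescaled_arc_half_bubble:
  assumes arc: "radial_arc n l a b w K" and \<sigma>: "\<sigma> > 0"
    and w: "w a = \<sigma> powr ((real n - 2) / 2)" "w b = 0" and K: "K a = 0"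
  shows "half_bubble n (l / \<sigma>\<^sup>2) (a * \<sigma>) (b * \<sigma>)
    (\<lambda>t. w (t / \<sigma>) / \<sigma> powr ((real n - 2) / 2)) (\<lambda>t. \<sigma> powr ((real n - 2) / 2) * K (t / \<sigma>))"
proof -
  interpret radial_arc n l a b w K by fact
  define S where "S = \<sigma> powr ((real n - 2) / 2)"
  have S: "S > 0" using \<sigma> by (simp add: S_def)
  have "S * S = \<sigma> powr (real (n - 2))"
    unfolding S_def powr_add[symmetric] using n5 by (simp add: of_nat_diff)
  then have SS: "S * S = \<sigma> ^ (n - 2)" using \<sigma> by (simp add: powr_realpow)
  have "S powr (crit_exp n - 1) = \<sigma> powr ((real n - 2) / 2 + 2)"
  proof -
    define R where "R = real n - 2"
    have R: "R > 0" "real n = R + 2" using n5 by (auto simp: R_def)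
    have "(real n - 2) / 2 * (crit_exp n - 1) = (real n - 2) / 2 + 2"
      using R(1) by (simp add: crit_exp_def R(2) field_simps)
    then show ?thesis unfolding S_def by (simp only: powr_powr)
  qed
  then have Sp: "S powr (crit_exp n - 1) = S * \<sigma>\<^sup>2"
    using \<sigma> by (simp add: powr_add S_def)
  have n1: "\<sigma> ^ (n - 1) = \<sigma> * (S * S)" unfolding SS using n5
    by (simp add: power_Suc[symmetric] Suc_diff_Suc numeral_2_eq_2 del: power_Suc)
  have div: "t / \<sigma> \<in> {a..b}" if "t \<in> {a * \<sigma>..b * \<sigma>}" for t
    using that \<sigma> by (auto simp: field_simps)
  have d: "((\<lambda>t. t / \<sigma>) has_real_derivative 1 / \<sigma>) (at t)" for t
    using \<sigma> by (auto intro!: derivative_eq_intros)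
  have in_arc: "a < t / \<sigma>" "t / \<sigma> < b" "t > 0" if "a * \<sigma> < t" "t < b * \<sigma>" for t
  proof -
    show "a < t / \<sigma>" "t / \<sigma> < b" using that \<sigma> by (auto simp: field_simps)
    then have "t / \<sigma> > 0" using a_nonneg by simp
    then show "t > 0" using \<sigma> by (simp add: zero_less_divide_iff)
  qed
  show ?thesis unfolding S_def[symmetric]
  proof (unfold_locales)
    show "continuous_on {a * \<sigma>..b * \<sigma>} (\<lambda>t. w (t / \<sigma>) / S)"
      using \<sigma> S div by (intro continuous_intros continuous_on_compose2[OF w_cont]) auto
    show "continuous_on {a * \<sigma>..b * \<sigma>} (\<lambda>t. S * K (t / \<sigma>))"
      using \<sigma> div by (intro continuous_intros continuous_on_compose2[OF K_cont]) auto
  next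
    fix t assume t: "a * \<sigma> < t" "t < b * \<sigma>"
    note t' = in_arc[OF t]
    show "w (t / \<sigma>) / S > 0" using w_pos t' S by simp
    have tp: "(t / \<sigma>) ^ (n - 1) = t ^ (n - 1) / (\<sigma> * (S * S))" by (simp only: power_divide n1)
    show "((\<lambda>t. w (t / \<sigma>) / S) has_real_derivative - (S * K (t / \<sigma>)) / t ^ (n - 1)) (at t)"
      by (rule DERIV_cong[OF DERIV_cdivide[OF DERIV_chain2[OF w_deriv[OF t'(1,2)] d]]])
        (unfold tp, use \<sigma> S t' in \<open>simp add: field_simps\<close>)
    have "(w (t / \<sigma>) / S) powr (crit_exp n - 1) = w (t / \<sigma>) powr (crit_exp n - 1) / (S * \<sigma>\<^sup>2)"
      using w_pos[OF t'(1,2)] S by (simp add: powr_divide Sp)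
    then have "S * ((t / \<sigma>) ^ (n - 1) * (l * w (t / \<sigma>) + w (t / \<sigma>) powr (crit_exp n - 1)) * (1 / \<sigma>))
      = t ^ (n - 1) * (l / \<sigma>\<^sup>2 * (w (t / \<sigma>) / S) + (w (t / \<sigma>) / S) powr (crit_exp n - 1))"
      unfolding tp using \<sigma> S by (simp add: field_simps power2_eq_square)
    then show "((\<lambda>t. S * K (t / \<sigma>)) has_real_derivative
        t ^ (n - 1) * (l / \<sigma>\<^sup>2 * (w (t / \<sigma>) / S) + (w (t / \<sigma>) / S) powr (crit_exp n - 1))) (at t)"
      using DERIV_cmult[OF DERIV_chain2[OF K_deriv[OF t'(1,2)] d], of S] by simp
  qed (use n5 l_pos a_nonneg ab \<sigma> S w K in \<open>auto simp: S_def[symmetric]\<close>)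
qed

text \<open>Weight and measure together give \<sigma>^n, and the amplitude takes away
  \<sigma>^(n-2).\<close>

lemma set_integral_rescale:
  fixes w :: "real \<Rightarrow> real"
  assumes \<sigma>: "\<sigma> > 0" and n: "n > 2"
  shows "(LINT t:{a * \<sigma>..b * \<sigma>}|lborel. t ^ (n - 1) * (w (t / \<sigma>) / \<sigma> powr ((real n - 2) / 2))\<^sup>2)
    = \<sigma>\<^sup>2 * (LINT s:{a..b}|lborel. s ^ (n - 1) * (w s)\<^sup>2)"
proof -
  define S where "S = \<sigma> powr ((real n - 2) / 2)"
  have S: "S > 0" using \<sigma> by (simp add: S_def)
  have "S * S = \<sigma> powr (real (n - 2))"
    unfolding S_def powr_add[symmetric] using n by (simp add: of_nat_diff)
  then have SS: "S\<^sup>2 = \<sigma> ^ (n - 2)" using \<sigma> by (simp add: powr_realpow power2_eq_square)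
  have n1: "\<sigma> ^ (n - 1) = \<sigma> * S\<^sup>2" unfolding SS using n
    by (simp add: power_Suc[symmetric] Suc_diff_Suc numeral_2_eq_2 del: power_Suc)
  have "(LINT t:{a * \<sigma>..b * \<sigma>}|lborel. t ^ (n - 1) * (w (t / \<sigma>) / S)\<^sup>2)
      = \<sigma> * (LINT s|lborel. indicator {a * \<sigma>..b * \<sigma>} (\<sigma> * s) *\<^sub>R ((\<sigma> * s) ^ (n - 1) * (w (\<sigma> * s / \<sigma>) / S)\<^sup>2))"
    unfolding set_lebesgue_integral_def
    by (subst lborel_integral_real_affine[where c = \<sigma> and t = 0]) (use \<sigma> in auto)
  also have "\<dots> = \<sigma> * (LINT s|lborel. \<sigma> * (indicator {a..b} s *\<^sub>R (s ^ (n - 1) * (w s)\<^sup>2)))"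
  proof -
    have "indicator {a * \<sigma>..b * \<sigma>} (\<sigma> * s) *\<^sub>R ((\<sigma> * s) ^ (n - 1) * (w (\<sigma> * s / \<sigma>) / S)\<^sup>2)
      = \<sigma> * (indicator {a..b} s *\<^sub>R (s ^ (n - 1) * (w s)\<^sup>2))" for s
      using \<sigma> S n1 by (auto simp: indicator_def mult.commute[of _ \<sigma>] power_mult_distrib power_divide)
    then show ?thesis by (simp only:)
  qed
  also have "\<dots> = \<sigma>\<^sup>2 * (LINT s:{a..b}|lborel. s ^ (n - 1) * (w s)\<^sup>2)"
    unfolding set_lebesgue_integral_def by (simp add: power2_eq_square)
  finally show ?thesis unfolding S_def .
qed

text \<open>The product l b^2 is invariant under the rescaling, so its smallness can be stated in
  the original variables; the position of the starting point has to be measured on the scale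
  1/\<sigma>.\<close>

lemma arc_limits:
  fixes l a b \<sigma> :: "nat \<Rightarrow> real" and w K :: "nat \<Rightarrow> real \<Rightarrow> real"
  assumes n: "n \<ge> 5"
    and arc: "\<forall>\<^sub>F j in sequentially. radial_arc n (l j) (a j) (b j) (w j) (K j) \<and> \<sigma> j > 0
      \<and> w j (a j) = \<sigma> j powr ((real n - 2) / 2) \<and> w j (b j) = 0 \<and> K j (a j) = 0"
    and a: "(\<lambda>j. a j * \<sigma> j) \<longlonglongrightarrow> 0" and lb: "(\<lambda>j. l j * (b j)\<^sup>2) \<longlonglongrightarrow> 0"
  shows "filterlim (\<lambda>j. b j * \<sigma> j) at_top sequentially"
    and "(\<lambda>j. \<sigma> j powr ((real n - 2) / 2) * K j (b j)) \<longlonglongrightarrow> c1 n"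
    and "(\<lambda>j. (\<sigma> j)\<^sup>2 * (LINT s:{a j..b j}|lborel. s ^ (n - 1) * (w j s)\<^sup>2)) \<longlonglongrightarrow> c2 n / 2"
proof -
  have half: "\<forall>\<^sub>F j in sequentially. half_bubble n (l j / (\<sigma> j)\<^sup>2) (a j * \<sigma> j) (b j * \<sigma> j)
      (\<lambda>t. w j (t / \<sigma> j) / \<sigma> j powr ((real n - 2) / 2)) (\<lambda>t. \<sigma> j powr ((real n - 2) / 2) * K j (t / \<sigma> j))"
    using arc by eventually_elim (blast intro: rescaled_arc_half_bubble)
  have pos: "\<forall>\<^sub>F j in sequentially. \<sigma> j > 0" using arc by eventually_elim simp
  then have "\<forall>\<^sub>F j in sequentially. l j * (b j)\<^sup>2 = l j / (\<sigma> j)\<^sup>2 * (b j * \<sigma> j)\<^sup>2"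
    by eventually_elim (simp add: power_mult_distrib)
  from Lim_transform_eventually[OF lb this]
  have \<delta>b: "(\<lambda>j. l j / (\<sigma> j)\<^sup>2 * (b j * \<sigma> j)\<^sup>2) \<longlonglongrightarrow> 0" .
  note lims = half_bubble_limits[OF n half a \<delta>b]
  show "filterlim (\<lambda>j. b j * \<sigma> j) at_top sequentially" by (fact lims(1))
  have "\<forall>\<^sub>F j in sequentially. \<sigma> j powr ((real n - 2) / 2) * K j (b j * \<sigma> j / \<sigma> j) =
      \<sigma> j powr ((real n - 2) / 2) * K j (b j)"
    using pos by eventually_elim simp
  from Lim_transform_eventually[OF lims(2) this]
  show "(\<lambda>j. \<sigma> j powr ((real n - 2) / 2) * K j (b j)) \<longlonglongrightarrow> c1 n" .
  have "\<forall>\<^sub>F j in sequentially.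
      (LINT t:{a j * \<sigma> j..b j * \<sigma> j}|lborel. t ^ (n - 1) * (w j (t / \<sigma> j) / \<sigma> j powr ((real n - 2) / 2))\<^sup>2)
      = (\<sigma> j)\<^sup>2 * (LINT s:{a j..b j}|lborel. s ^ (n - 1) * (w j s)\<^sup>2)"
    using pos by eventually_elim (rule set_integral_rescale; use n in simp)
  from Lim_transform_eventually[OF lims(3) this]
  show "(\<lambda>j. (\<sigma> j)\<^sup>2 * (LINT s:{a j..b j}|lborel. s ^ (n - 1) * (w j s)\<^sup>2)) \<longlonglongrightarrow> c2 n / 2" .
qed

section \<open>Positivity of the limit constants\<close>

lemma bubble_integral_pos:
  assumes n: "n > 2" and e: "e * (real n - 2) \<ge> real n + 1"
  shows "(LINT s:{0..}|lborel. bubble n (mu n) s powr e * s ^ (n - 1)) > 0"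
proof -
  let ?f = "\<lambda>s. indicator {0..} s *\<^sub>R (bubble n (mu n) s powr e * s ^ (n - 1))"
  have int: "integrable lborel ?f" using bubble_powr_integrable[OF n e] by (simp add: set_integrable_def)
  have nonneg: "AE s in lborel. 0 \<le> ?f s" by (auto simp: indicator_def)
  have "\<not> (AE s in lborel. ?f s = 0)"
  proof
    assume "AE s in lborel. ?f s = 0"
    then have "AE s in lborel. s \<notin> {1..2::real}"
      by eventually_elim (use bubble_pos[OF n] in \<open>auto simp: indicator_def less_imp_neq[symmetric] split: if_splits\<close>)
    then have "emeasure lborel {1..2::real} = 0"
      using AE_iff_measurable[of "{1..2::real}" lborel "\<lambda>s. s \<notin> {1..2}"] by (simp add: Collect_conj_eq atLeastAtMost_def atLeast_def atMost_def)
    then show False by simp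
  qed
  then have "(LINT s|lborel. ?f s) \<noteq> 0"
    using integral_nonneg_eq_0_iff_AE[OF int nonneg] by simp
  moreover have "(LINT s|lborel. ?f s) \<ge> 0"
    using nonneg by (rule integral_nonneg_AE)
  ultimately show ?thesis unfolding set_lebesgue_integral_def by simp
qed

lemma c1_pos: "n \<ge> 5 \<Longrightarrow> c1 n > 0"
  unfolding c1_def by (intro bubble_integral_pos) (auto simp: crit_exp_def field_simps)

lemma c2_pos: "n \<ge> 5 \<Longrightarrow> c2 n > 0"
  using bubble_integral_pos[of n 2] bubble_pos[of n] by (simp add: c2_def less_imp_le)

lemma c_limit_pos: "n \<ge> 5 \<Longrightarrow> c_limit n > 0"
  using c1_pos[of n] c2_pos[of n] by (simp add: c_limit_def)

text \<open>Here \<sigma> and \<tau> are the \<beta>-th powers of the two maxima. Multiplied by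
  \<sigma>^(n-2), the Pohozaev identity of the core becomes A^2 = 2 (\<sigma>^2 I) X; multiplied by
  \<tau>^(n-2), the sum over all three arcs becomes B^2 = 2 Q Y. The limits of \<open>X\<close> and
  \<open>Y\<close> are the two conclusions. \<open>H j (r j) = - K j (r j)\<close> expresses that
  the derivative of the solution is continuous across the node, so that P passes through it
  unchanged.\<close>

lemma two_arc_limits:
  fixes l r s \<sigma> \<tau> :: "nat \<Rightarrow> real" and w K v H :: "nat \<Rightarrow> real \<Rightarrow> real"
  assumes n: "n \<ge> 5" and l: "l \<longlonglongrightarrow> 0"
    and inner: "\<forall>\<^sub>F j in sequentially. radial_arc n (l j) 0 (r j) (w j) (K j) \<and> \<sigma> j > 0
      \<and> w j 0 = \<sigma> j powr ((real n - 2) / 2) \<and> w j (r j) = 0 \<and> K j 0 = 0"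
    and middle: "\<forall>\<^sub>F j in sequentially. radial_arc n (l j) (r j) (s j) (v j) (H j)
      \<and> v j (r j) = 0 \<and> H j (r j) = - K j (r j)
      \<and> (\<forall>x\<in>{r j..s j}. v j x \<le> v j (s j))"
    and outer: "\<forall>\<^sub>F j in sequentially. radial_arc n (l j) (s j) 1 (v j) (H j) \<and> \<tau> j > 0
      \<and> v j (s j) = \<tau> j powr ((real n - 2) / 2) \<and> v j 1 = 0 \<and> H j (s j) = 0"
  shows "(\<lambda>j. \<sigma> j ^ (n - 4) * r j ^ (n - 2) * l j) \<longlonglongrightarrow> c_limit n"
    and "(\<lambda>j. \<tau> j ^ (n - 4) * l j) \<longlonglongrightarrow> c_limit n"
proof -
  let ?m = "(real n - 2) / 2"
  define I where "I j = (LINT x:{0..r j}|lborel. x ^ (n - 1) * (w j x)\<^sup>2)" for j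
  define I\<^sub>1 where "I\<^sub>1 j = (LINT x:{r j..s j}|lborel. x ^ (n - 1) * (v j x)\<^sup>2)" for j
  define J where "J j = (LINT x:{s j..1}|lborel. x ^ (n - 1) * (v j x)\<^sup>2)" for j
  define A where "A j = \<sigma> j powr ?m * K j (r j)" for j
  define B where "B j = \<tau> j powr ?m * H j 1" for j
  have powr_sq: "(x powr ?m)\<^sup>2 = x ^ (n - 2)" if "x > 0" for x
    using that n by (simp add: power2_eq_square powr_add[symmetric] powr_realpow[symmetric] of_nat_diff)
  have n24: "x ^ (n - 2) = x ^ (n - 4) * x\<^sup>2" for x :: real
  proof -
    have "n - 2 = n - 4 + 2" using n by simp
    then show ?thesis by (simp only: power_add)
  qed
  have order: "\<forall>\<^sub>F j in sequentially. 0 < r j \<and> r j < s j \<and> s j < 1 \<and> l j > 0 \<and> \<sigma> j > 0 \<and> \<tau> j > 0"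
    using inner middle outer by eventually_elim (simp add: radial_arc_def)

  have lr: "(\<lambda>j. l j * (r j)\<^sup>2) \<longlonglongrightarrow> 0"
  proof (rule tendsto_sandwich[OF _ _ tendsto_const l])
    show "\<forall>\<^sub>F j in sequentially. 0 \<le> l j * (r j)\<^sup>2" using order by eventually_elim simp
    show "\<forall>\<^sub>F j in sequentially. l j * (r j)\<^sup>2 \<le> l j"
      using order by eventually_elim (simp add: mult_le_cancel_left2 power_le_one)
  qed
  note inner_lim = arc_limits[OF n inner _ lr, simplified, folded A_def I_def]
  have A: "A \<longlonglongrightarrow> c1 n" by (fact inner_lim(2))
  have I: "(\<lambda>j. (\<sigma> j)\<^sup>2 * I j) \<longlonglongrightarrow> c2 n / 2" using inner_lim(3) by (simp add: I_def)
  have \<sigma>1: "\<forall>\<^sub>F j in sequentially. \<sigma> j \<ge> 1"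
    using order inner_lim(1)[unfolded filterlim_at_top, rule_format, of 1]
  proof eventually_elim
    case (elim j)
    then have "r j * \<sigma> j \<le> 1 * \<sigma> j" by (intro mult_right_mono) auto
    then show ?case using elim by linarith
  qed
  have I_pos: "\<forall>\<^sub>F j in sequentially. (\<sigma> j)\<^sup>2 * I j > 0"
    using order_tendstoD(1)[OF I, of 0] c2_pos[OF n] by simp
  have inner_eq: "\<forall>\<^sub>F j in sequentially. (K j (r j))\<^sup>2 / (2 * r j ^ (n - 2)) = l j * I j"
    using inner
  proof eventually_elim
    case (elim j)
    interpret radial_arc n "l j" 0 "r j" "w j" "K j" using elim by simp
    have "l j * I j = pohozaev (r j) - pohozaev 0"
      using pohozaev_identity by (simp add: I_def mult.assoc)
    also have "pohozaev 0 = 0" using elim n by (simp add: pohozaev_def)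
    also have "pohozaev (r j) = (K j (r j))\<^sup>2 / (2 * r j ^ (n - 2))" using elim by (simp add: pohozaev_def)
    finally show ?case by simp
  qed
  define X where "X j = \<sigma> j ^ (n - 4) * r j ^ (n - 2) * l j" for j
  have "\<forall>\<^sub>F j in sequentially. (A j)\<^sup>2 / (2 * ((\<sigma> j)\<^sup>2 * I j)) = X j"
    using inner_eq order I_pos
  proof eventually_elim
    case (elim j)
    have "(K j (r j))\<^sup>2 = 2 * (l j * I j) * r j ^ (n - 2)" using elim by (simp add: field_simps)
    then have "(A j)\<^sup>2 = 2 * ((\<sigma> j)\<^sup>2 * I j) * X j"
      using elim unfolding A_def X_def by (simp add: power_mult_distrib powr_sq n24 mult_ac)
    then show ?case using elim(3) by (metis less_irrefl mult_eq_0_iff nonzero_mult_div_cancel_left zero_neq_numeral)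
  qed
  moreover have "(\<lambda>j. (A j)\<^sup>2 / (2 * ((\<sigma> j)\<^sup>2 * I j))) \<longlonglongrightarrow> (c1 n)\<^sup>2 / (2 * (c2 n / 2))"
    using c2_pos[OF n] by (intro tendsto_intros A I) auto
  ultimately have X: "X \<longlonglongrightarrow> c_limit n"
    by (simp add: c_limit_def Lim_transform_eventually)
  then show "(\<lambda>j. \<sigma> j ^ (n - 4) * r j ^ (n - 2) * l j) \<longlonglongrightarrow> c_limit n" by (simp add: X_def[abs_def])

  \<comment> \<open>The last equation computes P at the minimum point twice: directly, where H = 0,
    and as the accumulated integrals over the core and the rising arc. The first bound replaces v by
    its maximum.\<close>
  have middle_eq: "\<forall>\<^sub>F j in sequentially.
      I\<^sub>1 j \<le> (\<tau> j powr ?m)\<^sup>2 * s j ^ n / n \<and> 0 \<le> I\<^sub>1 j \<and>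
      s j ^ n * (l j * (\<tau> j powr ?m)\<^sup>2 / 2 + \<tau> j ^ n / crit_exp n) = l j * (I j + I\<^sub>1 j)"
    using middle outer inner_eq order
  proof eventually_elim
    case (elim j)
    interpret radial_arc n "l j" "r j" "s j" "v j" "H j" using elim by simp
    define T where "T = \<tau> j powr ?m"
    have "?m * crit_exp n = real n" using n by (simp add: crit_exp_def)
    then have Tq: "T powr crit_exp n = \<tau> j ^ n"
      unfolding T_def using elim by (simp only: powr_powr powr_realpow)
    have i1: "set_integrable lborel {r j..s j} (\<lambda>x. x ^ (n - 1) * (v j x)\<^sup>2)"
      by (intro borel_integrable_atLeastAtMost' continuous_intros w_cont)
    have i2: "set_integrable lborel {r j..s j} (\<lambda>x. x ^ (n - 1) * T\<^sup>2)"
      by (intro borel_integrable_atLeastAtMost' continuous_intros)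
    have d: "((\<lambda>x. T\<^sup>2 * x ^ n / n) has_real_derivative x ^ (n - 1) * T\<^sup>2) (at x)" for x
      using DERIV_cdivide[OF DERIV_cmult[OF DERIV_pow[of n x]], of "T\<^sup>2" "real n"] n by (simp add: mult.commute)
    have "I\<^sub>1 j \<le> (LINT x:{r j..s j}|lborel. x ^ (n - 1) * T\<^sup>2)"
      unfolding I\<^sub>1_def
    proof (rule set_integral_mono[OF i1 i2], intro mult_left_mono power_mono)
      fix x assume x: "x \<in> {r j..s j}"
      show "v j x \<le> T" using elim x by (simp add: T_def)
      show "0 \<le> v j x" using w_nonneg x by simp
      show "0 \<le> x ^ (n - 1)" using x elim by simp
    qed
    also have "\<dots> = T\<^sup>2 * s j ^ n / n - T\<^sup>2 * r j ^ n / n"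
      using elim n by (intro LINT_FTC_interior d) (auto intro!: continuous_intros)
    also have "\<dots> \<le> T\<^sup>2 * s j ^ n / n" using elim by simp
    finally have 1: "I\<^sub>1 j \<le> T\<^sup>2 * s j ^ n / n" .
    have 2: "I\<^sub>1 j \<ge> 0" unfolding I\<^sub>1_def set_lebesgue_integral_def using elim
      by (intro Bochner_Integration.integral_nonneg) (auto simp: indicator_def)
    have "l j * I\<^sub>1 j = pohozaev (s j) - pohozaev (r j)"
      using pohozaev_identity by (simp add: I\<^sub>1_def mult.assoc)
    also have "pohozaev (r j) = l j * I j" using elim by (simp add: pohozaev_def)
    also have "pohozaev (s j) = s j ^ n * (l j * T\<^sup>2 / 2 + \<tau> j ^ n / crit_exp n)"
      using elim Tq unfolding pohozaev_def by (simp add: T_def)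
    finally show ?case using 1 2 by (simp add: T_def algebra_simps)
  qed
  \<comment> \<open>The bound on \<open>I\<^sub>1\<close>, weakened from 1/n to 1/2, is absorbed by
    the quadratic term of P at s. This leaves (s \<tau>)^n <= 2^* l I <= 2^* l \<sigma>^2 I, which
    tends to 0 because \<sigma>^2 I converges.\<close>
  have s\<tau>: "(\<lambda>j. s j * \<tau> j) \<longlonglongrightarrow> 0"
  proof -
    have "(\<lambda>j. (s j * \<tau> j) ^ n) \<longlonglongrightarrow> 0"
    proof (rule tendsto_sandwich[OF _ _ tendsto_const])
      show "\<forall>\<^sub>F j in sequentially. 0 \<le> (s j * \<tau> j) ^ n" using order by eventually_elim simp
      show "\<forall>\<^sub>F j in sequentially. (s j * \<tau> j) ^ n \<le> crit_exp n * (l j * ((\<sigma> j)\<^sup>2 * I j))"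
        using middle_eq order \<sigma>1 I_pos
      proof eventually_elim
        case (elim j)
        define T where "T = \<tau> j powr ?m"
        have "l j * I\<^sub>1 j \<le> l j * (T\<^sup>2 * s j ^ n / n)" using elim by (intro mult_left_mono) (auto simp: T_def)
        also have "\<dots> \<le> l j * (T\<^sup>2 * s j ^ n / 2)"
          using elim n by (intro mult_left_mono divide_left_mono) auto
        finally have "l j * I\<^sub>1 j \<le> l j * (T\<^sup>2 * s j ^ n / 2)" .
        moreover have "s j ^ n * \<tau> j ^ n / crit_exp n = l j * I j + l j * I\<^sub>1 j - l j * (T\<^sup>2 * s j ^ n / 2)"
          using elim by (simp add: T_def[symmetric] algebra_simps)
        ultimately have "s j ^ n * \<tau> j ^ n / crit_exp n \<le> l j * I j" by linarith
        then have "(s j * \<tau> j) ^ n \<le> crit_exp n * (l j * I j)"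
          using crit_exp_ge[OF n] by (simp add: power_mult_distrib field_simps)
        also have "\<dots> \<le> crit_exp n * (l j * ((\<sigma> j)\<^sup>2 * I j))"
        proof (intro mult_left_mono)
          have "I j > 0" using elim by (simp add: zero_less_mult_iff)
          moreover have "(\<sigma> j)\<^sup>2 \<ge> 1" using elim by (simp add: one_le_power)
          ultimately show "I j \<le> (\<sigma> j)\<^sup>2 * I j" by (simp add: mult_le_cancel_right1)
        qed (use elim crit_exp_ge[OF n] in auto)
        finally show ?case .
      qed
      show "(\<lambda>j. crit_exp n * (l j * ((\<sigma> j)\<^sup>2 * I j))) \<longlonglongrightarrow> 0"
        using tendsto_mult[OF tendsto_const tendsto_mult[OF l I], of "crit_exp n"] by simp
    qed
    then show ?thesis using n by (subst (asm) power_tendsto_0_iff) auto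
  qed
  note outer_lim = arc_limits[OF n outer s\<tau>, simplified, OF l, folded B_def J_def]
  have B: "B \<longlonglongrightarrow> c1 n" by (fact outer_lim(2))
  have J: "(\<lambda>j. (\<tau> j)\<^sup>2 * J j) \<longlonglongrightarrow> c2 n / 2" using outer_lim(3) by (simp add: J_def)
  \<comment> \<open>The outer arc ends at 1, so the divergence of b \<tau> is the blow-up of \<tau>
    itself. With r < s <= s \<tau> it also gives r -> 0.\<close>
  have \<tau>1: "\<forall>\<^sub>F j in sequentially. \<tau> j \<ge> 1"
    using outer_lim(1)[unfolded filterlim_at_top] by blast
  have r0: "r \<longlonglongrightarrow> 0"
  proof (rule tendsto_sandwich[OF _ _ tendsto_const s\<tau>])
    show "\<forall>\<^sub>F j in sequentially. 0 \<le> r j" using order by eventually_elim simp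
    show "\<forall>\<^sub>F j in sequentially. r j \<le> s j * \<tau> j"
      using order \<tau>1
    proof eventually_elim
      case (elim j)
      then have "s j * 1 \<le> s j * \<tau> j" by (intro mult_left_mono) auto
      then show ?case using elim by linarith
    qed
  qed
  define Y where "Y j = \<tau> j ^ (n - 4) * l j" for j
  define Q where "Q j = (\<tau> j)\<^sup>2 * I j + (\<tau> j)\<^sup>2 * I\<^sub>1 j + (\<tau> j)\<^sup>2 * J j" for j
  \<comment> \<open>P equals H^2 / 2 at 1, and there it has accumulated the integrals over all three
    arcs.\<close>
  have outer_eq: "\<forall>\<^sub>F j in sequentially. (B j)\<^sup>2 = 2 * Q j * Y j"
    using outer middle_eq order
  proof eventually_elim
    case (elim j)
    interpret radial_arc n "l j" "s j" 1 "v j" "H j" using elim by simp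
    define T where "T = \<tau> j powr ?m"
    have "?m * crit_exp n = real n" using n by (simp add: crit_exp_def)
    then have Tq: "T powr crit_exp n = \<tau> j ^ n"
      unfolding T_def using elim by (simp only: powr_powr powr_realpow)
    have "l j * J j = pohozaev 1 - pohozaev (s j)"
      using pohozaev_identity by (simp add: J_def mult.assoc)
    also have "pohozaev 1 = (H j 1)\<^sup>2 / 2" using elim by (simp add: pohozaev_def)
    also have "pohozaev (s j) = s j ^ n * (l j * T\<^sup>2 / 2 + \<tau> j ^ n / crit_exp n)"
      using elim Tq unfolding pohozaev_def by (simp add: T_def)
    also have "\<dots> = l j * (I j + I\<^sub>1 j)" using elim by (simp add: T_def)
    finally have "(H j 1)\<^sup>2 = 2 * (l j * (I j + I\<^sub>1 j + J j))" by (simp add: algebra_simps)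
    then show ?case unfolding B_def Q_def Y_def using elim
      by (simp add: power_mult_distrib powr_sq n24 algebra_simps)
  qed
  have I1: "(\<lambda>j. (\<tau> j)\<^sup>2 * I\<^sub>1 j) \<longlonglongrightarrow> 0"
  proof (rule tendsto_sandwich[OF _ _ tendsto_const])
    show "\<forall>\<^sub>F j in sequentially. 0 \<le> (\<tau> j)\<^sup>2 * I\<^sub>1 j" using middle_eq by eventually_elim simp
    show "\<forall>\<^sub>F j in sequentially. (\<tau> j)\<^sup>2 * I\<^sub>1 j \<le> (s j * \<tau> j) ^ n / n"
      using middle_eq order
    proof eventually_elim
      case (elim j)
      have "(\<tau> j)\<^sup>2 * I\<^sub>1 j \<le> (\<tau> j)\<^sup>2 * (\<tau> j ^ (n - 2) * s j ^ n / n)"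
        using elim powr_sq[of "\<tau> j"] by (intro mult_left_mono) auto
      also have "\<dots> = (s j * \<tau> j) ^ n / n"
      proof -
        have "2 + (n - 2) = n" using n by simp
        then have "\<tau> j ^ n = (\<tau> j)\<^sup>2 * \<tau> j ^ (n - 2)" by (metis power_add)
        then show ?thesis by (simp add: power_mult_distrib)
      qed
      finally show ?case .
    qed
    have "(\<lambda>j. (s j * \<tau> j) ^ n / n) \<longlonglongrightarrow> 0 ^ n / n"
      using n by (intro tendsto_intros s\<tau>) auto
    then show "(\<lambda>j. (s j * \<tau> j) ^ n / n) \<longlonglongrightarrow> 0" using n by (simp add: power_0_left)
  qed
  \<comment> \<open>The core contributes \<tau>^2 I = (\<tau>/\<sigma>)^2 \<sigma>^2 I to
    \<open>Q\<close>. Dropping \<open>I\<close> and \<open>I\<^sub>1\<close> from \<open>Q\<close>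
    bounds \<open>Y\<close> by \<open>?c + 1\<close>, while \<open>X\<close> exceeds
    \<open>?c / 2\<close>. Since (\<tau>/\<sigma>)^(n-4) X = Y r^(n-2) and r -> 0, the ratio
    vanishes in the limit.\<close>
  have ratio: "(\<lambda>j. \<tau> j / \<sigma> j) \<longlonglongrightarrow> 0"
  proof -
    let ?c = "c_limit n"
    have c: "?c > 0" by (rule c_limit_pos[OF n])
    have "(\<lambda>j. (B j)\<^sup>2 / (2 * ((\<tau> j)\<^sup>2 * J j))) \<longlonglongrightarrow> (c1 n)\<^sup>2 / (2 * (c2 n / 2))"
      using c2_pos[OF n] by (intro tendsto_intros B J) auto
    then have Y_bound: "\<forall>\<^sub>F j in sequentially. (B j)\<^sup>2 / (2 * ((\<tau> j)\<^sup>2 * J j)) < ?c + 1"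
      by (rule order_tendstoD(2)) (simp add: c_limit_def)
    have J_pos: "\<forall>\<^sub>F j in sequentially. (\<tau> j)\<^sup>2 * J j > 0"
      using order_tendstoD(1)[OF J, of 0] c2_pos[OF n] by simp
    have X_bound: "\<forall>\<^sub>F j in sequentially. X j > ?c / 2"
      using order_tendstoD(1)[OF X, of "?c / 2"] c by simp
    have "(\<lambda>j. (\<tau> j / \<sigma> j) ^ (n - 4)) \<longlonglongrightarrow> 0"
    proof (rule tendsto_sandwich[OF _ _ tendsto_const])
      show "\<forall>\<^sub>F j in sequentially. 0 \<le> (\<tau> j / \<sigma> j) ^ (n - 4)" using order by eventually_elim simp
      show "\<forall>\<^sub>F j in sequentially. (\<tau> j / \<sigma> j) ^ (n - 4) \<le> (?c + 1) * r j ^ (n - 2) / (?c / 2)"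
        using Y_bound J_pos X_bound outer_eq order middle_eq I_pos
      proof eventually_elim
        case (elim j)
        have Ij: "I j > 0" using elim(7) by (simp add: zero_less_mult_iff)
        have Yj: "Y j \<ge> 0" using elim(5) by (simp add: Y_def)
        have "2 * ((\<tau> j)\<^sup>2 * J j) * Y j \<le> 2 * Q j * Y j"
          using elim(6) Ij Yj by (intro mult_right_mono) (auto simp: Q_def)
        then have *: "Y j * (2 * ((\<tau> j)\<^sup>2 * J j)) \<le> (B j)\<^sup>2"
          unfolding elim(4) by (simp only: mult.commute)
        have "Y j \<le> (B j)\<^sup>2 / (2 * ((\<tau> j)\<^sup>2 * J j))"
          by (rule mult_imp_le_div_pos[OF _ *]) (use elim(2) in simp)
        then have Y': "Y j \<le> ?c + 1" using elim(1) by simp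
        have "(\<tau> j / \<sigma> j) ^ (n - 4) * X j = Y j * r j ^ (n - 2)"
          using elim(5) by (simp add: X_def Y_def power_divide)
        then have "(\<tau> j / \<sigma> j) ^ (n - 4) = Y j * r j ^ (n - 2) / X j"
          using elim(3) c by (simp add: eq_divide_eq)
        also have "\<dots> \<le> (?c + 1) * r j ^ (n - 2) / (?c / 2)"
          using Y' Yj elim(3,5) c by (intro frac_le mult_right_mono mult_nonneg_nonneg) auto
        finally show ?case .
      qed
      have "(\<lambda>j. (?c + 1) * r j ^ (n - 2) / (?c / 2)) \<longlonglongrightarrow> (?c + 1) * 0 ^ (n - 2) / (?c / 2)"
        using c by (intro tendsto_intros r0) auto
      then show "(\<lambda>j. (?c + 1) * r j ^ (n - 2) / (?c / 2)) \<longlonglongrightarrow> 0" using n by (simp add: power_0_left)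
    qed
    then show ?thesis using n by (subst (asm) power_tendsto_0_iff) auto
  qed
  have "\<forall>\<^sub>F j in sequentially. (\<tau> j / \<sigma> j)\<^sup>2 * ((\<sigma> j)\<^sup>2 * I j) = (\<tau> j)\<^sup>2 * I j"
    using order by eventually_elim (simp add: power_divide)
  moreover have "(\<lambda>j. (\<tau> j / \<sigma> j)\<^sup>2 * ((\<sigma> j)\<^sup>2 * I j)) \<longlonglongrightarrow> 0\<^sup>2 * (c2 n / 2)"
    by (intro tendsto_intros ratio I)
  ultimately have "(\<lambda>j. (\<tau> j)\<^sup>2 * I j) \<longlonglongrightarrow> 0"
    by (simp add: Lim_transform_eventually)
  from tendsto_add[OF tendsto_add[OF this I1] J] have Q: "Q \<longlonglongrightarrow> c2 n / 2"
    by (simp add: Q_def[abs_def])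
  have "(\<lambda>j. (B j)\<^sup>2 / (2 * Q j)) \<longlonglongrightarrow> (c1 n)\<^sup>2 / (2 * (c2 n / 2))"
    using c2_pos[OF n] by (intro tendsto_intros B Q) auto
  moreover have "\<forall>\<^sub>F j in sequentially. (B j)\<^sup>2 / (2 * Q j) = Y j"
    using outer_eq order_tendstoD(1)[OF Q, of 0, simplified, OF c2_pos[OF n]]
    by eventually_elim simp
  ultimately have "Y \<longlonglongrightarrow> c_limit n"
    by (simp add: c_limit_def Lim_transform_eventually)
  then show "(\<lambda>j. \<tau> j ^ (n - 4) * l j) \<longlonglongrightarrow> c_limit n" by (simp add: Y_def[abs_def])
qed

section \<open>Reduction to the radial equation\<close>

lemma has_derivative_partial_deriv_line:
  fixes u :: "real^'n::finite \<Rightarrow> real"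
  assumes "u differentiable (at (x + s *\<^sub>R axis i 1))"
  shows "((\<lambda>s. u (x + s *\<^sub>R axis i 1)) has_real_derivative partial_deriv i u (x + s *\<^sub>R axis i 1)) (at s)"
proof -
  let ?y = "x + s *\<^sub>R axis i 1"
  have D: "(u has_derivative frechet_derivative u (at ?y)) (at ?y)"
    using assms by (simp add: frechet_derivative_works)
  have "((\<lambda>s. x + s *\<^sub>R axis i 1) has_derivative (\<lambda>h. h *\<^sub>R axis i 1)) (at s)"
    by (auto intro!: derivative_eq_intros)
  from has_derivative_compose[OF this D]
  have "((\<lambda>s. u (x + s *\<^sub>R axis i 1)) has_derivative (\<lambda>h. frechet_derivative u (at ?y) (h *\<^sub>R axis i 1))) (at s)" .
  moreover have "frechet_derivative u (at ?y) (h *\<^sub>R axis i 1) = partial_deriv i u ?y * h" for h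
    using linear_scale[OF linear_frechet_derivative[OF assms], of h "axis i 1"]
    by (simp add: partial_deriv_def mult.commute)
  ultimately show ?thesis by (simp add: has_field_derivative_def)
qed

lemma partial_deriv_eqI: "(u has_derivative D) (at x) \<Longrightarrow> partial_deriv i u x = D (axis i 1)"
  by (simp add: partial_deriv_def frechet_derivative_at[symmetric])

lemma has_derivative_radial:
  fixes g :: "real \<Rightarrow> real" and y :: "real^'n::finite"
  assumes "y \<noteq> 0" "(g has_real_derivative g') (at (norm y))"
  shows "((\<lambda>x. g (norm x)) has_derivative (\<lambda>h. g' * (y \<bullet> h / norm y))) (at y)"
proof -
  have "(norm has_derivative (\<lambda>h. y \<bullet> h / norm y)) (at y)"
    using has_derivative_norm[OF assms(1)] by (simp add: sgn_div_norm divide_inverse mult.commute inner_commute)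
  from has_derivative_compose[OF this assms(2)[unfolded has_field_derivative_def]]
  show ?thesis by (simp add: mult.assoc)
qed

text \<open>Away from the origin the gradient is q(|x|) x with q(\<rho>) = g'(\<rho>) / \<rho>.
  Differentiating this product once more and summing gives \<rho> q' + n q.\<close>

lemma radial_laplacian:
  fixes u :: "real^'n::finite \<Rightarrow> real"
  assumes S: "open S" "0 \<notin> S" and y: "y \<in> S"
    and u: "\<And>x. x \<in> S \<Longrightarrow> u x = g (norm x)"
    and g: "\<And>x. x \<in> S \<Longrightarrow> (g has_real_derivative g' (norm x)) (at (norm x))"
    and g': "(g' has_real_derivative g2) (at (norm y))"
  shows "laplacian u y = g2 + (real CARD('n) - 1) * g' (norm y) / norm y"
proof -
  have y0: "y \<noteq> 0" using S y by auto
  define q where "q \<rho> = g' \<rho> / \<rho>" for \<rho>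
  define q' where "q' = (g2 * norm y - g' (norm y)) / (norm y)\<^sup>2"
  have partial: "partial_deriv j u x = q (norm x) * x $ j" if "x \<in> S" for x j
  proof -
    have "x \<noteq> 0" using S that by auto
    from has_derivative_radial[OF this g[OF that]]
    have "(u has_derivative (\<lambda>h. g' (norm x) * (x \<bullet> h / norm x))) (at x)"
      by (rule has_derivative_transform_within_open[OF _ S(1) that]) (simp add: u)
    then show ?thesis by (simp add: partial_deriv_eqI q_def inner_axis)
  qed
  have q: "(q has_real_derivative q') (at (norm y))"
    unfolding q_def q'_def using y0
    by (auto intro!: derivative_eq_intros g' simp: power2_eq_square)
  have "partial_deriv j (partial_deriv j u) y = q' * (y $ j)\<^sup>2 / norm y + q (norm y)" for j
  proof -
    have "((\<lambda>x. x $ j) has_derivative (\<lambda>h. h $ j)) (at y)"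
      by (rule bounded_linear.has_derivative[OF bounded_linear_vec_nth has_derivative_ident])
    from has_derivative_mult[OF has_derivative_radial[OF y0 q] this]
    have "((\<lambda>x. q (norm x) * x $ j) has_derivative
        (\<lambda>h. q (norm y) * h $ j + q' * (y \<bullet> h / norm y) * y $ j)) (at y)" .
    then have "(partial_deriv j u has_derivative
        (\<lambda>h. q (norm y) * h $ j + q' * (y \<bullet> h / norm y) * y $ j)) (at y)"
      by (rule has_derivative_transform_within_open[OF _ S(1) y]) (simp add: partial)
    then show ?thesis by (simp add: partial_deriv_eqI inner_axis power2_eq_square)
  qed
  then have "laplacian u y = (\<Sum>j\<in>UNIV. q' / norm y * (y $ j)\<^sup>2 + q (norm y))"
    by (simp add: laplacian_def)
  also have "\<dots> = q' / norm y * (\<Sum>j\<in>UNIV. (y $ j)\<^sup>2) + real CARD('n) * q (norm y)"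
    by (simp add: sum.distrib sum_distrib_left)
  also have "(\<Sum>j\<in>UNIV. (y $ j)\<^sup>2) = (norm y)\<^sup>2"
    by (simp add: norm_vec_def L2_set_def sum_nonneg)
  also have "q' / norm y * (norm y)\<^sup>2 = g2 - g' (norm y) / norm y"
    using y0 by (simp add: q'_def field_simps power2_eq_square)
  finally show ?thesis by (simp add: q_def algebra_simps diff_divide_distrib)
qed

text \<open>\<open>K\<close> is built as the integral of s^(n-1) f(w) rather than as - s^(n-1) w',
  because u is only continuous up to the boundary and the integral is continuous at 1 at once. The
  two expressions agree inside: their difference is constant by the equation and vanishes at
  0.\<close>

lemma dirichlet_solution_radial_profile:
  fixes u :: "real^'n::finite \<Rightarrow> real"
  assumes n: "CARD('n) \<ge> 2" and sol: "dirichlet_solution (ball 0 1) f u"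
    and rad: "radial u" and f: "continuous_on UNIV f"
  obtains w K where "continuous_on {0..1} w" "continuous_on {0..1} K"
    "\<And>x. x \<in> cball 0 1 \<Longrightarrow> u x = w (norm x)" "w 1 = 0" "K 0 = 0"
    "\<And>s. 0 < s \<Longrightarrow> s < 1 \<Longrightarrow> (w has_real_derivative - K s / s ^ (CARD('n) - 1)) (at s)"
    "\<And>s. 0 < s \<Longrightarrow> s < 1 \<Longrightarrow> (K has_real_derivative s ^ (CARD('n) - 1) * f (w s)) (at s)"
proof -
  let ?n = "CARD('n)"
  obtain i :: 'n where True by simp
  define e :: "real^'n" where "e = axis i 1"
  have norm_e: "norm (s *\<^sub>R e) = \<bar>s\<bar>" for s by (simp add: e_def)
  have [simp]: "norm e = 1" by (simp add: e_def)
  have C2: "C2_on (ball 0 1) u" and cont: "continuous_on (cball 0 1) u"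
    and eq: "\<And>x. x \<in> ball 0 1 \<Longrightarrow> - laplacian u x = f (u x)"
    and bdy: "\<And>x. x \<in> sphere 0 1 \<Longrightarrow> u x = 0"
    using sol by (auto simp: dirichlet_solution_def)
  define w where "w s = u (s *\<^sub>R e)" for s
  define w1 where "w1 s = partial_deriv i u (s *\<^sub>R e)" for s
  define w2 where "w2 s = partial_deriv i (partial_deriv i u) (s *\<^sub>R e)" for s
  have u_w: "u x = w (norm x)" if "x \<in> cball 0 1" for x
    using rad[unfolded radial_def, rule_format, of x "norm x *\<^sub>R e"] that norm_e[of 1]
    by (simp add: w_def)
  have w_cont: "continuous_on {0..1} w" unfolding w_def
    by (intro continuous_on_compose2[OF cont] continuous_intros) (auto simp: norm_e)
  have dw: "(w has_real_derivative w1 s) (at s)" if "\<bar>s\<bar> < 1" for s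
    using has_derivative_partial_deriv_line[of u 0 s i] C2 that norm_e[of s]
    unfolding w_def[abs_def] w1_def C2_on_def e_def by simp
  have dw1: "(w1 has_real_derivative w2 s) (at s)" if "\<bar>s\<bar> < 1" for s
    using has_derivative_partial_deriv_line[of "partial_deriv i u" 0 s i] C2 that norm_e[of s]
    unfolding w1_def[abs_def] w2_def C2_on_def e_def by simp
  have ode: "w2 s + (real ?n - 1) * w1 s / s = - f (w s)" if s: "0 < s" "s < 1" for s
  proof -
    have "laplacian u (s *\<^sub>R e) = w2 s + (real ?n - 1) * w1 (norm (s *\<^sub>R e)) / norm (s *\<^sub>R e)"
    proof (rule radial_laplacian[where S = "ball 0 1 - {0}" and g = w and g' = w1])
      show "(w1 has_real_derivative w2 s) (at (norm (s *\<^sub>R e)))" using dw1[of s] s by (simp add: norm_e)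
    qed (use s norm_e[of s] in \<open>auto intro!: u_w dw simp: e_def\<close>)
    then show ?thesis using eq[of "s *\<^sub>R e"] s norm_e[of s] by (simp add: w_def)
  qed
  define F where "F s = s ^ (?n - 1) * f (w s)" for s
  have F: "continuous_on {0..1} F" unfolding F_def
    by (intro continuous_intros continuous_on_compose2[OF f] w_cont) auto
  define K where "K s = integral {0..s} F" for s
  have K_cont: "continuous_on {0..1} K" unfolding K_def
    by (intro indefinite_integral_continuous_1 integrable_continuous_real F)
  have dK: "(K has_real_derivative F s) (at s)" if "0 < s" "s < 1" for s
    using integral_has_real_derivative[OF F, of s] that
    unfolding K_def[abs_def] by (simp add: at_within_Icc_at)
  have K0: "K 0 = 0" by (simp add: K_def)
  have K_eq: "K s = - (s ^ (?n - 1) * w1 s)" if s: "0 < s" "s < 1" for s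
  proof -
    let ?Z = "\<lambda>s. K s + s ^ (?n - 1) * w1 s"
    have "?Z s = ?Z 0"
    proof (rule DERIV_isconst2[where f = ?Z and a = 0 and b = s])
      \<comment> \<open>u is twice differentiable across the origin, so \<open>w1\<close> is
        differentiable on both sides of 0 and hence continuous there.\<close>
      have "continuous_on {0..s} w1"
        using s by (intro DERIV_atLeastAtMost_imp_continuous_on) (force intro!: exI dw1)
      then show "continuous_on {0..s} ?Z"
        using s by (intro continuous_intros continuous_on_subset[OF K_cont]) auto
      fix x assume x: "0 < x" "x < s"
      have "((\<lambda>s. s ^ (?n - 1)) has_real_derivative real (?n - 1) * x ^ (?n - 1) / x) (at x)"
      proof -
        obtain j where "?n - 1 = Suc j" using n not0_implies_Suc[of "?n - 1"] by auto
        then show ?thesis using DERIV_pow[of "Suc j" x UNIV] x by simp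
      qed
      from DERIV_add[OF dK DERIV_mult[OF this dw1]] x s
      have "(?Z has_real_derivative F x + (real (?n - 1) * x ^ (?n - 1) / x * w1 x + w2 x * x ^ (?n - 1))) (at x)"
        by auto
      moreover have "real (?n - 1) * x ^ (?n - 1) / x * w1 x + w2 x * x ^ (?n - 1)
          = x ^ (?n - 1) * (w2 x + (real ?n - 1) * w1 x / x)"
        using n by (simp add: of_nat_diff algebra_simps)
      ultimately show "(?Z has_real_derivative 0) (at x)"
        using ode[of x] x s by (simp add: F_def)
    qed (use s in auto)
    then show ?thesis using n by (simp add: K0 power_0_left)
  qed
  show ?thesis
  proof (rule that[of w K])
    show "w 1 = 0" using bdy[of e] norm_e[of 1] by (simp add: w_def)
    show "(w has_real_derivative - K s / s ^ (?n - 1)) (at s)" if "0 < s" "s < 1" for s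
      using dw[of s] K_eq[OF that] that by simp
  qed (use w_cont K_cont u_w K0 dK in \<open>auto simp: F_def\<close>)
qed

text \<open>The nonlinearity is odd, so - w and - K solve the same system beyond the node. The point
  \<open>s\<close> maximizes - w on [r, 1]; it is interior, so w' and hence K vanish there. On the
  core w decreases, which makes its value at 0 the supremum.\<close>

lemma nodal_arcs:
  fixes u :: "real^'n::finite \<Rightarrow> real"
  assumes n: "CARD('n) \<ge> 5" and l: "l > 0" and sol: "BN_solution l u" and rad: "radial u"
    and pos: "u 0 > 0" and node: "is_node u r"
  obtains w K s where
    "radial_arc CARD('n) l 0 r w K" "w 0 = M_pos u" "w r = 0" "K 0 = 0"
    "radial_arc CARD('n) l r s (\<lambda>x. - w x) (\<lambda>x. - K x)" "\<And>x. x \<in> {r..s} \<Longrightarrow> - w x \<le> - w s"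
    "radial_arc CARD('n) l s 1 (\<lambda>x. - w x) (\<lambda>x. - K x)" "- w s = M_neg u" "w 1 = 0" "K s = 0"
proof -
  let ?n = "CARD('n)"
  define f where "f t = l * t + \<bar>t\<bar> powr (crit_exp ?n - 2) * t" for t
  have q: "crit_exp ?n > 2" by (rule crit_exp_ge[OF n])
  have f_cont: "continuous_on UNIV f"
    unfolding f_def using q by (intro continuous_intros continuous_on_powr') auto
  have f_pos: "f t = l * t + t powr (crit_exp ?n - 1)" if "t > 0" for t
  proof -
    have "t powr (1 + (crit_exp ?n - 2)) = t * t powr (crit_exp ?n - 2)"
      using that by (simp only: powr_mult_base less_imp_le)
    then show ?thesis using that by (simp add: f_def)
  qed
  have f_minus: "f (- t) = - f t" for t by (simp add: f_def)
  have n2: "?n \<ge> 2" using n by simp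
  have sol': "dirichlet_solution (ball 0 1) f u" using sol by (simp add: BN_solution_def f_def[abs_def])
  obtain w K where cont: "continuous_on {0..1} w" "continuous_on {0..1} K"
    and u: "\<And>x. x \<in> cball 0 1 \<Longrightarrow> u x = w (norm x)" and w1: "w 1 = 0" and K0: "K 0 = 0"
    and dw: "\<And>s. 0 < s \<Longrightarrow> s < 1 \<Longrightarrow> (w has_real_derivative - K s / s ^ (?n - 1)) (at s)"
    and dK: "\<And>s. 0 < s \<Longrightarrow> s < 1 \<Longrightarrow> (K has_real_derivative s ^ (?n - 1) * f (w s)) (at s)"
    by (rule dirichlet_solution_radial_profile[OF n2 sol' rad f_cont]) (rule that)
  have r: "0 < r" "r < 1" using node by (auto simp: is_node_def)
  obtain i :: 'n where True by simp
  have point: "\<exists>x::real^'n. norm x = t" if "t \<ge> 0" for t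
    using that by (intro exI[of _ "t *\<^sub>R axis i 1"]) simp
  have w_pos: "w t > 0" if "0 \<le> t" "t < r" for t
    using point[OF that(1)] node u that r by (fastforce simp: is_node_def)
  have w_neg: "w t < 0" if "r < t" "t < 1" for t
    using point[of t] node u that r by (fastforce simp: is_node_def)
  have wr: "w r = 0"
  proof (rule antisym)
    have cl: "r \<in> closure {0<..<r}" "r \<in> closure {r<..<1}" using r by auto
    have "w ` closure {0<..<r} \<subseteq> {0..}"
      using r cont w_pos by (intro image_closure_subset) (auto intro: continuous_on_subset less_imp_le)
    then show "w r \<ge> 0" using cl by blast
    have "w ` closure {r<..<1} \<subseteq> {..0}"
      using r cont w_neg by (intro image_closure_subset) (auto intro: continuous_on_subset less_imp_le)
    then show "w r \<le> 0" using cl by blast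
  qed
  have inner: "decreasing_arc ?n l 0 r w K"
  proof unfold_locales
    fix x assume "0 < x" "x < r"
    then show "(K has_real_derivative x ^ (?n - 1) * (l * w x + w x powr (crit_exp ?n - 1))) (at x)"
      using dK[of x] f_pos[of "w x"] w_pos[of x] r by simp
  qed (use n l r K0 w_pos dw in \<open>auto intro: continuous_on_subset[OF cont(1)] continuous_on_subset[OF cont(2)]\<close>)
  have outer: "radial_arc ?n l a b (\<lambda>x. - w x) (\<lambda>x. - K x)" if "r \<le> a" "a < b" "b \<le> 1" for a b
  proof unfold_locales
    show "continuous_on {a..b} (\<lambda>x. - w x)" "continuous_on {a..b} (\<lambda>x. - K x)"
      using that r by (auto intro!: continuous_on_minus intro: continuous_on_subset[OF cont(1)] continuous_on_subset[OF cont(2)])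
    fix x assume x: "a < x" "x < b"
    then have x': "0 < x" "x < 1" and wx: "w x < 0" using that r w_neg by auto
    show "- w x > 0" using wx by simp
    show "((\<lambda>x. - w x) has_real_derivative - (- K x) / x ^ (?n - 1)) (at x)"
      using DERIV_minus[OF dw[OF x']] by simp
    show "((\<lambda>x. - K x) has_real_derivative x ^ (?n - 1) * (l * - w x + (- w x) powr (crit_exp ?n - 1))) (at x)"
    proof -
      have "l * - w x + (- w x) powr (crit_exp ?n - 1) = - f (w x)"
        using f_pos[of "- w x"] f_minus[of "w x"] wx by simp
      then show ?thesis using DERIV_minus[OF dK[OF x']] by (simp only: mult_minus_right)
    qed
  qed (use n l r that in auto)
  have "compact {r..1}" "{r..1} \<noteq> {}" "continuous_on {r..1} (\<lambda>x. - w x)"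
    using r by (auto intro!: continuous_on_minus intro: continuous_on_subset[OF cont(1)])
  from continuous_attains_sup[OF this]
  obtain s where s: "s \<in> {r..1}" and s_max: "\<And>x. x \<in> {r..1} \<Longrightarrow> - w x \<le> - w s" by blast
  \<comment> \<open>The midpoint of [r, 1] shows that the maximum is positive, which excludes the
    end points r and 1, where w = 0.\<close>
  have ws: "- w s > 0" using s_max[of "(r + 1) / 2"] w_neg[of "(r + 1) / 2"] r by (auto simp: field_simps)
  then have s': "r < s" "s < 1" using s wr w1 by (auto simp: order_less_le)
  have "- (- K s / s ^ (?n - 1)) = 0"
  proof (rule DERIV_local_max[OF DERIV_minus[OF dw]])
    show "\<forall>y. \<bar>s - y\<bar> < min (s - r) (1 - s) \<longrightarrow> - w y \<le> - w s"
    proof (intro allI impI)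
      fix y assume "\<bar>s - y\<bar> < min (s - r) (1 - s)"
      then have "y \<in> {r..1}" by auto
      then show "- w y \<le> - w s" by (rule s_max)
    qed
  qed (use s' r in auto)
  then have Ks: "K s = 0" using s' r by simp
  interpret inner: decreasing_arc ?n l 0 r w K by fact
  have "M_pos u = w 0" unfolding M_pos_def sup_norm_def
  proof (rule cSup_eq_maximum)
    show "w 0 \<in> (\<lambda>x. \<bar>max (u x) 0\<bar>) ` ball 0 1"
      using u[of 0] pos by (intro image_eqI[of _ _ 0]) auto
    fix y assume "y \<in> (\<lambda>x. \<bar>max (u x) 0\<bar>) ` ball 0 1"
    then obtain x where "x \<in> ball 0 1" "y = \<bar>max (u x) 0\<bar>" by blast
    then have x: "norm x < 1" "y = max (w (norm x)) 0" using u[of x] by auto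
    show "y \<le> w 0"
    proof (cases "norm x \<le> r")
      case True
      then show ?thesis using inner.w_antimono[of 0 "norm x"] x w_pos[of 0] r by simp
    next
      case False
      then show ?thesis using w_neg[of "norm x"] x w_pos[of 0] r by simp
    qed
  qed
  then have M_pos: "w 0 = M_pos u" ..
  have "M_neg u = - w s" unfolding M_neg_def sup_norm_def
  proof (rule cSup_eq_maximum)
    obtain x :: "real^'n" where "norm x = s" using point[of s] s' r by auto
    then show "- w s \<in> (\<lambda>x. \<bar>max (- u x) 0\<bar>) ` ball 0 1"
      using u[of x] ws s' by (intro image_eqI[of _ _ x]) auto
    fix y assume "y \<in> (\<lambda>x. \<bar>max (- u x) 0\<bar>) ` ball 0 1"
    then obtain x where "x \<in> ball 0 1" "y = \<bar>max (- u x) 0\<bar>" by blast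
    then have x: "norm x < 1" "y = max (- w (norm x)) 0" using u[of x] by auto
    show "y \<le> - w s"
    proof (cases "norm x < r")
      case True
      then show ?thesis using w_pos[of "norm x"] x ws by simp
    next
      case False
      then show ?thesis using s_max[of "norm x"] x ws by simp
    qed
  qed
  then have M_neg: "- w s = M_neg u" ..
  show ?thesis
  proof (rule that[of w K s])
    show "- w x \<le> - w s" if "x \<in> {r..s}" for x
      using that s' by (intro s_max) auto
  qed (use s' in \<open>simp_all add: inner.radial_arc_axioms outer M_pos M_neg wr w1 K0 Ks\<close>)
qed

section \<open>The first Dirichlet eigenvalue of the ball\<close>

text \<open>If c were positive, g' would vanish at x and be positive just to the right of it, and g
  would rise above its maximum.\<close>

lemma second_derivative_nonpos_at_max:
  fixes g :: "real \<Rightarrow> real"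
  assumes d: "d > 0" and g: "\<And>t. \<bar>t - x\<bar> < d \<Longrightarrow> (g has_real_derivative g' t) (at t)"
    and g': "(g' has_real_derivative c) (at x)" and max: "\<And>t. \<bar>t - x\<bar> < d \<Longrightarrow> g t \<le> g x"
  shows "c \<le> 0"
proof (rule ccontr)
  assume "\<not> c \<le> 0"
  then have c: "c > 0" by simp
  have g'0: "g' x = 0"
    by (rule DERIV_local_max[OF g d]) (use d max in \<open>auto simp: abs_minus_commute\<close>)
  obtain e where e: "e > 0" "\<And>h. 0 < h \<Longrightarrow> h < e \<Longrightarrow> g' x < g' (x + h)"
    using DERIV_pos_inc_right[OF g' c] by auto
  define h where "h = min e d / 2"
  have h: "0 < h" "h < e" "h < d" using e d by (auto simp: h_def min_def)
  have "g x < g (x + h)"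
  proof (rule DERIV_pos_imp_increasing_open[where f = g])
    fix t assume t: "x < t" "t < x + h"
    then have "g' t > 0" using e(2)[of "t - x"] h g'0 by simp
    then show "\<exists>y. (g has_real_derivative y) (at t) \<and> y > 0" using g[of t] t h by auto
  next
    show "continuous_on {x..x + h} g"
      using h by (intro DERIV_atLeastAtMost_imp_continuous_on) (force intro!: exI g)
  qed (use h in auto)
  then show False using max[of "x + h"] h by simp
qed

text \<open>The function \<open>2 - |x|\<^sup>2\<close> is a positive supersolution for every \<open>l < n\<close>.\<close>

lemma dirichlet_eigenvalue_ball_ge:
  assumes "dirichlet_eigenvalue (ball (0::real^'n::finite) 1) l"
  shows "l \<ge> real CARD('n)"
proof -
  obtain \<phi> :: "real^'n \<Rightarrow> real" and x where sol: "dirichlet_solution (ball 0 1) (\<lambda>t. l * t) \<phi>"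
    and x: "x \<in> ball 0 1" "\<phi> x > 0"
  proof -
    obtain \<phi> :: "real^'n \<Rightarrow> real" and x where sol: "dirichlet_solution (ball 0 1) (\<lambda>t. l * t) \<phi>"
      and x: "x \<in> ball 0 1" "\<phi> x \<noteq> 0" using assms by (auto simp: dirichlet_eigenvalue_def)
    show thesis
    proof (cases "\<phi> x > 0")
      case True
      then show thesis using that sol x by blast
    next
      case False
      \<comment> \<open>\<open>partial_deriv\<close> is read off \<open>frechet_derivative\<close>,
        so a sign passes through it only where the function is known to be differentiable.\<close>
      have p: "partial_deriv i (\<lambda>x. - u x) y = - partial_deriv i u y" if "u differentiable at y"
        for i and u :: "real^'n \<Rightarrow> real" and y
        using has_derivative_minus[OF that[unfolded frechet_derivative_works]]
        by (simp add: partial_deriv_eqI) (simp add: partial_deriv_def)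
      have C2: "C2_on (ball 0 1) \<phi>" using sol by (simp add: dirichlet_solution_def)
      have D1: "\<phi> differentiable at y" "partial_deriv i \<phi> differentiable at y" if "y \<in> ball 0 1" for y i
        using C2 that unfolding C2_on_def by blast+
      have p1: "partial_deriv i (\<lambda>x. - \<phi> x) y = - partial_deriv i \<phi> y" if "y \<in> ball 0 1" for i y
        using p D1 that by blast
      have D2: "(partial_deriv i (\<lambda>x. - \<phi> x) has_derivative (\<lambda>h. - frechet_derivative (partial_deriv i \<phi>) (at y) h)) (at y)"
        if "y \<in> ball 0 1" for i y
        by (rule has_derivative_transform_within_open[OF has_derivative_minus[OF D1(2)[OF that, unfolded frechet_derivative_works]] _ that])
          (auto simp: p1)
      have p2: "partial_deriv j (partial_deriv i (\<lambda>x. - \<phi> x)) y = - partial_deriv j (partial_deriv i \<phi>) y"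
        if "y \<in> ball 0 1" for i j y
        using partial_deriv_eqI[OF D2[OF that]] by (simp add: partial_deriv_def)
      have "C2_on (ball 0 1) (\<lambda>x. - \<phi> x)"
        unfolding C2_on_def
      proof (intro conjI ballI allI)
        fix i j
        have "continuous_on (ball 0 1) (\<lambda>x. - partial_deriv i (partial_deriv j \<phi>) x)"
          using C2 by (intro continuous_on_minus) (simp add: C2_on_def)
        then show "continuous_on (ball 0 1) (partial_deriv i (partial_deriv j (\<lambda>x. - \<phi> x)))"
          by (subst continuous_on_cong[OF refl p2])
      next
        fix y :: "real^'n" assume y: "y \<in> ball 0 1"
        show "(\<lambda>x. - \<phi> x) differentiable at y" using D1(1)[OF y] by (rule differentiable_minus)
        show "partial_deriv i (\<lambda>x. - \<phi> x) differentiable at y" for i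
          using D2[OF y] unfolding differentiable_def by blast
      qed
      then have "dirichlet_solution (ball 0 1) (\<lambda>t. l * t) (\<lambda>x. - \<phi> x)"
        using sol unfolding dirichlet_solution_def laplacian_def
        by (auto simp: p2 sum_negf intro: continuous_on_minus)
      then show thesis using that[of "\<lambda>x. - \<phi> x" x] False x by simp
    qed
  qed
  have C2: "C2_on (ball 0 1) \<phi>" and cont: "continuous_on (cball 0 1) \<phi>"
    and eq: "\<And>y. y \<in> ball 0 1 \<Longrightarrow> - laplacian \<phi> y = l * \<phi> y"
    and bdy: "\<And>y. y \<in> sphere 0 1 \<Longrightarrow> \<phi> y = 0"
    using sol by (auto simp: dirichlet_solution_def)
  define G :: "real^'n \<Rightarrow> real" where "G y = 2 - (norm y)\<^sup>2" for y
  have G: "G y \<ge> 1" if "y \<in> cball 0 1" for y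
    using that by (simp add: G_def power_le_one)
  have "continuous_on (cball 0 1) (\<lambda>y. \<phi> y / G y)"
    using G unfolding G_def[abs_def] by (intro continuous_intros cont) force+
  from continuous_attains_sup[OF compact_cball _ this]
  obtain z where z: "z \<in> cball 0 1" and z_max: "\<And>y. y \<in> cball 0 1 \<Longrightarrow> \<phi> y / G y \<le> \<phi> z / G z" by auto
  \<comment> \<open>The least multiple of \<open>G\<close> lying above \<phi>, with contact at
    \<open>z\<close>. The boundary values 0 and m > 0 keep \<open>z\<close> inside the ball.\<close>
  define m where "m = \<phi> z / G z"
  have "\<phi> x / G x > 0" using x G[of x] by simp
  then have m: "m > 0" using z_max[of x] x by (simp add: m_def)
  then have z': "z \<in> ball 0 1" using bdy[of z] z by (force simp: m_def)
  have \<phi>z: "\<phi> z = m * G z" using G[OF z] by (simp add: m_def)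
  have le: "\<phi> y \<le> m * G y" if "y \<in> cball 0 1" for y
    using z_max[OF that] G[OF that] by (simp add: m_def[symmetric] divide_le_eq)
  obtain d where d: "d > 0" "ball z d \<subseteq> ball 0 1"
    using z' open_ball open_contains_ball by blast
  \<comment> \<open>At the contact point the pure second derivatives of \<phi> - m G are
    nonpositive, and those of m G are - 2 m. Summing gives l G(z) >= 2n, and G <= 2.\<close>
  have "partial_deriv i (partial_deriv i \<phi>) z \<le> - 2 * m" for i
  proof -
    let ?y = "\<lambda>t. z + t *\<^sub>R axis i 1"
    have y: "?y t \<in> ball 0 1" if "\<bar>t\<bar> < d" for t
      using that d by (intro subsetD[OF d(2)]) (simp add: dist_norm)
    have d1: "((\<lambda>t. \<phi> (?y t)) has_real_derivative partial_deriv i \<phi> (?y t)) (at t)" if "\<bar>t\<bar> < d" for t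
      using C2 y[OF that] by (intro has_derivative_partial_deriv_line) (simp add: C2_on_def)
    have d2: "((\<lambda>t. partial_deriv i \<phi> (?y t)) has_real_derivative partial_deriv i (partial_deriv i \<phi>) (?y 0)) (at 0)"
      using C2 y[of 0] d by (intro has_derivative_partial_deriv_line) (simp add: C2_on_def)
    have sq: "(norm (?y t))\<^sup>2 = (norm z)\<^sup>2 + 2 * (z $ i) * t + t\<^sup>2" for t
      unfolding power2_norm_eq_inner
      by (simp add: inner_add_left inner_add_right inner_axis inner_axis_axis inner_commute[of "axis i 1"] power2_eq_square algebra_simps)
    have "partial_deriv i (partial_deriv i \<phi>) (?y 0) - m * (- 2) \<le> 0"
    proof (rule second_derivative_nonpos_at_max[OF d(1), where x = 0
          and g = "\<lambda>t. \<phi> (?y t) - m * (2 - ((norm z)\<^sup>2 + 2 * (z $ i) * t + t\<^sup>2))"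
          and g' = "\<lambda>t. partial_deriv i \<phi> (?y t) - m * (- (2 * z $ i + 2 * t))"])
      fix t assume t: "\<bar>t - 0\<bar> < d"
      show "((\<lambda>t. \<phi> (?y t) - m * (2 - ((norm z)\<^sup>2 + 2 * (z $ i) * t + t\<^sup>2))) has_real_derivative
          partial_deriv i \<phi> (?y t) - m * (- (2 * z $ i + 2 * t))) (at t)"
        using t by (intro DERIV_diff d1 DERIV_cmult) (auto intro!: derivative_eq_intros)
      show "\<phi> (?y t) - m * (2 - ((norm z)\<^sup>2 + 2 * (z $ i) * t + t\<^sup>2))
          \<le> \<phi> (?y 0) - m * (2 - ((norm z)\<^sup>2 + 2 * (z $ i) * 0 + 0\<^sup>2))"
        using le[of "?y t"] y[of t] t \<phi>z unfolding G_def sq by simp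
    next
      show "((\<lambda>t. partial_deriv i \<phi> (?y t) - m * (- (2 * z $ i + 2 * t))) has_real_derivative
          partial_deriv i (partial_deriv i \<phi>) (?y 0) - m * (- 2)) (at 0)"
        by (intro DERIV_diff d2 DERIV_cmult) (auto intro!: derivative_eq_intros)
    qed
    then show ?thesis by simp
  qed
  then have "laplacian \<phi> z \<le> (\<Sum>i\<in>(UNIV::'n set). - 2 * m)"
    unfolding laplacian_def by (intro sum_mono)
  then have "2 * m * real CARD('n) \<le> l * (m * G z)"
    using eq[OF z'] \<phi>z by (simp add: mult_ac)
  then have ge: "2 * real CARD('n) \<le> l * G z" using m by (simp add: mult.assoc mult.left_commute[of _ m])
  have "0 < 2 * real CARD('n)" by simp
  also note ge
  finally have "l > 0" using G[OF z] by (simp add: zero_less_mult_iff)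
  then have "l * G z \<le> l * 2" by (intro mult_left_mono) (simp_all add: G_def)
  with ge show ?thesis by simp
qed

text \<open>Power series in t = r^2 of the radial solution of \<Delta>G + G = 0, G(0) = 1, a
  multiple of r^(1-n/2) J_(n/2-1)(r). For G(r) = F(r^2) the equation is 4 t F'' + 2n F' + F = 0,
  whose coefficients give this recursion. Expanding in r^2 avoids any singularity at the
  origin.\<close>

primrec bessel_coeff :: "real \<Rightarrow> nat \<Rightarrow> real" where
  "bessel_coeff n 0 = 1"
| "bessel_coeff n (Suc k) = - bessel_coeff n k / (real (Suc k) * (4 * real k + 2 * n))"

text \<open>The factor 4k + 2n is at least 1, so the coefficients are dominated by those of the
  exponential series.\<close>

lemma bessel_series_summable:
  assumes "n \<ge> 1"
  shows "summable (\<lambda>k. bessel_coeff n k * t ^ k)"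
proof -
  have le: "\<bar>bessel_coeff n k\<bar> \<le> inverse (fact k)" for k
  proof (induction k)
    case (Suc k)
    have "real (Suc k) * 1 \<le> real (Suc k) * (4 * real k + 2 * n)"
      using assms by (intro mult_left_mono) auto
    then have "\<bar>bessel_coeff n k\<bar> / (real (Suc k) * (4 * real k + 2 * n)) \<le> inverse (fact k) / real (Suc k)"
      using Suc by (intro frac_le) auto
    moreover have pos: "real (Suc k) * (4 * real k + 2 * n) > 0" using assms by (intro mult_pos_pos) auto
    have "\<bar>bessel_coeff n (Suc k)\<bar> = \<bar>bessel_coeff n k\<bar> / (real (Suc k) * (4 * real k + 2 * n))"
      by (simp only: bessel_coeff.simps abs_divide abs_minus_cancel abs_of_pos[OF pos])
    moreover have "inverse (fact (Suc k)) = inverse (fact k) / real (Suc k)"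
      by (simp add: divide_inverse mult.commute)
    ultimately show ?case by (simp only:)
  qed simp
  show ?thesis
  proof (rule summable_comparison_test'[where N = 0])
    show "summable (\<lambda>k. inverse (fact k) * \<bar>t\<bar> ^ k)" by (rule summable_exp)
    show "norm (bessel_coeff n k * t ^ k) \<le> inverse (fact k) * \<bar>t\<bar> ^ k" for k
      using le[of k] by (simp add: abs_mult power_abs mult_right_mono)
  qed
qed

lemma bessel_type_solution:
  fixes n :: real
  assumes n: "n \<ge> 1"
  obtains F F1 F2 :: "real \<Rightarrow> real" where "F 0 = 1"
    "\<And>t. (F has_real_derivative F1 t) (at t)" "\<And>t. (F1 has_real_derivative F2 t) (at t)"
    "continuous_on UNIV F2" "\<And>t. 4 * t * F2 t + 2 * n * F1 t + F t = 0"
proof -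
  let ?a = "bessel_coeff n"
  define F where "F t = (\<Sum>k. ?a k * t ^ k)" for t
  define F1 where "F1 t = (\<Sum>k. diffs ?a k * t ^ k)" for t
  define F2 where "F2 t = (\<Sum>k. diffs (diffs ?a) k * t ^ k)" for t
  note s0 = bessel_series_summable[OF n]
  have s1: "summable (\<lambda>k. diffs ?a k * t ^ k)" for t
    by (rule termdiff_converges_all) (rule s0)
  have s2: "summable (\<lambda>k. diffs (diffs ?a) k * t ^ k)" for t
    by (rule termdiff_converges_all) (rule s1)
  have s3: "summable (\<lambda>k. diffs (diffs (diffs ?a)) k * t ^ k)" for t
    by (rule termdiff_converges_all) (rule s2)
  have dF2: "(F2 has_real_derivative (\<Sum>k. diffs (diffs (diffs ?a)) k * t ^ k)) (at t)" for t
    unfolding F2_def[abs_def] by (rule termdiffs_strong_converges_everywhere) (rule s2)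
  show ?thesis
  proof (rule that[of F F1 F2])
    show "F 0 = 1" unfolding F_def by (subst suminf_finite[of "{0}"]) (auto simp: power_0_left)
    show "(F has_real_derivative F1 t) (at t)" for t
      unfolding F_def[abs_def] F1_def by (rule termdiffs_strong_converges_everywhere) (rule s0)
    show "(F1 has_real_derivative F2 t) (at t)" for t
      unfolding F1_def[abs_def] F2_def by (rule termdiffs_strong_converges_everywhere) (rule s1)
    show "continuous_on UNIV F2"
      using dF2 by (meson DERIV_isCont continuous_at_imp_continuous_on)
    show "4 * t * F2 t + 2 * n * F1 t + F t = 0" for t
    proof -
      have "(\<lambda>k. t * (diffs (diffs ?a) k * t ^ k)) sums (t * F2 t)"
        unfolding F2_def by (intro sums_mult summable_sums s2)
      then have "(\<lambda>k. real (Suc k) * diffs ?a (Suc k) * t ^ Suc k) sums (t * F2 t)"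
        by (simp add: diffs_def mult_ac)
      \<comment> \<open>The factor t shifts the series of \<open>F2\<close> by one index; the term
        restored at index 0 has the factor 0.\<close>
      then have "(\<lambda>k. real k * diffs ?a k * t ^ k) sums (t * F2 t)"
        using sums_Suc_iff[of "\<lambda>k. real k * diffs ?a k * t ^ k"] by simp
      moreover have "(\<lambda>k. diffs ?a k * t ^ k) sums F1 t" "(\<lambda>k. ?a k * t ^ k) sums F t"
        unfolding F1_def F_def by (intro summable_sums s1 s0)+
      ultimately have "(\<lambda>k. 4 * (real k * diffs ?a k * t ^ k) + 2 * n * (diffs ?a k * t ^ k) + ?a k * t ^ k)
          sums (4 * (t * F2 t) + 2 * n * F1 t + F t)"
        by (intro sums_add sums_mult)
      moreover have "4 * (real k * diffs ?a k * t ^ k) + 2 * n * (diffs ?a k * t ^ k) + ?a k * t ^ k = 0" for k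
      proof -
        have "(4 * real k + 2 * n) * diffs ?a k = - ?a k"
          using n by (simp add: diffs_def divide_simps add_pos_nonneg)
        then have "((4 * real k + 2 * n) * diffs ?a k + ?a k) * t ^ k = 0" by simp
        then show ?thesis by (simp add: algebra_simps)
      qed
      ultimately have "(\<lambda>k. 0) sums (4 * (t * F2 t) + 2 * n * F1 t + F t)" by simp
      then show ?thesis using sums_unique2[OF sums_zero] by (simp add: mult.assoc)
    qed
  qed
qed

text \<open>With \<open>G r = F (r\<^sup>2)\<close>, the derivative of \<open>arctan (- G' / G)\<close> is at least \<open>3 / 4\<close> for large \<open>r\<close>,
  so \<open>G\<close> cannot be free of zeros.\<close>

lemma bessel_type_zero:
  fixes n :: real
  assumes n: "n \<ge> 1"
    and F: "\<And>t. (F has_real_derivative F1 t) (at t)" "\<And>t. (F1 has_real_derivative F2 t) (at t)"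
    and ode: "\<And>t. 4 * t * F2 t + 2 * n * F1 t + F t = 0"
  shows "\<exists>t>0. F t = 0"
proof (rule ccontr)
  assume "\<not> (\<exists>t>0. F t = 0)"
  then have nz: "F t \<noteq> 0" if "t > 0" for t using that by blast
  \<comment> \<open>For q = - G'/G the equation becomes the Riccati equation q' = 1 + q^2 - (n-1)/r
    q, with right side \<open>dq\<close>.\<close>
  define q where "q r = - (2 * r * F1 (r\<^sup>2)) / F (r\<^sup>2)" for r
  define dq where "dq r = 1 + (q r)\<^sup>2 - (n - 1) / r * q r" for r
  have sq: "((\<lambda>r. r\<^sup>2) has_real_derivative 2 * r) (at r)" for r :: real
    by (auto intro!: derivative_eq_intros)
  have q: "(q has_real_derivative dq r) (at r)" if r: "r > 0" for r
  proof -
    have dF: "((\<lambda>r. F (r\<^sup>2)) has_real_derivative F1 (r\<^sup>2) * (2 * r)) (at r)"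
      and dF1: "((\<lambda>r. F1 (r\<^sup>2)) has_real_derivative F2 (r\<^sup>2) * (2 * r)) (at r)"
      by (rule DERIV_chain2[OF F(1) sq], rule DERIV_chain2[OF F(2) sq])
    have "((\<lambda>r. - (2 * r * F1 (r\<^sup>2))) has_real_derivative - (2 * F1 (r\<^sup>2) + 2 * r * (F2 (r\<^sup>2) * (2 * r)))) (at r)"
      by (auto intro!: derivative_eq_intros dF1)
    from DERIV_divide[OF this dF] nz[of "r\<^sup>2"] r
    have "(q has_real_derivative ((- (2 * F1 (r\<^sup>2) + 2 * r * (F2 (r\<^sup>2) * (2 * r)))) * F (r\<^sup>2)
        - (- (2 * r * F1 (r\<^sup>2))) * (F1 (r\<^sup>2) * (2 * r))) / (F (r\<^sup>2) * F (r\<^sup>2))) (at r)"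
      unfolding q_def[abs_def] by simp
    moreover have "4 * r * r * F2 (r\<^sup>2) = - 2 * n * F1 (r\<^sup>2) - F (r\<^sup>2)"
      using ode[of "r\<^sup>2"] by (simp add: power2_eq_square)
    then have "- (2 * F1 (r\<^sup>2) + 2 * r * (F2 (r\<^sup>2) * (2 * r))) = 2 * (n - 1) * F1 (r\<^sup>2) + F (r\<^sup>2)"
      by (simp add: algebra_simps)
    moreover have "((2 * (n - 1) * F1 (r\<^sup>2) + F (r\<^sup>2)) * F (r\<^sup>2)
        - (- (2 * r * F1 (r\<^sup>2))) * (F1 (r\<^sup>2) * (2 * r))) / (F (r\<^sup>2) * F (r\<^sup>2)) = dq r"
      unfolding dq_def q_def using nz[of "r\<^sup>2"] r by (simp add: field_simps power2_eq_square)
    ultimately show ?thesis by simp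
  qed
  \<comment> \<open>Beyond 2n the coefficient (n-1)/r is at most 1/2, so the cross term costs at
    most |q|/2 <= (1 + q^2)/4. Over a length of 8 the arctangent would gain 6, more than the width
    \<pi> of its range.\<close>
  define R where "R = 2 * n"
  have R: "R > 0" using n by (simp add: R_def)
  have d_arctan: "((\<lambda>r. arctan (q r)) has_real_derivative inverse (1 + (q r)\<^sup>2) * dq r) (at r)" if "r > 0" for r
    using DERIV_chain2[OF DERIV_arctan q[OF that]] .
  have "3 / 4 * (R + 8) - 3 / 4 * R \<le> arctan (q (R + 8)) - arctan (q R)"
  proof (rule derivative_le_imp_increment_le[where f = "\<lambda>r. 3 / 4 * r"])
    show "continuous_on {R..R + 8} (\<lambda>r. arctan (q r))"
      using R by (intro DERIV_atLeastAtMost_imp_continuous_on) (force intro!: exI d_arctan)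
    fix r assume r: "R < r" "r < R + 8"
    then have r0: "r > 0" using R by simp
    show "((\<lambda>r. arctan (q r)) has_real_derivative inverse (1 + (q r)\<^sup>2) * dq r) (at r)"
      by (rule d_arctan[OF r0])
    show "((\<lambda>r. 3 / 4 * r) has_real_derivative 3 / 4) (at r)" by (auto intro!: derivative_eq_intros)
    have "(n - 1) / r \<le> 1 / 2" using r r0 by (simp add: R_def divide_le_eq)
    moreover have "(n - 1) / r \<ge> 0" using n r0 by simp
    ultimately have "(n - 1) / r * \<bar>q r\<bar> \<le> 1 / 2 * \<bar>q r\<bar>" by (intro mult_right_mono) auto
    moreover have "(n - 1) / r * q r \<le> (n - 1) / r * \<bar>q r\<bar>" using n r0 by (intro mult_left_mono) auto
    moreover have "2 * \<bar>q r\<bar> \<le> 1 + (q r)\<^sup>2"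
      using sum_squares_bound[of "\<bar>q r\<bar>" 1] by simp
    ultimately have "3 / 4 * (1 + (q r)\<^sup>2) \<le> dq r" by (simp add: dq_def)
    moreover have "1 + (q r)\<^sup>2 > 0" by (simp add: add_pos_nonneg)
    ultimately show "3 / 4 \<le> inverse (1 + (q r)\<^sup>2) * dq r" by (simp add: field_simps)
  qed (auto intro!: continuous_intros)
  moreover have "arctan (q (R + 8)) < pi / 2" "- (pi / 2) < arctan (q R)"
    using arctan_bounded by blast+
  moreover have "3 / 4 * (R + 8) - 3 / 4 * R = 6" by (simp add: field_simps)
  ultimately show False using pi_less_4 by linarith
qed

text \<open>A positive zero j of F plays two roles: F(j |x|^2) vanishes on the unit sphere, and the
  scaling makes j its eigenvalue.\<close>

lemma ex_dirichlet_eigenvalue_ball: "\<exists>l. dirichlet_eigenvalue (ball (0::real^'n::finite) 1) l"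
proof -
  let ?n = "real CARD('n)"
  have n: "?n \<ge> 1" by (simp add: Suc_leI)
  obtain F F1 F2 where F0: "F 0 = 1" and F: "\<And>t. (F has_real_derivative F1 t) (at t)"
    and F1: "\<And>t. (F1 has_real_derivative F2 t) (at t)" and F2: "continuous_on UNIV F2"
    and ode: "\<And>t. 4 * t * F2 t + 2 * ?n * F1 t + F t = 0"
    by (rule bessel_type_solution[OF n]) (rule that)
  obtain j where j: "j > 0" "F j = 0" using bessel_type_zero[OF n F F1 ode] by blast
  define \<phi> :: "real^'n \<Rightarrow> real" where "\<phi> x = F (j * (x \<bullet> x))" for x
  have d: "((\<lambda>x::real^'n. j * (x \<bullet> x)) has_derivative (\<lambda>h. 2 * j * (x \<bullet> h))) (at x)" for x
    by (auto intro!: derivative_eq_intros simp: inner_commute algebra_simps)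
  have F1_cont: "continuous_on UNIV F1"
    using F1 by (meson DERIV_isCont continuous_at_imp_continuous_on)
  have d\<phi>: "(\<phi> has_derivative (\<lambda>h. F1 (j * (x \<bullet> x)) * (2 * j * (x \<bullet> h)))) (at x)" for x
    unfolding \<phi>_def[abs_def] using has_derivative_compose[OF d F[unfolded has_field_derivative_def]] .
  have p1: "partial_deriv i \<phi> = (\<lambda>x. 2 * j * (x $ i * F1 (j * (x \<bullet> x))))" for i
    by (rule ext) (simp add: partial_deriv_eqI[OF d\<phi>] inner_axis)
  have nth: "((\<lambda>x::real^'n. x $ i) has_derivative (\<lambda>h. h $ i)) (at x)" for i x
    by (rule bounded_linear.has_derivative[OF bounded_linear_vec_nth has_derivative_ident])
  have d1: "(partial_deriv i \<phi> has_derivative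
      (\<lambda>h. 2 * j * (x $ i * (F2 (j * (x \<bullet> x)) * (2 * j * (x \<bullet> h))) + h $ i * F1 (j * (x \<bullet> x))))) (at x)" for i x
    unfolding p1
    by (rule has_derivative_mult_right[OF has_derivative_mult[OF nth has_derivative_compose[OF d F1[unfolded has_field_derivative_def]]]])
  have p2: "partial_deriv k (partial_deriv i \<phi>) =
      (\<lambda>x. 2 * j * (x $ i * (F2 (j * (x \<bullet> x)) * (2 * j * x $ k)) + axis k 1 $ i * F1 (j * (x \<bullet> x))))" for i k
    by (rule ext) (simp add: partial_deriv_eqI[OF d1] inner_axis)
  have "C2_on (ball 0 1) \<phi>"
    unfolding C2_on_def
  proof (intro conjI ballI allI)
    show "\<phi> differentiable at x" "partial_deriv i \<phi> differentiable at x" for x i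
      using d\<phi> d1 unfolding differentiable_def by blast+
    show "continuous_on (ball 0 1) (partial_deriv i (partial_deriv k \<phi>))" for i k
      unfolding p2
      by (intro continuous_intros continuous_on_compose2[OF F2] continuous_on_compose2[OF F1_cont]) auto
  qed
  moreover have "continuous_on (cball 0 1) \<phi>"
    using d\<phi> by (meson continuous_at_imp_continuous_on has_derivative_continuous)
  moreover have "- laplacian \<phi> x = j * \<phi> x" for x
  proof -
    have sq: "(\<Sum>i\<in>UNIV. x $ i * x $ i) = x \<bullet> x" by (simp add: inner_vec_def)
    have "laplacian \<phi> x = (\<Sum>i\<in>UNIV. 4 * j * j * F2 (j * (x \<bullet> x)) * (x $ i * x $ i) + 2 * j * F1 (j * (x \<bullet> x)))"
      unfolding laplacian_def p2 by (rule sum.cong) (simp_all add: algebra_simps axis_def)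
    also have "\<dots> = 4 * j * j * F2 (j * (x \<bullet> x)) * (x \<bullet> x) + ?n * (2 * j * F1 (j * (x \<bullet> x)))"
      by (simp add: sum.distrib sum_distrib_left[symmetric] sq)
    also have "\<dots> = j * (4 * (j * (x \<bullet> x)) * F2 (j * (x \<bullet> x)) + 2 * ?n * F1 (j * (x \<bullet> x)))"
      by (simp add: algebra_simps)
    also have "\<dots> = j * (- F (j * (x \<bullet> x)))"
      using ode[of "j * (x \<bullet> x)"] by (simp add: add_eq_0_iff2)
    finally show ?thesis by (simp add: \<phi>_def)
  qed
  moreover have "\<phi> x = 0" if "x \<in> sphere 0 1" for x
    using that j by (simp add: \<phi>_def dot_square_norm)
  ultimately have "dirichlet_solution (ball 0 1) (\<lambda>t. j * t) \<phi>"
    by (simp add: dirichlet_solution_def)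
  moreover have "\<phi> 0 \<noteq> 0" by (simp add: \<phi>_def F0)
  ultimately show ?thesis unfolding dirichlet_eigenvalue_def by (intro exI[of _ j] exI[of _ \<phi>]) (auto intro!: bexI[of _ 0])
qed

text \<open>The infimum of the empty set of reals is unspecified, so the lower bound alone would not suffice.\<close>

lemma first_dirichlet_eigenvalue_ball_pos: "first_dirichlet_eigenvalue (ball (0::real^'n::finite) 1) > 0"
proof -
  have "real CARD('n) \<le> first_dirichlet_eigenvalue (ball (0::real^'n) 1)"
    unfolding first_dirichlet_eigenvalue_def
    using ex_dirichlet_eigenvalue_ball dirichlet_eigenvalue_ball_ge by (intro cInf_greatest) auto
  moreover have "0 < real CARD('n)" by simp
  ultimately show ?thesis by linarith
qed

section \<open>Limits along the family\<close>

text \<open>The one-sided limit is tested on arbitrary positive sequences tending to 0. With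
  \<sigma> = M^\<beta>, the identities \<beta> (n-2)/2 = 1 and \<beta> (n-4) = 2 - 2\<beta>
  translate between the maxima and the scales.\<close>

lemma radial_family_limits:
  fixes u :: "real \<Rightarrow> real^'n::finite \<Rightarrow> real" and r :: "real \<Rightarrow> real"
  assumes n: "CARD('n) \<ge> 5" and L: "L > 0"
    and sol: "\<And>l. \<lbrakk>0 < l; l < L\<rbrakk> \<Longrightarrow> BN_solution l (u l) \<and> radial (u l) \<and> u l 0 > 0 \<and> is_node (u l) (r l)"
  shows "((\<lambda>l. M_pos (u l) powr (2 - 2 * beta_exp CARD('n)) * r l ^ (CARD('n) - 2) * l)
            \<longlongrightarrow> c_limit CARD('n)) (at_right 0)" (is "(?X \<longlongrightarrow> _) _")
    and "((\<lambda>l. M_neg (u l) powr (2 - 2 * beta_exp CARD('n)) * l) \<longlongrightarrow> c_limit CARD('n)) (at_right 0)"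
      (is "(?Y \<longlongrightarrow> _) _")
proof -
  let ?n = "CARD('n)" and ?m = "(real CARD('n) - 2) / 2"
  define \<beta> where "\<beta> = beta_exp ?n"
  have \<beta>m: "\<beta> * ?m = 1" using n by (simp add: \<beta>_def beta_exp_def)
  have power: "(M powr \<beta>) powr ?m = M" "(M powr \<beta>) ^ (?n - 4) = M powr (2 - 2 * beta_exp ?n)" if "M > 0" for M
  proof -
    show "(M powr \<beta>) powr ?m = M" using that by (simp only: powr_powr \<beta>m powr_one less_imp_le)
    define R where "R = real ?n - 2"
    have R: "R > 0" "real ?n = R + 2" using n by (auto simp: R_def)
    have "\<beta> * real (?n - 4) = 2 - 2 * beta_exp ?n"
      using n R(1) by (simp add: of_nat_diff \<beta>_def beta_exp_def R(2) field_simps)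
    then show "(M powr \<beta>) ^ (?n - 4) = M powr (2 - 2 * beta_exp ?n)"
      using that by (simp add: powr_realpow[symmetric] powr_powr)
  qed
  have "(?X \<circ> l) \<longlonglongrightarrow> c_limit ?n \<and> (?Y \<circ> l) \<longlonglongrightarrow> c_limit ?n"
    if l_pos: "\<And>j. l j > 0" and l0: "l \<longlonglongrightarrow> 0" for l
  proof -
    define P where "P j z \<longleftrightarrow> (case z of (w, K, s) \<Rightarrow>
      radial_arc ?n (l j) 0 (r (l j)) w K \<and> w 0 = M_pos (u (l j)) \<and> w (r (l j)) = 0 \<and> K 0 = 0
      \<and> radial_arc ?n (l j) (r (l j)) s (\<lambda>x. - w x) (\<lambda>x. - K x) \<and> (\<forall>x\<in>{r (l j)..s}. - w x \<le> - w s)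
      \<and> radial_arc ?n (l j) s 1 (\<lambda>x. - w x) (\<lambda>x. - K x) \<and> - w s = M_neg (u (l j)) \<and> w 1 = 0 \<and> K s = 0
      \<and> M_pos (u (l j)) > 0 \<and> M_neg (u (l j)) > 0)" for j z
    have "\<exists>z. P j z" if j: "l j < L" for j
    proof -
      note sol' = sol[OF l_pos j]
      obtain w K s where *: "radial_arc ?n (l j) 0 (r (l j)) w K" "w 0 = M_pos (u (l j))" "w (r (l j)) = 0" "K 0 = 0"
        "radial_arc ?n (l j) (r (l j)) s (\<lambda>x. - w x) (\<lambda>x. - K x)" "\<And>x. x \<in> {r (l j)..s} \<Longrightarrow> - w x \<le> - w s"
        "radial_arc ?n (l j) s 1 (\<lambda>x. - w x) (\<lambda>x. - K x)" "- w s = M_neg (u (l j))" "w 1 = 0" "K s = 0"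
        using nodal_arcs[OF n l_pos, of j "u (l j)" "r (l j)"] sol' by blast
      interpret inner: decreasing_arc ?n "l j" 0 "r (l j)" w K
        using *(1,4) by (simp add: decreasing_arc_def decreasing_arc_axioms_def)
      have r: "0 < r (l j)" "r (l j) < s"
        using *(1,5) by (auto simp: radial_arc_def)
      have "0 < w (r (l j) / 2)" using r by (intro inner.w_pos) auto
      also have "\<dots> \<le> w 0" using r by (intro inner.w_antimono) auto
      finally have "M_pos (u (l j)) > 0" using *(2) by simp
      moreover have "0 < - w ((r (l j) + s) / 2)" using r by (intro radial_arc.w_pos[OF *(5)]) auto
      then have "0 < - w s" using *(6)[of "(r (l j) + s) / 2"] r by auto
      moreover have "\<forall>x\<in>{r (l j)..s}. w s \<le> w x" using *(6) by fastforce
      ultimately have "P j (w, K, s)" unfolding P_def using * by simp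
      then show ?thesis by blast
    qed
    \<comment> \<open>The arcs exist only for \<open>l j < L\<close>, which holds eventually;
      putting this condition inside the existential allows a choice for every j.\<close>
    then have "\<forall>j. \<exists>z. l j < L \<longrightarrow> P j z" by blast
    then have "\<exists>z. \<forall>j. l j < L \<longrightarrow> P j (z j)" by (rule choice)
    then obtain z where z: "\<And>j. l j < L \<Longrightarrow> P j (z j)" by blast
    define w K s where "w j = fst (z j)" and "K j = fst (snd (z j))" and "s j = snd (snd (z j))" for j
    have zj: "z j = (w j, K j, s j)" for j by (simp add: w_def K_def s_def)
    have "\<forall>\<^sub>F j in sequentially. l j < L" using order_tendstoD(2)[OF l0 L] .
    then have ev: "\<forall>\<^sub>F j in sequentially. P j (w j, K j, s j)"
      by eventually_elim (metis z zj)
    define \<sigma> \<tau> where "\<sigma> j = M_pos (u (l j)) powr \<beta>" and "\<tau> j = M_neg (u (l j)) powr \<beta>" for j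
    have inner: "\<forall>\<^sub>F j in sequentially. radial_arc ?n (l j) 0 (r (l j)) (w j) (K j) \<and> \<sigma> j > 0
      \<and> w j 0 = \<sigma> j powr ?m \<and> w j (r (l j)) = 0 \<and> K j 0 = 0"
      using ev by eventually_elim (simp add: P_def \<sigma>_def power)
    have middle: "\<forall>\<^sub>F j in sequentially. radial_arc ?n (l j) (r (l j)) (s j) (\<lambda>x. - w j x) (\<lambda>x. - K j x)
      \<and> - w j (r (l j)) = 0 \<and> - K j (r (l j)) = - K j (r (l j))
      \<and> (\<forall>x\<in>{r (l j)..s j}. - w j x \<le> - w j (s j))"
      using ev by eventually_elim (unfold P_def prod.case, elim conjE, intro conjI; (assumption | simp))
    have outer: "\<forall>\<^sub>F j in sequentially. radial_arc ?n (l j) (s j) 1 (\<lambda>x. - w j x) (\<lambda>x. - K j x) \<and> \<tau> j > 0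
      \<and> - w j (s j) = \<tau> j powr ?m \<and> - w j 1 = 0 \<and> - K j (s j) = 0"
      using ev by eventually_elim (simp add: P_def \<tau>_def power)
    note lims = two_arc_limits[OF n l0 inner middle outer]
    have "\<forall>\<^sub>F j in sequentially. \<sigma> j ^ (?n - 4) * r (l j) ^ (?n - 2) * l j = (?X \<circ> l) j"
      using ev by eventually_elim (simp add: P_def \<sigma>_def power)
    moreover have "\<forall>\<^sub>F j in sequentially. \<tau> j ^ (?n - 4) * l j = (?Y \<circ> l) j"
      using ev by eventually_elim (simp add: P_def \<tau>_def power)
    ultimately show ?thesis using lims by (blast intro: Lim_transform_eventually)
  qed
  then show "(?X \<longlongrightarrow> c_limit ?n) (at_right 0)" "(?Y \<longlongrightarrow> c_limit ?n) (at_right 0)"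
    unfolding tendsto_at_iff_sequentially by auto
qed

theorem theorem2:
  fixes u :: "real \<Rightarrow> real^'n::finite \<Rightarrow> real" and r :: "real \<Rightarrow> real"
  assumes n_ge_7: "CARD('n) \<ge> 7"
    and least_energy: "\<And>l. \<lbrakk>0 < l; l < first_dirichlet_eigenvalue (ball (0::real^'n) 1)\<rbrakk>
        \<Longrightarrow> least_energy_radial_sign_changing l (u l)"
    and pos_at_0: "\<And>l. \<lbrakk>0 < l; l < first_dirichlet_eigenvalue (ball (0::real^'n) 1)\<rbrakk>
        \<Longrightarrow> u l 0 > 0"
    and node: "\<And>l. \<lbrakk>0 < l; l < first_dirichlet_eigenvalue (ball (0::real^'n) 1)\<rbrakk>
        \<Longrightarrow> is_node (u l) (r l)"
  shows "((\<lambda>l. M_pos (u l) powr (2 - 2 * beta_exp CARD('n)) * r l ^ (CARD('n) - 2) * l)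
            \<longlongrightarrow> c_limit CARD('n)) (at_right 0)
    \<and> ((\<lambda>l. M_neg (u l) powr (2 - 2 * beta_exp CARD('n)) * l)
            \<longlongrightarrow> c_limit CARD('n)) (at_right 0)
    \<and> ((\<lambda>l. M_neg (u l) powr (2 - 2 * beta_exp CARD('n))
              / (M_pos (u l) powr (2 - 2 * beta_exp CARD('n)) * r l ^ (CARD('n) - 2)))
            \<longlongrightarrow> 1) (at_right 0)"
proof -
  have n: "CARD('n) \<ge> 5" using n_ge_7 by simp
  note lims = radial_family_limits[OF n first_dirichlet_eigenvalue_ball_pos, of u r]
  have sol: "BN_solution l (u l) \<and> radial (u l) \<and> u l 0 > 0 \<and> is_node (u l) (r l)"
    if "0 < l" "l < first_dirichlet_eigenvalue (ball (0::real^'n) 1)" for l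
    using least_energy[OF that] pos_at_0[OF that] node[OF that]
    by (simp add: least_energy_radial_sign_changing_def radial_sign_changing_solution_def)
  have "c_limit CARD('n) \<noteq> 0" using c_limit_pos[OF n] by simp
  from tendsto_divide[OF lims(2)[OF sol] lims(1)[OF sol] this]
  have "((\<lambda>l. (M_neg (u l) powr (2 - 2 * beta_exp CARD('n)) * l) /
      (M_pos (u l) powr (2 - 2 * beta_exp CARD('n)) * r l ^ (CARD('n) - 2) * l)) \<longlongrightarrow> 1) (at_right 0)"
    using \<open>c_limit CARD('n) \<noteq> 0\<close> by simp
  moreover have "\<forall>\<^sub>F l in at_right (0::real). l \<noteq> 0" by (simp add: eventually_at_filter)
  then have "\<forall>\<^sub>F l in at_right 0. (M_neg (u l) powr (2 - 2 * beta_exp CARD('n)) * l) /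
      (M_pos (u l) powr (2 - 2 * beta_exp CARD('n)) * r l ^ (CARD('n) - 2) * l)
    = M_neg (u l) powr (2 - 2 * beta_exp CARD('n))
      / (M_pos (u l) powr (2 - 2 * beta_exp CARD('n)) * r l ^ (CARD('n) - 2))"
    by eventually_elim simp
  ultimately have "((\<lambda>l. M_neg (u l) powr (2 - 2 * beta_exp CARD('n))
      / (M_pos (u l) powr (2 - 2 * beta_exp CARD('n)) * r l ^ (CARD('n) - 2))) \<longlongrightarrow> 1) (at_right 0)"
    by (rule Lim_transform_eventually)
  with lims[OF sol] show ?thesis by blast
qed

end
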